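(* The measures $\nu[Q_{n,n}]$ converge in the weak-$*$ sense to $\mu_\Gamma$ as $n\to\infty$, where $\mu_\Gamma$ is the equilibrium measure on $\Gamma$. The support of $\mu_\Gamma$ is $\Gamma$. The measure $\mu_\Gamma$ is the pre-image of the normalized arc-length measure on the unit circle $\{|w|=1\}$ under the mapping $\varphi(z)=\frac{(z+1)^2}{4z}$ from $\Gamma$ to the unit circle, i.e. $\mu_\Gamma(B)=\mathfrak{m}(\varphi(B\cap\Gamma))$ for every Borel set $B\subset\mathbb{C}$. The logarithmic capacity of $\Gamma$ equals $4$. Moreover, for $n$ large enough and all $m\in\mathbb{Z}_+$, the zeros of $Q_{n,m}$ are inside $\Gamma$.
   Context: For nonnegative integers $n,m$, $Q_{n,m}(z)=\sum_{k=0}^n\binom{n+m}{k+m}z^k$. The curve is $$\Gamma=\left\{z\in\mathbb{C}:\left|\tfrac{(z+1)^2}{4z}\right|=1\text{ and }|z|\ge 1\right\}.$$ The normalized zero counting measure is $\nu[Q_{n,n}]=\frac1n\sum_{\zeta:\,Q_{n,n}(\zeta)=0}\delta_\zeta$ (zeros counted with multiplicity). Weak-$*$ convergence means convergence of integrals of every continuous compactly supported function on $\mathbb{C}$. $\mathfrak{m}$ denotes the normalized arc-length $d\theta/(2\pi)$ on the unit circle. The equilibrium measure is the unique probability measure on $\Gamma$ minimizing the logarithmic energy.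
   Formalization: In the last sentence, "n large enough" is read as n ≥ max(N, m) with N independent of m, since with one threshold for all m the claim is false (for fixed n ≥ 1 the zeros of Q_{n,m} cannot stay inside the bounded curve Γ as m → ∞). *)

theory Defs
  imports "HOL-Probability.Probability" "HOL-Computational_Algebra.Polynomial"
begin

definition Q :: "nat \<Rightarrow> nat \<Rightarrow> complex poly" where
  "Q n m = (\<Sum>k\<le>n. monom (of_nat ((n + m) choose (k + m))) k)"

definition phi :: "complex \<Rightarrow> complex" where
  "phi z = (z + 1)\<^sup>2 / (4 * z)"

definition Gamma_curve :: "complex set" where
  "Gamma_curve = {z. norm (phi z) = 1 \<and> norm z \<ge> 1}"

text \<open>The normalized zero counting measure, with the atom at each zero \<open>\<zeta>\<close> weighted by
  (multiplicity of \<open>\<zeta>\<close>) / (degree); see \<open>emeasure_zero_counting_measure\<close> below.\<close>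

definition zero_counting_measure :: "complex poly \<Rightarrow> complex measure" where
  "zero_counting_measure p =
     distr (density (count_space {\<zeta>. poly p \<zeta> = 0})
              (\<lambda>\<zeta>. ennreal (real (order \<zeta> p) / real (degree p))))
       borel (\<lambda>\<zeta>. \<zeta>)"

definition weak_star_conv :: "(nat \<Rightarrow> complex measure) \<Rightarrow> complex measure \<Rightarrow> bool" where
  "weak_star_conv M N \<longleftrightarrow>
     (\<forall>f :: complex \<Rightarrow> complex.
        continuous_on UNIV f \<and> compact (closure {z. f z \<noteq> 0}) \<longrightarrow>
        (\<lambda>n. \<integral>z. f z \<partial>M n) \<longlonglongrightarrow> (\<integral>z. f z \<partial>N))"

definition circle_measure :: "complex measure" where
  "circle_measure = distr (uniform_measure lborel {0..2 * pi}) borel cis"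

definition prob_measure_on :: "complex set \<Rightarrow> complex measure \<Rightarrow> bool" where
  "prob_measure_on K \<mu> \<longleftrightarrow> sets \<mu> = sets borel \<and> prob_space \<mu> \<and> emeasure \<mu> K = 1"

text \<open>The energy \<open>\<integral>\<integral> log (1 / |z - t|) d\<mu>(t) d\<mu>(z)\<close>, as the difference of the integrals of the
  positive and the negative part of the kernel (\<open>ennreal\<close> truncates negative reals to \<open>0\<close>).
  The value may be \<open>\<infinity>\<close>, which the Bochner integral could not express. If \<open>\<mu>\<close> has compact support
  and finite mass, the integral of the negative part is finite, so \<open>\<infinity> - \<infinity>\<close> does not arise.\<close>

definition log_energy :: "complex measure \<Rightarrow> ereal" where
  "log_energy \<mu> =
     enn2ereal (\<integral>\<^sup>+z. (\<integral>\<^sup>+t. (if z = t then \<infinity> else ennreal (ln (1 / norm (z - t)))) \<partial>\<mu>) \<partial>\<mu>)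
   - enn2ereal (\<integral>\<^sup>+z. (\<integral>\<^sup>+t. (if z = t then 0 else ennreal (- ln (1 / norm (z - t)))) \<partial>\<mu>) \<partial>\<mu>)"

definition minimizes_log_energy :: "complex set \<Rightarrow> complex measure \<Rightarrow> bool" where
  "minimizes_log_energy K \<mu> \<longleftrightarrow>
     prob_measure_on K \<mu> \<and> (\<forall>\<nu>. prob_measure_on K \<nu> \<longrightarrow> log_energy \<mu> \<le> log_energy \<nu>)"

text \<open>Meaningful only if the minimizer exists and is unique.\<close>

definition equilibrium_measure :: "complex set \<Rightarrow> complex measure" where
  "equilibrium_measure K = (THE \<mu>. minimizes_log_energy K \<mu>)"

definition robin_constant :: "complex set \<Rightarrow> ereal" where
  "robin_constant K = (INF \<mu> \<in> {\<mu>. prob_measure_on K \<mu>}. log_energy \<mu>)"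

text \<open>\<open>cap K = exp (- V)\<close> with \<open>V\<close> the infimum of the energies, and \<open>exp (- \<infinity>) = 0\<close>.
  For compact \<open>K\<close> the value \<open>V = - \<infinity>\<close> does not occur.\<close>

definition logarithmic_capacity :: "complex set \<Rightarrow> real" where
  "logarithmic_capacity K =
     (if robin_constant K = \<infinity> then 0 else exp (- real_of_ereal (robin_constant K)))"

definition measure_support :: "complex measure \<Rightarrow> complex set" where
  "measure_support \<mu> = {z. \<forall>U. open U \<and> z \<in> U \<longrightarrow> emeasure \<mu> U > 0}"

lemma coeff_Q: "coeff (Q n m) k = (if k \<le> n then of_nat ((n + m) choose (k + m)) else 0)"
  by (simp add: Q_def coeff_sum)

lemma poly_Q: "poly (Q n m) z = (\<Sum>k\<le>n. of_nat ((n + m) choose (k + m)) * z ^ k)"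
  by (simp add: Q_def poly_sum poly_monom)

lemma degree_Q: "degree (Q n m) = n"
proof (rule antisym)
  show "degree (Q n m) \<le> n"
    by (rule degree_le) (simp add: coeff_Q)
  show "n \<le> degree (Q n m)"
    by (rule le_degree) (simp add: coeff_Q)
qed

lemma emeasure_zero_counting_measure:
  assumes "p \<noteq> 0" "B \<in> sets borel"
  shows "emeasure (zero_counting_measure p) B =
    (\<Sum>\<zeta> | poly p \<zeta> = 0. ennreal (real (order \<zeta> p) / real (degree p)) * indicator B \<zeta>)"
proof -
  have fin: "finite {\<zeta>. poly p \<zeta> = 0}"
    using assms(1) by (rule poly_roots_finite)
  have "emeasure (zero_counting_measure p) B =
      (\<integral>\<^sup>+\<zeta>. ennreal (real (order \<zeta> p) / real (degree p)) * indicator (B \<inter> {\<zeta>. poly p \<zeta> = 0}) \<zeta>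
         \<partial>count_space {\<zeta>. poly p \<zeta> = 0})"
    using assms(2) by (simp add: zero_counting_measure_def emeasure_distr emeasure_density)
  also have "\<dots> = (\<Sum>\<zeta> | poly p \<zeta> = 0.
      ennreal (real (order \<zeta> p) / real (degree p)) * indicator (B \<inter> {\<zeta>. poly p \<zeta> = 0}) \<zeta>)"
    using fin by (rule nn_integral_count_space_finite)
  also have "\<dots> = (\<Sum>\<zeta> | poly p \<zeta> = 0.
      ennreal (real (order \<zeta> p) / real (degree p)) * indicator B \<zeta>)"
    by (rule sum.cong) (auto simp: indicator_def)
  finally show ?thesis .
qed

end

theory Submission
  imports Defs "HOL-Complex_Analysis.Complex_Analysis" "HOL-Real_Asymp.Real_Asymp"
    "HOL-Computational_Algebra.Computational_Algebra"
begin

text \<open>The map \<open>phi\<close> takes \<open>|z| > 1\<close> conformally onto the complement of \<open>[0, 1]\<close>; let \<open>psi\<close> be the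
  inverse branch. The candidate equilibrium measure is the image of arc length under \<open>psi\<close>. With
  \<open>\<zeta> = psi w\<close> and \<open>u = phi z\<close> one has \<open>4 (w - u) = (\<zeta> - z) (1 - 1 / (\<zeta> z))\<close>, and the logarithms of
  \<open>|w - u|\<close> and \<open>|1 - 1 / (\<zeta> z)|\<close> have mean zero over the circle, so the potential is constant on the
  curve. As \<open>- ln r\<close> is a mixture of Gaussians up to constants, and Gaussian kernels are
  positive definite, the logarithmic energy is positive definite on differences of probability
  measures; hence the candidate is the unique minimizer, with energy \<open>- ln 4\<close>.

  For the zeros \<open>\<zeta>\<close> of \<open>Q n n\<close>, Newton's identities give their power sums: \<open>2 n (-1)^k\<close> for
  \<open>1 \<le> k \<le> n\<close>, and \<open>O(1)\<close> for each fixed negative exponent. Since \<open>phi\<close> is a Laurent polynomial, the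
  averages of \<open>phi(\<zeta>)^k\<close> tend to \<open>0\<close> for \<open>k \<ge> 1\<close>, as for arc length. The reflection formula
  \<open>(4 phi(\<zeta>))^n = Q(1 / \<zeta>) - (2n choose n)\<close> together with a summation by parts shows that the zeros
  approach the curve, where trigonometric polynomials in \<open>phi\<close> are dense.\<close>

text \<open>Analytic moments alone do not identify the limit: the unit mass at z = -1, where
  \<open>phi\<close> vanishes, has the same \<open>phi\<close>-moments as the equilibrium measure.
  It is excluded only because the zeros accumulate at the curve. There |phi| = 1, so conjugates act
  as negative powers and the moments become Fourier coefficients. Hence test functions are
  approximated on the curve only, while the zeros stay in a compact region next to it. The moments
  come from comparison: reversed, \<open>Q n n\<close> agrees up to degree n with (1 + x)^(2n),
  whose zeros are all -1; divided by its constant term, \<open>Q n n\<close> has coefficients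
  bounded by 1 for every n. The number 4 is the reciprocal of the leading coefficient of phi(z) =
  z/4 + 1/2 + 1/(4z), the exterior map of the curve. Existence and uniqueness of the minimizer come
  together: the mixed energy of the candidate with any competitor on the curve is known exactly, so
  positive definiteness turns into an inequality between the two energies, and no compactness
  argument for measures is involved.\<close>

subsection \<open>The curve and the location of the zeros\<close>

text \<open>The closed region between the unit circle and the curve. It will contain all zeros of
  \<open>Q n n\<close>, is compact, and avoids the pole of \<open>phi\<close> at 0.\<close>

definition K_region :: "complex set" where
  "K_region = {z. norm z \<ge> 1 \<and> norm (phi z) \<le> 1}"

lemma continuous_on_phi: "continuous_on {z. norm z \<ge> 1} phi"
  unfolding phi_def[abs_def] by (intro continuous_intros) auto

text \<open>\<open>phi\<close> is rational of degree two and invariant under z -> 1/z, so t = z and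
  t = 1/z are the only solutions of phi z = phi t.\<close>

lemma phi_minus_phi:
  assumes "z \<noteq> 0" "t \<noteq> 0"
  shows "4 * (phi z - phi t) = (z - t) * (1 - 1 / (z * t))"
  using assms by (simp add: phi_def field_simps power2_eq_square)

lemma norm_phi_le_1:
  assumes "norm z = 1"
  shows "norm (phi z) \<le> 1"
proof -
  have "norm (z + 1) \<le> 2" using norm_triangle_ineq[of z 1] assms by simp
  then have "norm (z + 1) ^ 2 \<le> 2 ^ 2" by (intro power_mono) auto
  then show ?thesis using assms by (simp add: phi_def norm_divide norm_mult norm_power)
qed

text \<open>On the unit circle phi(e^(ia)) = cos(a/2)^2, so the curve touches the circle only at 1.
  This one contact point is why injectivity on the curve needs an argument.\<close>

lemma eq_1_if_norm_phi_eq_1: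
  assumes "norm z = 1" "norm (phi z) = 1"
  shows "z = 1"
proof -
  have "norm (z + 1) ^ 2 = 4"
    using assms by (simp add: phi_def norm_divide norm_mult norm_power)
  then have "(Re z + 1)^2 + (Im z)^2 = 4" by (simp add: cmod_power2)
  moreover have "(Re z)^2 + (Im z)^2 = 1" using assms(1) by (metis cmod_power2 one_power2)
  ultimately have "Re z = 1" by (simp add: power2_eq_square algebra_simps)
  moreover from this have "Im z = 0" using \<open>(Re z)^2 + (Im z)^2 = 1\<close> by simp
  ultimately have "Re z = 1" "Im z = 0" by simp_all
  then show ?thesis by (simp add: complex_eq_iff)
qed

lemma phi_inj:
  assumes "z \<in> Gamma_curve" "t \<in> Gamma_curve" "phi z = phi t"
  shows "z = t"
proof (rule ccontr)
  assume "z \<noteq> t"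
  have z: "norm z \<ge> 1" "norm t \<ge> 1" "z \<noteq> 0" "t \<noteq> 0" using assms by (auto simp: Gamma_curve_def)
  then have "1 / (z * t) = 1" using phi_minus_phi[of z t] assms(3) \<open>z \<noteq> t\<close> by simp
  then have zt: "z * t = 1" using z by (simp add: field_simps)
  then have "norm z * norm t = 1" by (metis norm_mult norm_one)
  then have "norm z = 1" "norm t = 1"
    using z mult_left_mono[of 1 "norm t" "norm z"] mult_right_mono[of 1 "norm z" "norm t"] by auto
  then have "z = 1" "t = 1" using eq_1_if_norm_phi_eq_1 assms by (auto simp: Gamma_curve_def)
  then show False using \<open>z \<noteq> t\<close> by simp
qed

lemma closed_exterior_sublevel:
  assumes "closed (S :: complex set)"
  shows "closed {z. norm z \<ge> 1 \<and> phi z \<in> S}"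
proof -
  have "closed ({z::complex. norm z \<ge> 1} \<inter> phi -` S)"
    by (intro continuous_closed_preimage continuous_on_phi assms closed_Collect_le continuous_intros)
  then show ?thesis by (simp add: Int_def vimage_def)
qed

text \<open>The estimate (r - 1)^2 <= 4 r for r = |z| means r <= 3 + 2 sqrt 2 < 6.\<close>

lemma K_region_bounded:
  assumes "z \<in> K_region"
  shows "norm z \<le> 6"
proof (rule ccontr)
  assume "\<not> norm z \<le> 6"
  then have r: "norm z > 6" by simp
  have "norm (z + 1) ^ 2 \<le> 4 * norm z"
    using assms by (simp add: K_region_def phi_def norm_divide norm_mult norm_power divide_simps split: if_splits)
  moreover have "norm z - 1 \<le> norm (z + 1)" using norm_diff_ineq[of z 1] by simp
  then have "(norm z - 1)^2 \<le> norm (z + 1) ^ 2" using r by (intro power_mono) auto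
  ultimately have "(norm z - 1)^2 \<le> 4 * norm z" by simp
  moreover have "norm z * norm z > 6 * norm z" using r by (intro mult_strict_right_mono) auto
  ultimately show False by (simp add: power2_eq_square algebra_simps)
qed

lemma closed_K_region: "closed K_region"
  using closed_exterior_sublevel[of "cball 0 1"] by (simp add: K_region_def)

lemma compact_K_region: "compact K_region"
  using closed_K_region K_region_bounded by (auto simp: compact_eq_bounded_closed bounded_iff)

lemma closed_Gamma: "closed Gamma_curve"
proof -
  have "Gamma_curve = {z. norm z \<ge> 1 \<and> phi z \<in> sphere 0 1}" by (auto simp: Gamma_curve_def)
  then show ?thesis using closed_exterior_sublevel[of "sphere 0 1"] by simp
qed

lemma Gamma_subset_K: "Gamma_curve \<subseteq> K_region"
  by (auto simp: Gamma_curve_def K_region_def)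

lemma compact_Gamma: "compact Gamma_curve"
  using compact_K_region Gamma_subset_K closed_Gamma
  by (metis compact_Int_closed inf.absorb2)

text \<open>The complement of the curve is covered by two disjoint open sets, the bounded
  \<open>- E\<close> and the exterior \<open>C\<close>, so a component meeting \<open>- E\<close>
  stays in it; the Jordan curve theorem is not involved. Openness is obtained from closed
  complements, since \<open>phi\<close> is continuous only away from 0.\<close>

lemma inside_Gamma:
  assumes "\<not> (norm z \<ge> 1 \<and> norm (phi z) \<ge> 1)"
  shows "z \<in> inside Gamma_curve"
proof -
  define E where "E = {z. norm z \<ge> 1 \<and> norm (phi z) \<ge> 1}"
  define C where "C = {z. norm z > 1 \<and> norm (phi z) > 1}"
  have "E = {z. norm z \<ge> 1 \<and> phi z \<in> - ball 0 1}" by (auto simp: E_def)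
  then have "closed E" using closed_exterior_sublevel[of "- ball 0 1"] open_ball closed_Compl by metis
  then have oE: "open (- E)" by (rule open_Compl)
  have C_eq: "C = - ({z. norm z \<le> 1} \<union> K_region)"
    using norm_phi_le_1 by (auto simp: C_def K_region_def not_le)
  have "closed {z::complex. norm z \<le> 1}" by (intro closed_Collect_le continuous_intros)
  then have oC: "open C" unfolding C_eq using closed_K_region by blast
  \<comment> \<open>A point of \<open>E\<close> off the curve has |phi| > 1 and therefore cannot lie
    on the unit circle.\<close>
  have cov: "- Gamma_curve \<subseteq> - E \<union> C"
    using norm_phi_le_1 by (auto simp: E_def C_def Gamma_curve_def) (metis le_less order_antisym)+
  have disj: "- E \<inter> C = {}" by (auto simp: E_def C_def)
  have bd: "bounded (- E)"
    unfolding bounded_iff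
  proof (intro exI ballI)
    fix z assume "z \<in> - E"
    then have "norm z \<le> 1 \<or> z \<in> K_region" by (auto simp: E_def K_region_def)
    then show "norm z \<le> 6" using K_region_bounded by force
  qed
  define S where "S = connected_component_set (- Gamma_curve) z"
  have zE: "z \<in> - E" using assms by (simp add: E_def)
  have zG: "z \<notin> Gamma_curve" using assms by (auto simp: Gamma_curve_def)
  have "connected S" unfolding S_def by simp
  moreover have "S \<subseteq> - Gamma_curve" unfolding S_def by (rule connected_component_subset)
  moreover have "z \<in> S" unfolding S_def using zG by simp
  ultimately have "C \<inter> S = {}"
    using connectedD[OF \<open>connected S\<close> oE oC] cov disj zE by blast
  then have "S \<subseteq> - E" using cov \<open>S \<subseteq> - Gamma_curve\<close> by blast
  then have "bounded S" using bd bounded_subset by blast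
  then show ?thesis using zG by (simp add: inside_def S_def)
qed

text \<open>The shift by m in the binomials makes z^m Q the upper part of the expansion of (1 +
  z)^(n + m). At a zero, the whole power thus equals its lower part, of degree less than m.\<close>

lemma poly_Q_times_power:
  "z ^ m * poly (Q n m) z = (1 + z) ^ (n + m) - (\<Sum>j<m. of_nat ((n + m) choose j) * z ^ j)"
proof -
  have "z ^ m * poly (Q n m) z = (\<Sum>k\<le>n. of_nat ((n + m) choose (k + m)) * z ^ (k + m))"
    by (simp add: poly_Q sum_distrib_left power_add mult_ac)
  also have "\<dots> = (\<Sum>j=m..n+m. of_nat ((n + m) choose j) * z ^ j)"
    by (rule sum.reindex_bij_witness[of _ "\<lambda>j. j - m" "\<lambda>k. k + m"]) auto
  finally have 1: "z ^ m * poly (Q n m) z = (\<Sum>j=m..n+m. of_nat ((n + m) choose j) * z ^ j)" .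
  have "(1 + z) ^ (n + m) = (\<Sum>j\<le>n+m. of_nat ((n + m) choose j) * z ^ j)"
    by (subst add.commute) (simp add: binomial_ring)
  also have "{..n+m} = {..<m} \<union> {m..n+m}" by auto
  also have "(\<Sum>j\<in>{..<m} \<union> {m..n+m}. of_nat ((n + m) choose j) * z ^ j) =
      (\<Sum>j<m. of_nat ((n + m) choose j) * z ^ j) + (\<Sum>j=m..n+m. of_nat ((n + m) choose j) * z ^ j)"
    by (rule sum.union_disjoint) auto
  finally show ?thesis using 1 by simp
qed

lemma sum_choose_lower_less:
  assumes "m \<le> n"
  shows "(\<Sum>j<m. (n + m) choose j) < 2 ^ (n + m)"
proof -
  have "(\<Sum>j<m. (n + m) choose j) < (\<Sum>j\<le>n+m. (n + m) choose j)"
    by (rule sum_strict_mono2[of _ _ "n + m"]) (use assms in auto)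
  then show ?thesis by (simp add: choose_row_sum)
qed

text \<open>In the closed exterior |1 + z| >= 2 sqrt |z|, which makes the full power (1 + z)^(n + m)
  at least 2^(n + m) |z|^m. The lower part is strictly smaller, because its binomials do not exhaust
  the row sum 2^(n + m).\<close>

lemma zeros_not_exterior:
  assumes "m \<le> n" "poly (Q n m) z = 0"
  shows "\<not> (norm z \<ge> 1 \<and> norm (phi z) \<ge> 1)"
proof
  assume z: "norm z \<ge> 1 \<and> norm (phi z) \<ge> 1"
  then have z1: "norm z \<ge> 1" and "4 * norm z \<le> norm (z + 1) ^ 2"
    by (auto simp: phi_def norm_divide norm_mult norm_power divide_simps split: if_splits)
  then have "sqrt (4 * norm z) \<le> norm (z + 1)" by (simp add: real_le_lsqrt)
  then have le: "2 * sqrt (norm z) \<le> norm (1 + z)" by (simp add: real_sqrt_mult add.commute)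
  have s1: "sqrt (norm z) \<ge> 1" using z1 by simp
  have "2 ^ (n + m) * norm z ^ m = 2 ^ (n + m) * sqrt (norm z) ^ (m + m)"
    by (simp add: power_add flip: power_mult_distrib real_sqrt_mult)
  \<comment> \<open>Here m <= n enters: the power of sqrt |z| available is n + m, the one required
    is 2 m.\<close>
  also have "\<dots> \<le> 2 ^ (n + m) * sqrt (norm z) ^ (n + m)"
    using assms s1 by (intro mult_left_mono power_increasing) auto
  also have "\<dots> = (2 * sqrt (norm z)) ^ (n + m)" by (simp add: power_mult_distrib)
  also have "\<dots> \<le> norm (1 + z) ^ (n + m)" using le z1 by (intro power_mono) auto
  also have "\<dots> = norm (\<Sum>j<m. of_nat ((n + m) choose j) * z ^ j)"
    using poly_Q_times_power[of z m n] assms(2) by (simp flip: norm_power)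
  also have "\<dots> \<le> (\<Sum>j<m. norm (of_nat ((n + m) choose j) * z ^ j))" by (rule norm_sum)
  also have "\<dots> \<le> (\<Sum>j<m. of_nat ((n + m) choose j) * norm z ^ m)"
    by (intro sum_mono) (auto simp: norm_mult norm_power intro!: mult_left_mono power_increasing z1)
  also have "\<dots> = of_nat (\<Sum>j<m. (n + m) choose j) * norm z ^ m" by (simp add: sum_distrib_right)
  also have "\<dots> < 2 ^ (n + m) * norm z ^ m"
  proof (rule mult_strict_right_mono)
    show "real (\<Sum>j<m. n + m choose j) < 2 ^ (n + m)"
      using sum_choose_lower_less[OF assms(1)] by (metis of_nat_less_iff of_nat_numeral of_nat_power)
      show "0 < norm z ^ m" using z1 by (intro zero_less_power) linarith
  qed
  finally show False by simp
qed

subsection \<open>Power sums of the zeros\<close>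

text \<open>Logarithmic derivative of the product: each factor contributes - m a / (1 - a X),
  expanded as a geometric series.\<close>

lemma fps_deriv_prod_linear:
  fixes a :: "'b \<Rightarrow> complex" and m :: "'b \<Rightarrow> nat"
  assumes "finite S"
  shows "fps_deriv (\<Prod>x\<in>S. (1 - fps_const (a x) * fps_X) ^ m x) =
     - (\<Prod>x\<in>S. (1 - fps_const (a x) * fps_X) ^ m x) * Abs_fps (\<lambda>k. \<Sum>x\<in>S. of_nat (m x) * a x ^ Suc k)"
  using assms
proof (induction S rule: finite_induct)
  case empty
  then show ?case by (simp add: fps_eq_iff)
next
  case (insert y S)
  define g where "g = 1 - fps_const (a y) * fps_X"
  define h where "h = Abs_fps (\<lambda>k. a y ^ Suc k)"
  define P where "P = (\<Prod>x\<in>S. (1 - fps_const (a x) * fps_X) ^ m x)"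
  define T where "T = Abs_fps (\<lambda>k. \<Sum>x\<in>S. of_nat (m x) * a x ^ Suc k)"
  have gh: "g * h = fps_const (a y)"
  proof (rule fps_ext)
    fix n
    show "fps_nth (g * h) n = fps_nth (fps_const (a y)) n"
      by (cases n) (simp_all add: g_def h_def left_diff_distrib mult.assoc)
  qed
  have "fps_deriv (g ^ m y) = - (g ^ m y) * (of_nat (m y) * h)"
  proof (cases "m y")
    case (Suc l)
    have dg: "fps_deriv g = - fps_const (a y)" by (simp add: g_def)
    have "fps_deriv (g ^ m y) = - (of_nat (m y) * (g * h) * g ^ l)"
      by (simp only: fps_deriv_power' dg gh Suc diff_Suc_1 mult_minus_left mult_minus_right)
    then show ?thesis using Suc by (simp add: mult_ac)
  qed simp
  then have "fps_deriv (g ^ m y * P) = - (g ^ m y * P) * (of_nat (m y) * h + T)"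
    using insert.IH[folded P_def T_def] by (simp only: fps_deriv_mult) (simp add: algebra_simps)
  also have "of_nat (m y) * h + T = Abs_fps (\<lambda>k. \<Sum>x\<in>insert y S. of_nat (m x) * a x ^ Suc k)"
    by (rule fps_ext) (simp add: T_def h_def insert.hyps flip: fps_of_nat)
  finally show ?case using insert.hyps by (simp add: P_def g_def)
qed

text \<open>Coefficient comparison in \<open>fps_deriv_prod_linear\<close>. Multiplicities are
  weights over an arbitrary index type, so that the zeros of \<open>Q n n\<close> and the single
  root of (1 + x)^(2n) are both instances.\<close>

lemma Newton_identity:
  fixes a :: "'b \<Rightarrow> complex" and m :: "'b \<Rightarrow> nat"
  assumes "finite S"
  defines "P \<equiv> \<Prod>x\<in>S. [:1, - a x:] ^ m x"
  shows "of_nat (Suc k) * coeff P (Suc k) =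
     - (\<Sum>i\<le>k. coeff P (k - i) * (\<Sum>x\<in>S. of_nat (m x) * a x ^ Suc i))"
proof -
  have lin: "fps_of_poly [:1, - c:] = 1 - fps_const c * fps_X" for c :: complex
    by (simp add: fps_of_poly_pCons)
  then have P: "fps_of_poly P = (\<Prod>x\<in>S. (1 - fps_const (a x) * fps_X) ^ m x)"
    by (simp only: P_def fps_of_poly_prod fps_of_poly_power lin)
  have "of_nat (Suc k) * coeff P (Suc k) = fps_nth (fps_deriv (fps_of_poly P)) k" by simp
  also have "\<dots> = - fps_nth (Abs_fps (\<lambda>k. \<Sum>x\<in>S. of_nat (m x) * a x ^ Suc k) * fps_of_poly P) k"
    unfolding P by (subst fps_deriv_prod_linear[OF assms(1)]) (simp add: mult.commute)
  also have "\<dots> = - (\<Sum>i\<le>k. coeff P (k - i) * (\<Sum>x\<in>S. of_nat (m x) * a x ^ Suc i))"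
    unfolding fps_mult_nth by (simp add: atLeast0AtMost mult.commute)
  finally show ?thesis .
qed

lemma coeff_0_prod_linear: "coeff (\<Prod>x\<in>S. [:1, - a x:] ^ m x) 0 = (1 :: complex)"
  by (simp add: poly_prod flip: poly_0_coeff_0)

section \<open>Zeros of \<open>Q n n\<close> and their power sums\<close>

definition zeros :: "nat \<Rightarrow> complex set" where
  "zeros n = {z. poly (Q n n) z = 0}"

definition power_sum :: "nat \<Rightarrow> (complex \<Rightarrow> complex) \<Rightarrow> complex" where
  "power_sum n f = (\<Sum>z\<in>zeros n. of_nat (order z (Q n n)) * f z)"

lemma Q_nonzero: "Q n m \<noteq> 0"
  using coeff_Q[of n m n] by auto

lemma finite_zeros: "finite (zeros n)"
  unfolding zeros_def using Q_nonzero by (rule poly_roots_finite)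

lemma zero_not_in_zeros: "z \<in> zeros n \<Longrightarrow> z \<noteq> 0"
  by (auto simp: zeros_def poly_0_coeff_0 coeff_Q)

lemma Q_decompose: "Q n n = (\<Prod>z\<in>zeros n. [:-z, 1:] ^ order z (Q n n))"
  using complex_poly_decompose[of "Q n n"] by (simp add: zeros_def coeff_Q degree_Q)

lemma power_sum_1: "power_sum n (\<lambda>_. 1) = of_nat n"
proof -
  have "n = degree (\<Prod>z\<in>zeros n. [:-z, 1:] ^ order z (Q n n))"
    using Q_decompose[of n] degree_Q by metis
  also have "\<dots> = (\<Sum>z\<in>zeros n. order z (Q n n))"
    by (subst degree_prod_sum_eq) (auto simp: degree_power_eq)
  finally show ?thesis by (simp add: power_sum_def flip: of_nat_sum)
qed

text \<open>Newton's identities recover the first n power sums from the first n coefficients. These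
  are the same for the reversed \<open>Q n n\<close> and for (1 + x)^(2n), whose power sums are 2 n
  (-1)^k.\<close>

lemma power_sum_pos:
  assumes "k \<ge> 1" "k \<le> n"
  shows "power_sum n (\<lambda>z. z ^ k) = 2 * of_nat n * (-1) ^ k"
proof -
  define P where "P = (\<Prod>z\<in>zeros n. [:1, - z:] ^ order z (Q n n))"
  \<comment> \<open>This is (1 + x)^(2n), written as a product over a one-element index set to fit
    \<open>Newton_identity\<close>.\<close>
  define B where "B = (\<Prod>x\<in>{()}. [:1, - (-1 :: complex):] ^ (2 * n))"
  have PR: "P = reflect_poly (Q n n)"
    by (subst Q_decompose) (simp add: P_def reflect_poly_prod reflect_poly_power reflect_poly_pCons zero_not_in_zeros)
  have cP: "coeff P j = of_nat ((2 * n) choose j)" if "j \<le> n" for j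
  proof -
    have "n - j + n = 2 * n - j" using that by simp
    then show ?thesis
      using that binomial_symmetric[of j "2 * n"]
      by (simp add: PR coeff_reflect_poly degree_Q coeff_Q flip: mult_2)
  qed
  have cB: "coeff B j = of_nat ((2 * n) choose j)" for j
  proof (cases "j \<le> 2 * n")
    case True
    then show ?thesis by (simp add: B_def coeff_linear_poly_power)
  next
    case False
    then show ?thesis
      using degree_power_eq[of "[:1, 1 :: complex:]" "2 * n"] by (simp add: B_def coeff_eq_0)
  qed
  define s where "s j = power_sum n (\<lambda>z. z ^ j)" for j
  have P: "of_nat (Suc k) * coeff P (Suc k) = - (\<Sum>i\<le>k. coeff P (k - i) * s (Suc i))" for k
    unfolding P_def s_def power_sum_def by (rule Newton_identity[OF finite_zeros])
  have B: "of_nat (Suc k) * coeff B (Suc k) = - (\<Sum>i\<le>k. coeff B (k - i) * (2 * of_nat n * (-1) ^ Suc i))" for k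
    using Newton_identity[where S = "{()}" and a = "\<lambda>_. -1" and m = "\<lambda>_. 2 * n" and k = k] unfolding B_def by simp
  have "s (Suc j) = 2 * of_nat n * (-1) ^ Suc j" if "j < n" for j
    using that
  proof (induction j rule: less_induct)
    case (less j)
    have split: "(\<Sum>i\<le>j. f i) = (\<Sum>i<j. f i) + f j" for f :: "nat \<Rightarrow> complex"
      by (simp add: lessThan_Suc_atMost[symmetric])
    have "(\<Sum>i\<le>j. coeff P (j - i) * s (Suc i)) = (\<Sum>i\<le>j. coeff B (j - i) * (2 * of_nat n * (-1) ^ Suc i))"
      using P[of j] B[of j] cP[of "Suc j"] cB[of "Suc j"] less.prems by (metis neg_equal_iff_equal Suc_leI)
    moreover have "(\<Sum>i<j. coeff P (j - i) * s (Suc i)) = (\<Sum>i<j. coeff B (j - i) * (2 * of_nat n * (-1) ^ Suc i))"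
      using less by (intro sum.cong) (auto simp: cP cB)
    ultimately show ?case unfolding split using cP[of 0] cB[of 0] by simp
  qed
  from this[of "k - 1"] show ?thesis using assms by (simp add: s_def)
qed

text \<open>After division by the constant term, the coefficients of \<open>Q n n\<close> are
  quotients by the central, hence largest, binomial and are at most 1. Newton's recursion then
  bounds the k-th sum by a number depending on k alone.\<close>

lemma power_sum_neg_bounded:
  assumes "k \<ge> 1"
  shows "\<exists>B. \<forall>n. norm (power_sum n (\<lambda>z. inverse z ^ k)) \<le> B"
proof -
  define P where "P n = (\<Prod>z\<in>zeros n. [:1, - inverse z:] ^ order z (Q n n))" for n
  define c where "c n = (\<Prod>z\<in>zeros n. (- z) ^ order z (Q n n))" for n
  have QP: "Q n n = smult (c n) (P n)" for n
  proof -
    have "poly (Q n n) x = poly (smult (c n) (P n)) x" for x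
    proof -
      have "poly (Q n n) x = (\<Prod>z\<in>zeros n. (- z + x) ^ order z (Q n n))"
        by (subst Q_decompose) (simp add: poly_prod)
      also have "\<dots> = (\<Prod>z\<in>zeros n. (- z) ^ order z (Q n n) * (1 - inverse z * x) ^ order z (Q n n))"
      proof (rule prod.cong)
        fix z assume "z \<in> zeros n"
        then have "- z + x = - z * (1 - inverse z * x)" using zero_not_in_zeros by (simp add: field_simps)
        then show "(- z + x) ^ order z (Q n n) = (- z) ^ order z (Q n n) * (1 - inverse z * x) ^ order z (Q n n)"
          by (metis power_mult_distrib)
      qed simp
      also have "\<dots> = poly (smult (c n) (P n)) x"
        by (simp add: c_def P_def poly_prod prod.distrib mult.commute)
      finally show ?thesis .
    qed
    then show ?thesis by (simp add: poly_eq_poly_eq_iff[symmetric] fun_eq_iff)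
  qed
  have P0: "coeff (P n) 0 = 1" for n unfolding P_def by (rule coeff_0_prod_linear)
  have c: "c n = of_nat ((2 * n) choose n)" for n
    using arg_cong[OF QP[of n], of "\<lambda>p. coeff p 0"] P0[of n] by (simp add: coeff_Q mult_2)
  have bP: "norm (coeff (P n) j) \<le> 1" for n j
  proof -
    have "norm (c n) * norm (coeff (P n) j) = norm (coeff (Q n n) j)"
      using QP[of n] by (metis coeff_smult norm_mult)
    also have "\<dots> \<le> norm (c n)"
      using binomial_maximum[of "2 * n" "j + n"] by (simp add: coeff_Q c mult_2)
    finally show ?thesis using c[of n] by (simp add: mult_le_cancel_left1 split: if_splits)
  qed
  define s where "s n j = power_sum n (\<lambda>z. inverse z ^ j)" for n j
  have N: "of_nat (Suc k) * coeff (P n) (Suc k) = - (\<Sum>i\<le>k. coeff (P n) (k - i) * s n (Suc i))" for n k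
    unfolding P_def s_def power_sum_def by (rule Newton_identity[OF finite_zeros])
  have "\<exists>B. \<forall>n. norm (s n (Suc j)) \<le> B" for j
  proof (induction j rule: less_induct)
    case (less j)
    then obtain B where B: "\<And>i n. i < j \<Longrightarrow> norm (s n (Suc i)) \<le> B i" by metis
    have lin: "S = - A - X" if "A = - T" "T = X + S" for A X S T :: complex
      using that by simp
    show ?case
    proof (intro exI allI)
      fix n
      have "(\<Sum>i\<le>j. coeff (P n) (j - i) * s n (Suc i)) = (\<Sum>i<j. coeff (P n) (j - i) * s n (Suc i)) + s n (Suc j)"
        by (simp add: lessThan_Suc_atMost[symmetric] P0)
      then have "s n (Suc j) = - (of_nat (Suc j) * coeff (P n) (Suc j)) - (\<Sum>i<j. coeff (P n) (j - i) * s n (Suc i))"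
        using N[of j n] by (intro lin)
      also have "norm \<dots> \<le> norm (of_nat (Suc j) * coeff (P n) (Suc j)) + (\<Sum>i<j. norm (coeff (P n) (j - i) * s n (Suc i)))"
        by (rule order_trans[OF norm_triangle_ineq4]) (simp add: norm_sum)
      also have "\<dots> \<le> real (Suc j) * 1 + (\<Sum>i<j. 1 * B i)"
        unfolding norm_mult norm_of_nat by (intro add_mono sum_mono mult_mono bP B) auto
      finally show "norm (s n (Suc j)) \<le> real (Suc j) * 1 + (\<Sum>i<j. 1 * B i)" .
    qed
  qed
  from this[of "k - 1"] show ?thesis using assms by (simp add: s_def)
qed

section \<open>Limits of averages over the zeros\<close>

definition zero_avg :: "nat \<Rightarrow> (complex \<Rightarrow> complex) \<Rightarrow> complex" where
  "zero_avg n f = power_sum n f / of_nat n"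

lemma zero_avg_power_int:
  "(\<lambda>n. zero_avg n (\<lambda>z. z powi i)) \<longlonglongrightarrow> (if i = 0 then 1 else if i > 0 then 2 * (-1) ^ nat i else 0)"
proof (cases i "0 :: int" rule: linorder_cases)
  case equal
  have "\<forall>\<^sub>F n in sequentially. zero_avg n (\<lambda>z. z powi i) = 1"
    using eventually_gt_at_top[of 0] by eventually_elim (simp add: zero_avg_def equal power_sum_1)
  then show ?thesis using equal by (simp add: tendsto_eventually)
next
  case greater
  have "\<forall>\<^sub>F n in sequentially. zero_avg n (\<lambda>z. z powi i) = 2 * (-1) ^ nat i"
    using eventually_ge_at_top[of "max 1 (nat i)"]
    by eventually_elim (use greater in \<open>auto simp: zero_avg_def power_int_def power_sum_pos\<close>)
  then show ?thesis using greater by (simp add: tendsto_eventually)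
next
  case less
  obtain B where B: "\<And>n. norm (power_sum n (\<lambda>z. inverse z ^ nat (-i))) \<le> B"
    using power_sum_neg_bounded[of "nat (-i)"] less by force
  have "(\<lambda>n. zero_avg n (\<lambda>z. z powi i)) \<longlonglongrightarrow> 0"
  proof (rule Lim_null_comparison)
    show "\<forall>\<^sub>F n in sequentially. norm (zero_avg n (\<lambda>z. z powi i)) \<le> B / real n"
      using less B by (intro always_eventually allI) (simp add: zero_avg_def power_int_def norm_divide divide_right_mono)
    show "(\<lambda>n. B / real n) \<longlonglongrightarrow> 0" by (rule lim_const_over_n)
  qed
  then show ?thesis using less by simp
qed

lemma zero_avg_sum: "zero_avg n (\<lambda>z. \<Sum>j\<in>J. c j * f j z) = (\<Sum>j\<in>J. c j * zero_avg n (f j))"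
  unfolding zero_avg_def power_sum_def sum_distrib_left sum_divide_distrib
  by (subst sum.swap) (simp add: mult_ac)

lemma zero_avg_cong: "(\<And>z. z \<in> zeros n \<Longrightarrow> f z = g z) \<Longrightarrow> zero_avg n f = zero_avg n g"
  by (simp add: zero_avg_def power_sum_def)

text \<open>The second factor is the limit of the averages of z^(j - k), so this is the limit for (4
  phi)^k = z^(-k) (1 + z)^(2k). The symmetry j -> 2k - j folds the doubled upper half back onto the
  full alternating row, that is (1 - 1)^(2k) up to sign.\<close>

lemma central_alternating_sum:
  assumes "k \<ge> 1"
  shows "(\<Sum>j\<le>2*k. of_nat ((2*k) choose j) * (let i = int j - int k in if i = 0 then 1 else if i > 0 then 2 * (-1) ^ nat i else 0)) = (0::complex)"
proof -
  define g :: "nat \<Rightarrow> complex" where "g j = (-1) ^ j * of_nat ((2*k) choose j)" for j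
  have tot: "(\<Sum>j\<le>2*k. g j) = 0" unfolding g_def using assms by (intro choose_alternating_sum) simp
  have dec: "{..2*k} = {..<k} \<union> {k} \<union> {k<..2*k}" by auto
  have split: "(\<Sum>j\<le>2*k. f j) = (\<Sum>j<k. f j) + f k + (\<Sum>j\<in>{k<..2*k}. f j)" for f :: "nat \<Rightarrow> complex"
    unfolding dec by (subst sum.union_disjoint, auto)+
  have "(\<Sum>j<k. g j) = (\<Sum>j\<in>{k<..2*k}. g j)"
    by (rule sum.reindex_bij_witness[of _ "\<lambda>j. 2*k - j" "\<lambda>j. 2*k - j"])
       (auto simp: g_def binomial_symmetric[symmetric] minus_one_power_iff)
  then have z: "g k + 2 * (\<Sum>j\<in>{k<..2*k}. g j) = 0" using tot split[of g] by (simp add: algebra_simps)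
  have gk: "(-1) ^ k * g k = of_nat ((2*k) choose k)"
    by (simp add: g_def minus_one_power_iff)
  have "(\<Sum>j\<le>2*k. of_nat ((2*k) choose j) * (let i = int j - int k in if i = 0 then 1 else if i > 0 then 2 * (-1) ^ nat i else 0)) =
     of_nat ((2*k) choose k) + (\<Sum>j\<in>{k<..2*k}. (-1) ^ k * (2 * g j))"
    unfolding split
    by (auto simp: Let_def g_def minus_one_power_iff nat_diff_distrib intro!: sum.cong)
  also have "\<dots> = (-1) ^ k * (g k + 2 * (\<Sum>j\<in>{k<..2*k}. g j))"
    using gk by (simp add: distrib_left sum_distrib_left)
  finally show ?thesis using z by simp
qed

lemma zero_avg_phi_power:
  assumes "k \<ge> 1"
  shows "(\<lambda>n. zero_avg n (\<lambda>z. phi z ^ k)) \<longlonglongrightarrow> 0"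
proof -
  have eq: "zero_avg n (\<lambda>z. phi z ^ k) =
     (\<Sum>j\<le>2*k. of_nat ((2*k) choose j) / 4 ^ k * zero_avg n (\<lambda>z. z powi (int j - int k)))" for n
  proof -
    have "zero_avg n (\<lambda>z. phi z ^ k) =
        zero_avg n (\<lambda>z. \<Sum>j\<le>2*k. of_nat ((2*k) choose j) / 4 ^ k * z powi (int j - int k))"
    proof (rule zero_avg_cong)
      fix z assume "z \<in> zeros n"
      then have "z \<noteq> 0" by (rule zero_not_in_zeros)
      have "phi z ^ k = (z + 1) ^ (2 * k) / (4 ^ k * z ^ k)"
        by (simp add: phi_def power_divide power_mult_distrib power_mult)
      also have "\<dots> = (\<Sum>j\<le>2*k. of_nat ((2*k) choose j) / 4 ^ k * (z ^ j / z ^ k))"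
        by (simp add: binomial_ring sum_divide_distrib mult_ac)
      also have "\<dots> = (\<Sum>j\<le>2*k. of_nat ((2*k) choose j) / 4 ^ k * z powi (int j - int k))"
        using \<open>z \<noteq> 0\<close> by (simp add: power_int_diff)
      finally show "phi z ^ k = (\<Sum>j\<le>2*k. of_nat ((2*k) choose j) / 4 ^ k * z powi (int j - int k))" .
    qed
    then show ?thesis unfolding zero_avg_sum .
  qed
  have "(\<lambda>n. \<Sum>j\<le>2*k. of_nat ((2*k) choose j) / 4 ^ k * zero_avg n (\<lambda>z. z powi (int j - int k))) \<longlonglongrightarrow>
    (\<Sum>j\<le>2*k. of_nat ((2*k) choose j) / 4 ^ k * (let i = int j - int k in if i = 0 then 1 else if i > 0 then 2 * (-1) ^ nat i else 0))"
    unfolding Let_def by (intro tendsto_intros zero_avg_power_int)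
  moreover have "(\<Sum>j\<le>2*k. of_nat ((2*k) choose j) / 4 ^ k * (let i = int j - int k in if i = 0 then 1 else if i > 0 then 2 * (-1) ^ nat i else 0)) = (0::complex)"
    using central_alternating_sum[OF assms] by (simp flip: sum_divide_distrib)
  ultimately show ?thesis unfolding eq by simp
qed

subsection \<open>Zeros approach the curve\<close>

lemma one_minus_times_sum:
  fixes a :: "nat \<Rightarrow> 'a :: comm_ring_1"
  shows "(1 - x) * (\<Sum>k\<le>n. a k * x ^ k) =
    a 0 - (\<Sum>k\<le>n. (a k - a (Suc k)) * x ^ Suc k) - a (Suc n) * x ^ Suc n"
  by (induction n) (simp_all add: algebra_simps)

definition coeff_gap :: "nat \<Rightarrow> nat \<Rightarrow> real" where
  "coeff_gap n k = real ((2 * n) choose (k + n)) - real ((2 * n) choose (Suc k + n))"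

text \<open>Binomials decrease to the right of the middle of the row.\<close>

lemma coeff_gap_nonneg: "coeff_gap n k \<ge> 0"
proof -
  have "(2 * n) choose (Suc k + n) \<le> (2 * n) choose (k + n)"
  proof (cases "Suc k + n \<le> 2 * n")
    case True then show ?thesis by (intro binomial_antimono) auto
  qed (simp add: binomial_eq_0)
  then show ?thesis by (simp add: coeff_gap_def)
qed

lemma coeff_gap_sum: "(\<Sum>k\<le>n. coeff_gap n k) = real ((2 * n) choose n)"
  using sum_telescope[of "\<lambda>k. real ((2 * n) choose (k + n))" n]
  by (simp add: coeff_gap_def binomial_eq_0)

lemma one_minus_times_Q:
  "(1 - x) * poly (Q n n) x = of_nat ((2 * n) choose n) - (\<Sum>k\<le>n. of_real (coeff_gap n k) * x ^ Suc k)"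
  unfolding poly_Q one_minus_times_sum by (simp add: coeff_gap_def mult_2[symmetric] binomial_eq_0)

text \<open>The Enestroem-Kakeya argument: at a zero with |z| < 1 the gaps, weighted by powers of z,
  could not add up to their own sum, the constant term.\<close>

lemma zeros_norm_ge_1:
  assumes "z \<in> zeros n"
  shows "norm z \<ge> 1"
proof (rule ccontr)
  assume "\<not> norm z \<ge> 1"
  then have z: "norm z < 1" by simp
  have "real ((2 * n) choose n) = norm (\<Sum>k\<le>n. of_real (coeff_gap n k) * z ^ Suc k)"
    using one_minus_times_Q[of z n] assms by (simp add: zeros_def)
       (metis norm_of_nat)
  also have "\<dots> \<le> (\<Sum>k\<le>n. norm (of_real (coeff_gap n k) * z ^ Suc k))" by (rule norm_sum)
  also have "\<dots> \<le> (\<Sum>k\<le>n. coeff_gap n k * norm z)"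
  proof (rule sum_mono)
    fix k
    have "norm z * norm z ^ k \<le> norm z * 1" using z by (intro mult_left_mono power_le_one) auto
    then show "norm (of_real (coeff_gap n k) * z ^ Suc k) \<le> coeff_gap n k * norm z"
      using coeff_gap_nonneg[of n k] by (simp add: norm_mult norm_power mult_left_mono)
  qed
  also have "\<dots> = real ((2 * n) choose n) * norm z" by (simp add: coeff_gap_sum flip: sum_distrib_right)
  finally show False using z by simp
qed

lemma zeros_in_K: "z \<in> zeros n \<Longrightarrow> z \<in> K_region"
  using zeros_norm_ge_1[of z n] zeros_not_exterior[of n n z] by (auto simp: K_region_def zeros_def)

text \<open>By symmetry of the binomials, the lower half of (1 + z)^(2n) is z^n times Q(1/z) without
  its constant term; dividing the whole power by z^n gives (4 phi z)^n.\<close>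

lemma Q_reflection:
  assumes "z \<noteq> 0"
  shows "(4 * phi z) ^ n = poly (Q n n) z + poly (Q n n) (1 / z) - of_nat ((2 * n) choose n)"
proof -
  have "(\<Sum>j<n. of_nat ((n + n) choose j) * z ^ j) = z ^ n * (poly (Q n n) (1 / z) - of_nat ((2 * n) choose n))"
  proof -
    have "(\<Sum>j<n. of_nat ((n + n) choose j) * z ^ j) = (\<Sum>k\<in>{0<..n}. of_nat ((n + n) choose (k + n)) * (z ^ n * (1 / z) ^ k))"
    proof (rule sum.reindex_bij_witness[of _ "\<lambda>k. n - k" "\<lambda>j. n - j"], goal_cases)
      case (5 j)
      then have "z ^ n * (1 / z) ^ (n - j) = z ^ j"
        using assms by (simp add: power_one_over power_diff field_simps)
      moreover have "(n + n) choose (n - j + n) = (n + n) choose j"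
        using binomial_symmetric[of j "n + n"] 5 by (simp add: algebra_simps)
      ultimately show ?case by simp
    qed auto
    also have "\<dots> = z ^ n * (\<Sum>k\<in>{0<..n}. of_nat ((n + n) choose (k + n)) * (1 / z) ^ k)"
      by (simp add: sum_distrib_left mult_ac)
    also have "(\<Sum>k\<in>{0<..n}. of_nat ((n + n) choose (k + n)) * (1 / z) ^ k) = poly (Q n n) (1 / z) - of_nat ((2 * n) choose n)"
    proof -
      have "{..n} = insert 0 {0<..n}" by auto
      then show ?thesis by (simp add: poly_Q mult_2)
    qed
    finally show ?thesis .
  qed
  then have "z ^ n * (poly (Q n n) z + poly (Q n n) (1 / z) - of_nat ((2 * n) choose n)) = (1 + z) ^ (n + n)"
    using poly_Q_times_power[of z n n]
    by (simp only: add_diff_eq[symmetric] distrib_left) simp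
  moreover have "(4 * phi z) ^ n * z ^ n = (1 + z) ^ (n + n)"
    using assms by (simp add: phi_def mult_2[symmetric] power_mult add.commute flip: power_mult_distrib)
  ultimately show ?thesis using assms by (metis mult.commute mult_cancel_left power_not_zero)
qed

text \<open>With A the central binomial, the gap equals 3 n A / ((n + 1)(n + 2)), and A >= 4^n /
  (2n). Only the exponential rate 4 matters later.\<close>

lemma coeff_gap_1_lower:
  assumes "n \<ge> 1"
  shows "coeff_gap n 1 \<ge> 4 ^ n / ((real n + 1) * (real n + 2))"
proof -
  have step: "Suc k * (m choose Suc k) = (m - k) * (m choose k)" for m k
    using binomial_absorption[of k m] binomial_absorb_comp[of m k] by simp
  define A B C where "A = real ((2*n) choose n)" and "B = real ((2*n) choose (n+1))" and "C = real ((2*n) choose (n+2))"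
  have 1: "(real n + 1) * B = real n * A"
    using arg_cong[OF step[of n "2*n"], of real] by (simp add: A_def B_def algebra_simps)
  have "real (2*n - Suc n) = real n - 1" using assms by (simp add: of_nat_diff)
  then have 2: "(real n + 2) * C = (real n - 1) * B"
    using arg_cong[OF step[of "n+1" "2*n"], of real] by (simp add: B_def C_def algebra_simps)
  have d: "coeff_gap n 1 = B - C" by (simp add: coeff_gap_def B_def C_def add.commute)
  have nn: "0 \<le> real n * A" by (simp add: A_def)
  have A: "2 * real n * A \<ge> 4 ^ n"
    using central_binomial_lower_bound[of n] assms by (simp add: A_def field_simps)
  have "(real n + 1) * (real n + 2) * coeff_gap n 1 = (real n + 1) * ((real n + 2) * B - (real n + 2) * C)"
    unfolding d by (simp add: algebra_simps)
  also have "\<dots> = 3 * ((real n + 1) * B)" unfolding 2 by (simp add: algebra_simps)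
  also have "\<dots> = 3 * (real n * A)" unfolding 1 ..
  also have "\<dots> \<ge> 4 ^ n" using A nn by linarith
  finally show ?thesis by (simp add: divide_le_eq mult_ac add_pos_nonneg)
qed

lemma Re_power_le_1: "norm y \<le> 1 \<Longrightarrow> Re (y ^ k) \<le> 1"
  using complex_Re_le_cmod[of "y ^ k"] power_le_one[of "norm y" k] by (simp add: norm_power)

text \<open>For y = 1/z, reflection and summation by parts combine to (1 - y)(4 phi z)^n = y S,
  where S is the sum of gap_k (1 - y^k). As |y| <= 1, all terms of S have nonnegative real part, so
  one of them bounds |S| from below.\<close>

lemma phi_zero_lower:
  assumes "z \<in> zeros n" "n \<ge> 1"
  shows "norm (1 / z) * coeff_gap n 1 * (1 - Re (1 / z)) \<le> norm (1 - 1 / z) * norm (4 * phi z) ^ n"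
proof -
  define y where "y = 1 / z"
  have z0: "z \<noteq> 0" using assms zero_not_in_zeros by blast
  have y: "norm y \<le> 1" using zeros_norm_ge_1[OF assms(1)] by (auto simp: y_def norm_divide divide_le_eq)
  define S where "S = (\<Sum>k\<le>n. of_real (coeff_gap n k) * (1 - y ^ k))"
  have e1: "(1 - y) * poly (Q n n) y = of_nat ((2 * n) choose n) - y * (\<Sum>k\<le>n. of_real (coeff_gap n k) * y ^ k)"
    unfolding one_minus_times_Q by (simp add: sum_distrib_left mult_ac)
  have e2: "S = of_nat ((2 * n) choose n) - (\<Sum>k\<le>n. of_real (coeff_gap n k) * y ^ k)"
    using arg_cong[OF coeff_gap_sum[of n], of complex_of_real]
    by (simp add: S_def right_diff_distrib sum_subtractf)
  have "(1 - y) * (4 * phi z) ^ n = y * S"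
  proof -
    define X C T where "X = (4 * phi z) ^ n" and "C = complex_of_nat ((2 * n) choose n)"
      and "T = (\<Sum>k\<le>n. of_real (coeff_gap n k) * y ^ k)"
    have "poly (Q n n) y = X + C"
      using Q_reflection[OF z0, of n] assms(1) by (simp add: y_def zeros_def X_def C_def)
    with e1 have "(1 - y) * (X + C) = C - y * T" by (simp only: C_def T_def)
    then have "(1 - y) * X = y * (C - T)" by (simp add: algebra_simps)
    then show ?thesis unfolding e2 X_def C_def T_def .
  qed
  then have n1: "norm (1 - y) * norm (4 * phi z) ^ n = norm y * norm S"
    by (metis norm_mult norm_power)
  \<comment> \<open>The term k = 0 vanishes, which makes k = 1 the first useful one.\<close>
  have "coeff_gap n 1 * (1 - Re y) = (\<Sum>k\<in>{1}. coeff_gap n k * (1 - Re (y ^ k)))" by simp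
  also have "\<dots> \<le> (\<Sum>k\<le>n. coeff_gap n k * (1 - Re (y ^ k)))"
    using assms(2) coeff_gap_nonneg Re_power_le_1[OF y] by (intro sum_mono2) auto
  also have "\<dots> = Re S" by (simp add: S_def)
  also have "\<dots> \<le> norm S" by (rule complex_Re_le_cmod)
  finally have "norm y * (coeff_gap n 1 * (1 - Re y)) \<le> norm y * norm S" by (intro mult_left_mono) auto
  then show ?thesis using n1 by (simp add: y_def mult_ac)
qed

lemma Re_inverse_less_1:
  assumes "norm z \<ge> 1" "z \<noteq> 1"
  shows "Re (1 / z) < 1"
proof (rule ccontr)
  assume *: "\<not> Re (1 / z) < 1"
  have n: "norm (1 / z) \<le> 1" using assms by (auto simp: norm_divide divide_le_eq)
  have "Re (1 / z) = 1" using * complex_Re_le_cmod[of "1 / z"] n by linarith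
  moreover have "(Re (1/z))^2 + (Im (1/z))^2 \<le> 1"
    using n power_mono[OF n, of 2] by (simp add: cmod_power2)
  ultimately have "1 / z = 1" by (simp add: complex_eq_iff)
  then show False using assms(2) by (simp add: divide_eq_1_iff)
qed

text \<open>Where |phi| <= m < 1, compactness bounds the factor \<open>h\<close> below by some c >
  0, so a zero there would give c 4^n / ((n + 1)(n + 2)) <= (4 m)^n, which fails for large
  n.\<close>

lemma eventually_zeros_phi_gt:
  assumes "m < 1"
  shows "\<forall>\<^sub>F n in sequentially. \<forall>z\<in>zeros n. norm (phi z) > m"
proof (cases "0 < m")
  case False
  \<comment> \<open>For m <= 0 only phi z = 0 has to be excluded, and this works for every n >=
    1.\<close>
  have *: "norm (phi z) > m" if "z \<in> zeros n" "n \<ge> 1" for z n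
  proof (rule ccontr)
    assume "\<not> norm (phi z) > m"
    then have "phi z = 0" using False by (metis norm_ge_zero norm_le_zero_iff not_less order_trans)
    moreover have "z \<noteq> 1" using \<open>phi z = 0\<close> by (auto simp: phi_def)
    ultimately have "norm (1 / z) * coeff_gap n 1 * (1 - Re (1 / z)) \<le> 0"
      using phi_zero_lower[OF that] that(2) by (simp add: power_0_left)
    moreover have "coeff_gap n 1 > 0"
      by (rule less_le_trans[OF _ coeff_gap_1_lower[OF that(2)]]) simp
    moreover have "norm (1 / z) > 0" using zero_not_in_zeros[OF that(1)] by simp
    moreover have "1 - Re (1 / z) > 0"
      using Re_inverse_less_1[OF zeros_norm_ge_1[OF that(1)] \<open>z \<noteq> 1\<close>] by simp
    ultimately show False by (meson mult_pos_pos not_less)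
  qed
  show ?thesis using eventually_ge_at_top[of 1] by eventually_elim (use * in blast)
next
  case True
  define L where "L = {z. norm z \<ge> 1 \<and> phi z \<in> cball 0 m}"
  have "closed L" unfolding L_def by (rule closed_exterior_sublevel) simp
  moreover have "L \<subseteq> K_region" using assms by (auto simp: L_def K_region_def)
  ultimately have cL: "compact L" using compact_K_region by (metis compact_Int_closed inf.absorb2)
  define h where "h z = norm (1 / z) * (1 - Re (1 / z)) / norm (1 - 1 / z)" for z :: complex
  \<comment> \<open>Since phi 1 = 1 > m, the set avoids the point 1, where \<open>h\<close> would be
    0/0.\<close>
  have L: "norm z \<ge> 1" "z \<noteq> 1" "z \<noteq> 0" "1 / z \<noteq> 1" if "z \<in> L" for z
  proof -
    show "norm z \<ge> 1" using that by (simp add: L_def)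
    then show "z \<noteq> 0" by auto
    show z1: "z \<noteq> 1" using that assms by (auto simp: L_def phi_def)
    then show "1 / z \<noteq> 1" by (simp add: divide_eq_1_iff)
  qed
  have hpos: "h z > 0" if "z \<in> L" for z
    unfolding h_def using L[OF that] Re_inverse_less_1[of z] by (intro divide_pos_pos mult_pos_pos) auto
  have hc: "continuous_on L h"
    unfolding h_def using L by (intro continuous_intros) auto
  obtain c where c: "c > 0" "\<And>z. z \<in> L \<Longrightarrow> h z \<ge> c"
  proof (cases "L = {}")
    case True then show ?thesis using that[of 1] by simp
  next
    case False
    then obtain x where "x \<in> L" "\<And>z. z \<in> L \<Longrightarrow> h x \<le> h z"
      using continuous_attains_inf[OF cL False hc] by blast
    then show ?thesis using that[of "h x"] hpos by blast
  qed
  have "(\<lambda>n. m ^ n * ((real n + 1) * (real n + 2))) \<longlonglongrightarrow> 0"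
    using True assms by real_asymp
  then have "\<forall>\<^sub>F n in sequentially. m ^ n * ((real n + 1) * (real n + 2)) < c"
    using c(1) by (rule order_tendstoD)
  then show ?thesis using eventually_ge_at_top[of 1]
  proof eventually_elim
    case (elim n)
    show ?case
    proof (intro ballI, rule ccontr)
      fix z assume z: "z \<in> zeros n" and "\<not> norm (phi z) > m"
      then have pm: "norm (phi z) \<le> m" by simp
      then have zL: "z \<in> L" using zeros_norm_ge_1[OF z] by (simp add: L_def)
      have nz: "norm (1 - 1 / z) > 0" using L[OF zL] by simp
      have "c * (4 ^ n / ((real n + 1) * (real n + 2))) \<le> h z * coeff_gap n 1"
        using c zL coeff_gap_1_lower[OF elim(2)] by (intro mult_mono) (auto intro: less_imp_le[OF hpos])
      also have "\<dots> \<le> norm (4 * phi z) ^ n"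
        using phi_zero_lower[OF z elim(2)] nz by (simp add: h_def divide_le_eq mult_ac)
      also have "\<dots> \<le> (4 * m) ^ n" using pm by (intro power_mono) (auto simp: norm_mult)
      finally have "c * 4 ^ n \<le> 4 ^ n * (m ^ n * ((real n + 1) * (real n + 2)))"
        by (simp add: power_mult_distrib divide_le_eq mult_ac add_pos_nonneg)
      then show False using elim(1) by simp
    qed
  qed
qed

text \<open>Convergence of the zeros to the curve, phrased for an error function: the part of
  \<open>K_region\<close> where \<open>h\<close> is at least the threshold is compact and misses the
  curve, so |phi| has a maximum below 1 there.\<close>

lemma eventually_zeros_near_Gamma:
  fixes h :: "complex \<Rightarrow> real"
  assumes "continuous_on K_region h" "\<And>z. z \<in> Gamma_curve \<Longrightarrow> h z < \<eta>"
  shows "\<forall>\<^sub>F n in sequentially. \<forall>z\<in>zeros n. h z < \<eta>"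
proof -
  define L where "L = K_region \<inter> h -` {\<eta>..}"
  have "closed L" unfolding L_def
    by (intro continuous_closed_preimage assms closed_K_region closed_atLeast)
  then have cL: "compact L" using compact_K_region
    by (metis L_def compact_Int_closed inf_left_idem)
  have phiL: "continuous_on L (\<lambda>z. norm (phi z))"
    by (intro continuous_on_norm continuous_on_subset[OF continuous_on_phi]) (auto simp: L_def K_region_def)
  have lt: "norm (phi z) < 1" if "z \<in> L" for z
    using that assms(2)[of z] by (auto simp: L_def K_region_def Gamma_curve_def order.order_iff_strict)
  obtain m where m: "m < 1" "\<And>z. z \<in> L \<Longrightarrow> norm (phi z) \<le> m"
  proof (cases "L = {}")
    case True then show ?thesis using that[of 0] by simp
  next
    case False
    then obtain x where "x \<in> L" "\<And>z. z \<in> L \<Longrightarrow> norm (phi z) \<le> norm (phi x)"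
      using continuous_attains_sup[OF cL False phiL] by blast
    then show ?thesis using that[of "norm (phi x)"] lt by blast
  qed
  show ?thesis using eventually_zeros_phi_gt[OF m(1)]
  proof eventually_elim
    case (elim n)
    show ?case
    proof (intro ballI, rule ccontr)
      fix z assume "z \<in> zeros n" "\<not> h z < \<eta>"
      then have "z \<in> L" using zeros_in_K by (auto simp: L_def)
      then show False using m(2) elim \<open>z \<in> zeros n\<close> by force
    qed
  qed
qed

lemma norm_zero_avg_le:
  assumes "\<And>z. z \<in> zeros n \<Longrightarrow> norm (f z) \<le> \<epsilon>" "\<epsilon> \<ge> 0"
  shows "norm (zero_avg n f) \<le> \<epsilon>"
proof (cases "n = 0")
  case False
  have "norm (power_sum n f) \<le> (\<Sum>z\<in>zeros n. real (order z (Q n n)) * \<epsilon>)"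
    unfolding power_sum_def using assms
    by (intro sum_norm_le) (auto simp: norm_mult intro: mult_left_mono)
  also have "\<dots> = real n * \<epsilon>"
  proof -
    have "of_real (\<Sum>z\<in>zeros n. real (order z (Q n n))) = (of_real (real n) :: complex)"
      using power_sum_1[of n] by (simp add: power_sum_def)
    then show ?thesis by (simp only: of_real_eq_iff flip: sum_distrib_right)
  qed
  finally show ?thesis using False by (simp add: zero_avg_def norm_divide divide_le_eq mult.commute)
qed (use assms in \<open>simp add: zero_avg_def\<close>)

lemma zero_avg_diff: "zero_avg n (\<lambda>z. f z - g z) = zero_avg n f - zero_avg n g"
  by (simp add: zero_avg_def power_sum_def sum_subtractf right_diff_distrib diff_divide_distrib)

text \<open>Closeness on the curve suffices, although the zeros lie off it.\<close>

lemma zero_avg_approx: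
  assumes "continuous_on K_region f" "continuous_on K_region g" "\<epsilon> > 0"
    and "\<And>z. z \<in> Gamma_curve \<Longrightarrow> norm (f z - g z) < \<epsilon>"
  shows "\<forall>\<^sub>F n in sequentially. norm (zero_avg n f - zero_avg n g) \<le> \<epsilon>"
proof -
  have "\<forall>\<^sub>F n in sequentially. \<forall>z\<in>zeros n. norm (f z - g z) < \<epsilon>"
    by (intro eventually_zeros_near_Gamma continuous_intros assms)
  then show ?thesis
  proof eventually_elim
    case (elim n)
    then have "norm (zero_avg n (\<lambda>z. f z - g z)) \<le> \<epsilon>"
      using assms(3) by (intro norm_zero_avg_le) (auto intro: less_imp_le)
    then show ?case by (simp add: zero_avg_diff)
  qed
qed

subsection \<open>The inverse branch of \<open>phi\<close>\<close>

text \<open>The origin lies on the branch cut but cannot be avoided: 1 - 1/w vanishes at w = 1.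
  There continuity comes from |csqrt w| = sqrt |w|.\<close>

lemma continuous_on_csqrt_right_halfplane: "continuous_on {z. Re z \<ge> 0} csqrt"
  unfolding continuous_on_eq_continuous_within
proof
  fix z :: complex assume z: "z \<in> {z. Re z \<ge> 0}"
  show "continuous (at z within {z. Re z \<ge> 0}) csqrt"
  proof (cases "z = 0")
    case True
    have "((\<lambda>w. sqrt (norm w)) \<longlongrightarrow> sqrt (norm (0::complex))) (at 0 within {z. Re z \<ge> 0})"
      by (intro tendsto_intros)
    then have "(csqrt \<longlongrightarrow> 0) (at 0 within {z. Re z \<ge> 0})"
      by (intro tendsto_norm_zero_cancel[of csqrt]) simp
    then show ?thesis using True by (simp add: continuous_within)
  next
    case False
    then have "z \<notin> \<real>\<^sub>\<le>\<^sub>0" using z by (auto simp: complex_nonpos_Reals_iff complex_eq_iff)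
    then show ?thesis by (rule continuous_within_csqrt)
  qed
qed

text \<open>With s = sqrt (1 - 1/w), the equation phi z = w has the solution z = (1 + s)/(1 - s) = w
  (1 + s)^2. The principal root has Re s >= 0, which selects |z| >= 1 when |w| >= 1.\<close>

definition psi :: "complex \<Rightarrow> complex" where
  "psi w = w * (1 + csqrt (1 - 1 / w))\<^sup>2"

text \<open>The reciprocal of \<open>psi\<close> in the coordinate \<open>v = 1 / w\<close> at infinity.\<close>

definition chi :: "complex \<Rightarrow> complex" where
  "chi v = v / (1 + csqrt (1 - v))\<^sup>2"

lemma norm_one_plus_csqrt: "norm (1 + csqrt z) \<ge> 1"
  by (rule order_trans[OF _ complex_Re_le_cmod]) (use Re_csqrt[of z] in \<open>simp del: csqrt.simps\<close>)

lemma one_plus_csqrt_nonzero: "1 + csqrt z \<noteq> 0"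
  using norm_one_plus_csqrt[of z] by auto

lemma norm_chi_le: "norm (chi v) \<le> norm v"
proof -
  have "norm v \<le> norm v * norm (1 + csqrt (1 - v)) ^ 2"
    using mult_left_mono[OF one_le_power[OF norm_one_plus_csqrt[of "1 - v"], of 2], of "norm v"] by simp
  then show ?thesis
    using one_plus_csqrt_nonzero[of "1 - v"] by (simp add: chi_def norm_divide norm_power divide_le_eq)
qed

lemma continuous_on_chi: "continuous_on (cball 0 1) chi"
proof -
  have "continuous_on (cball 0 1) (\<lambda>v. csqrt (1 - v))"
    by (rule continuous_on_compose2[OF continuous_on_csqrt_right_halfplane])
       (auto intro!: continuous_intros order_trans[OF complex_Re_le_cmod])
  then show ?thesis unfolding chi_def[abs_def]
    by (intro continuous_intros) (auto simp: one_plus_csqrt_nonzero)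
qed

lemma one_minus_not_nonpos: "norm v < 1 \<Longrightarrow> 1 - (v :: complex) \<notin> \<real>\<^sub>\<le>\<^sub>0"
  using complex_Re_le_cmod[of v] by (auto simp: complex_nonpos_Reals_iff)

lemma holomorphic_on_chi: "chi holomorphic_on ball 0 1"
  unfolding chi_def[abs_def]
  by (intro holomorphic_intros) (auto simp: one_plus_csqrt_nonzero one_minus_not_nonpos)

text \<open>On the circle 1/w = cnj w, so this turns 1 / psi w = chi (1/w) into the conjugate of
  \<open>chi w\<close>, a boundary value of a function holomorphic in the disc.\<close>

lemma chi_cnj:
  assumes "norm v \<le> 1"
  shows "chi (cnj v) = cnj (chi v)"
proof (cases "v = 1")
  case False
  have "1 - v \<notin> \<real>\<^sub>\<le>\<^sub>0"
  proof
    assume "1 - v \<in> \<real>\<^sub>\<le>\<^sub>0"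
    then have "Re v \<ge> 1" "Im v = 0" by (auto simp: complex_nonpos_Reals_iff)
    moreover have "Re v \<le> 1" using complex_Re_le_cmod[of v] assms by simp
    ultimately show False using False by (simp add: complex_eq_iff)
  qed
  from cnj_csqrt[OF this] show ?thesis by (simp add: chi_def)
qed (simp add: chi_def)

lemma psi_chi: "w \<noteq> 0 \<Longrightarrow> psi w * chi (1 / w) = 1"
  using one_plus_csqrt_nonzero[of "1 - 1 / w"] by (simp add: psi_def chi_def)

lemma phi_psi:
  assumes "w \<noteq> 0"
  shows "phi (psi w) = w"
proof -
  define s where "s = csqrt (1 - 1 / w)"
  have s2: "w * (1 - s ^ 2) = 1" using assms by (simp add: s_def)
  then have prod: "((1 - s) * (1 + s)) * w = 1" by (simp add: power2_eq_square algebra_simps)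
  then have nz: "1 - s \<noteq> 0" "1 + s \<noteq> 0" by auto
  have "psi w * (1 - s) = (w * (1 - s ^ 2)) * (1 + s)"
    by (simp add: psi_def s_def[symmetric] power2_eq_square algebra_simps)
  then have psi: "psi w = (1 + s) / (1 - s)" using s2 nz by (simp add: field_simps)
  have frac: "(2 / d)\<^sup>2 / (4 * (e / d)) = 1 / (d * e)" if "d \<noteq> 0" "e \<noteq> 0" for d e :: complex
    using that by (simp add: power2_eq_square)
  have psi1: "psi w + 1 = 2 / (1 - s)" using nz by (simp add: psi field_simps)
  have "phi (psi w) = (2 / (1 - s))\<^sup>2 / (4 * ((1 + s) / (1 - s)))"
    unfolding phi_def psi1 unfolding psi ..
  also have "\<dots> = 1 / ((1 - s) * (1 + s))"
    using frac[OF nz] .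
  also have "\<dots> = w" using prod nz by (metis mult_eq_0_iff nonzero_mult_div_cancel_left)
  finally show ?thesis .
qed

lemma norm_psi_ge: "w \<noteq> 0 \<Longrightarrow> norm w \<ge> 1 \<Longrightarrow> norm (psi w) \<ge> 1"
  using mult_mono[of 1 "norm w" 1 "norm (1 + csqrt (1 - 1 / w)) ^ 2"] one_le_power[OF norm_one_plus_csqrt, of _ 2]
  by (simp add: psi_def norm_mult norm_power)

lemma psi_in_Gamma: "norm w = 1 \<Longrightarrow> psi w \<in> Gamma_curve"
  using norm_psi_ge[of w] phi_psi[of w] by (cases "w = 0") (auto simp: Gamma_curve_def)

lemma psi_phi: "z \<in> Gamma_curve \<Longrightarrow> psi (phi z) = z"
proof (rule phi_inj)
  assume z: "z \<in> Gamma_curve"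
  then have "norm (phi z) = 1" by (simp add: Gamma_curve_def)
  then show "psi (phi z) \<in> Gamma_curve" "phi (psi (phi z)) = phi z"
    by (auto simp: psi_in_Gamma intro!: phi_psi)
qed

lemma continuous_on_psi: "continuous_on (sphere 0 1) psi"
proof -
  have "continuous_on (sphere 0 1) (\<lambda>w. csqrt (1 - 1 / w))"
  proof (rule continuous_on_compose2[OF continuous_on_csqrt_right_halfplane])
    show "(\<lambda>w. 1 - 1 / w) ` sphere 0 1 \<subseteq> {z. 0 \<le> Re z}"
    proof clarify
      fix w :: complex assume "w \<in> sphere 0 1"
      then show "0 \<le> Re (1 - 1 / w)" using complex_Re_le_cmod[of "1 / w"] by (simp add: norm_divide)
    qed
  qed (auto intro!: continuous_intros)
  then show ?thesis unfolding psi_def[abs_def] by (intro continuous_intros)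
qed

subsection \<open>Means over the unit circle\<close>

lemma sets_circle_measure [simp, measurable_cong]: "sets circle_measure = sets borel"
  by (simp add: circle_measure_def)

lemma space_circle_measure [simp]: "space circle_measure = UNIV"
  by (simp add: circle_measure_def)

lemma cis_measurable [measurable]: "cis \<in> borel_measurable borel"
  by (intro borel_measurable_continuous_onI continuous_intros)

lemma cis_measurable_uniform: "cis \<in> measurable (uniform_measure lborel {0..2 * pi}) borel"
  by simp

lemma prob_space_uniform_angle: "prob_space (uniform_measure lborel {0..2 * pi})"
  by (rule prob_space_uniform_measure) auto

lemma prob_space_circle_measure: "prob_space circle_measure"
  unfolding circle_measure_def
  by (rule prob_space.prob_space_distr[OF prob_space_uniform_angle cis_measurable_uniform])

interpretation circle: prob_space circle_measure by (rule prob_space_circle_measure)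

lemma AE_circle_norm: "AE w in circle_measure. norm w = 1"
  unfolding circle_measure_def by (subst AE_distr_iff) auto

lemma emeasure_circle_measure:
  assumes "B \<in> sets borel"
  shows "emeasure circle_measure B = emeasure lborel ({0..2*pi} \<inter> cis -` B) / ennreal (2 * pi)"
proof -
  have "cis -` B \<in> sets borel" using measurable_sets[OF cis_measurable assms] by simp
  then show ?thesis using assms
    by (simp add: circle_measure_def emeasure_distr emeasure_uniform_measure Int_commute)
qed

lemma emeasure_circle_singleton: "emeasure circle_measure {w} = 0"
proof -
  have "countable ({0..2*pi} \<inter> cis -` {w})"
  proof (cases "\<exists>a. cis a = w")
    case True
    then obtain a where a: "cis a = w" by blast
    have "cis -` {w} \<subseteq> range (\<lambda>n::int. a + of_int (2 * n) * pi)"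
    proof
      fix t assume "t \<in> cis -` {w}"
      then have "exp (\<i> * of_real t) = exp (\<i> * of_real a)" using a by (simp add: cis_conv_exp)
      then obtain n :: int where "\<i> * of_real t = \<i> * of_real a + (of_int (2 * n) * pi) * \<i>"
        by (auto simp: exp_eq)
      then have "t = a + of_int (2 * n) * pi" by (simp add: complex_eq_iff)
      then show "t \<in> range (\<lambda>n::int. a + of_int (2 * n) * pi)" by blast
    qed
    then show ?thesis by (meson countableI_type countable_image countable_subset inf.coboundedI2)
  next
    case False
    then have "cis -` {w} = {}" by auto
    then show ?thesis by simp
  qed
  then show ?thesis by (simp add: emeasure_circle_measure emeasure_lborel_countable)
qed

lemma AE_circle_neq: "AE w in circle_measure. w \<noteq> a"
  by (rule AE_I[of _ _ "{a}"]) (auto simp: emeasure_circle_singleton)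

text \<open>The indicator extends f by zero, which makes it Borel when continuity is known on the
  circle only. The second part passes to the angle, where contour integrals can be compared.\<close>

lemma integral_circle_measure:
  fixes f :: "complex \<Rightarrow> complex"
  assumes "continuous_on (sphere 0 1) f"
  shows "integrable circle_measure (\<lambda>w. indicator (sphere 0 1) w *\<^sub>R f w)"
    and "((\<lambda>t. f (cis t)) has_integral (2 * pi * (\<integral>w. indicator (sphere 0 1) w *\<^sub>R f w \<partial>circle_measure))) {0..2*pi}"
proof -
  define g where "g w = indicator (sphere 0 1) w *\<^sub>R f w" for w
  have gm: "g \<in> borel_measurable borel"
    unfolding g_def by (intro borel_measurable_continuous_on_indicator assms) auto
  have "compact (f ` sphere 0 1)" using assms by (intro compact_continuous_image) auto
  then obtain B where B: "\<And>w. w \<in> sphere 0 1 \<Longrightarrow> norm (f w) \<le> B"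
    by (meson bounded_iff compact_imp_bounded imageI)
  have "norm (g w) \<le> max B 0" for w using B[of w] by (auto simp: g_def indicator_def)
  then show i1: "integrable circle_measure (\<lambda>w. indicator (sphere 0 1) w *\<^sub>R f w)"
    unfolding g_def[symmetric]
    by (intro circle.integrable_const_bound[where B = "max B 0"]) (use gm in auto)
  have cont: "continuous_on {0..2*pi} (\<lambda>t. f (cis t))"
    by (intro continuous_on_compose2[OF assms] continuous_intros) auto
  have si: "set_integrable lborel {0..2*pi} (\<lambda>t. f (cis t))"
    unfolding set_integrable_def by (rule borel_integrable_compact[OF compact_Icc cont])
  have "(\<integral>w. g w \<partial>circle_measure) = (\<integral>t. g (cis t) \<partial>uniform_measure lborel {0..2*pi})"
    unfolding circle_measure_def using gm by (intro integral_distr) auto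
  also have "\<dots> = (\<integral>t. (indicator {0..2*pi} t / (2 * pi)) *\<^sub>R g (cis t) \<partial>lborel)"
  proof -
    have "uniform_measure lborel {0..2*pi} = density lborel (\<lambda>t. ennreal (indicator {0..2*pi} t / (2 * pi)))"
      unfolding uniform_measure_def
      by (intro density_cong) (auto simp: indicator_def divide_ennreal[symmetric])
    then show ?thesis using gm by (subst integral_density[symmetric]) (auto simp: pi_ge_zero)
  qed
  also have "\<dots> = (\<integral>t. (1 / (2 * pi)) *\<^sub>R (indicator {0..2*pi} t *\<^sub>R f (cis t)) \<partial>lborel)"
    by (intro Bochner_Integration.integral_cong) (auto simp: g_def)
  also have "\<dots> = (1 / (2 * pi)) *\<^sub>R (LINT t:{0..2*pi}|lborel. f (cis t))"
    using si by (subst integral_scaleR_right) (auto simp: set_lebesgue_integral_def set_integrable_def)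
  finally have "(LINT t:{0..2*pi}|lborel. f (cis t)) = 2 * pi * (\<integral>w. g w \<partial>circle_measure)"
    by (simp add: scaleR_conv_of_real)
  then show "((\<lambda>t. f (cis t)) has_integral (2 * pi * (\<integral>w. indicator (sphere 0 1) w *\<^sub>R f w \<partial>circle_measure))) {0..2*pi}"
    using set_borel_integral_eq_integral[OF si] unfolding g_def[symmetric]
    by (metis integrable_integral)
qed

text \<open>Cauchy's formula at the centre, with dz / z = i dt.\<close>

lemma circle_mean_value:
  assumes "continuous_on (cball 0 1) f" "f holomorphic_on ball 0 1"
  shows "integrable circle_measure (\<lambda>w. indicator (sphere 0 1) w *\<^sub>R f w)"
    and "(\<integral>w. indicator (sphere 0 1) w *\<^sub>R f w \<partial>circle_measure) = f 0"
proof -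
  have c: "continuous_on (sphere 0 1) f" using assms(1) by (rule continuous_on_subset) auto
  show "integrable circle_measure (\<lambda>w. indicator (sphere 0 1) w *\<^sub>R f w)"
    by (rule integral_circle_measure(1)[OF c])
  have "((\<lambda>u. f u / (u - 0)) has_contour_integral (2 * of_real pi * \<i> * f 0)) (circlepath 0 1)"
    by (rule Cauchy_integral_circlepath[OF assms]) simp
  then have "((\<lambda>t. (f (cis t) / cis t) * \<i> * cis t) has_integral (2 * of_real pi * \<i> * f 0)) {0..2*pi}"
    unfolding circlepath_def by (subst (asm) has_contour_integral_part_circlepath_iff) auto
  then have "((\<lambda>t. (f (cis t) * \<i>) * (- \<i>)) has_integral (2 * of_real pi * \<i> * f 0) * (- \<i>)) {0..2*pi}"
    by (intro has_integral_mult_left) simp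
  then have "((\<lambda>t. f (cis t)) has_integral (2 * of_real pi * f 0)) {0..2*pi}"
    by (simp add: mult.assoc) (simp add: mult.left_commute[of \<i>])
  from has_integral_unique[OF this integral_circle_measure(2)[OF c]]
  show "(\<integral>w. indicator (sphere 0 1) w *\<^sub>R f w \<partial>circle_measure) = f 0" by simp
qed

text \<open>Bounds ln |1 - r g| below by ln |1 - g| - ln 2 uniformly in r, which dominates the
  logarithms as r tends to 1.\<close>

lemma norm_one_minus_le_double:
  fixes g :: complex
  assumes "0 \<le> r" "r \<le> 1" "norm g \<le> 1"
  shows "norm (1 - g) \<le> 2 * norm (1 - of_real r * g)"
proof -
  have "norm (of_real r * g) \<le> r" using assms by (simp add: norm_mult mult_left_le)
  then have "1 - r \<le> norm (1 - of_real r * g)" using norm_triangle_ineq2[of 1 "of_real r * g"] by simp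
  moreover have "norm (of_real r * g - g) \<le> 1 - r"
  proof -
    have "of_real r * g - g = - (of_real (1 - r) * g)" by (simp add: algebra_simps)
    then have "norm (of_real r * g - g) = (1 - r) * norm g"
      using assms by (simp only: norm_minus_cancel norm_mult norm_of_real)
    then show ?thesis using assms mult_left_mono[of "norm g" 1 "1 - r"] by simp
  qed
  moreover have "norm (1 - g) \<le> norm (1 - of_real r * g) + norm (of_real r * g - g)"
    using norm_triangle_ineq[of "1 - of_real r * g" "of_real r * g - g"] by simp
  ultimately show ?thesis by linarith
qed

text \<open>Fatou along \<open>r f\<close>, \<open>r \<longrightarrow> 1\<close>, yields integrability, which then allows dominated convergence.\<close>

lemma circle_log_mean:
  assumes cont: "continuous_on (cball 0 1) f" and holo: "f holomorphic_on ball 0 1"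
    and le: "\<And>v. norm v \<le> 1 \<Longrightarrow> norm (f v) \<le> 1" and f0: "f 0 = 0"
  defines "g \<equiv> \<lambda>w. indicator (sphere 0 1) w *\<^sub>R f w"
  assumes AE1: "AE w in circle_measure. g w \<noteq> 1"
  shows "integrable circle_measure (\<lambda>w. ln (norm (1 - g w)))"
    and "(\<integral>w. ln (norm (1 - g w)) \<partial>circle_measure) = 0"
proof -
  define r where "r n = 1 - 1 / (real n + 2)" for n :: nat
  have r: "0 < r n" "r n < 1" for n by (auto simp: r_def field_simps)
  have rlim: "r \<longlonglongrightarrow> 1" unfolding r_def[abs_def]
    by real_asymp
  have gm: "g \<in> borel_measurable borel"
    unfolding g_def by (intro borel_measurable_continuous_on_indicator continuous_on_subset[OF cont]) auto
  have g1: "norm (g w) \<le> 1" for w using le[of w] by (auto simp: g_def indicator_def)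
  define l where "l n w = ln (norm (1 - of_real (r n) * g w))" for n w
  define l0 where "l0 w = ln (norm (1 - g w))" for w
  have lm: "l n \<in> borel_measurable circle_measure" for n unfolding l_def using gm by measurable
  have l0m: "l0 \<in> borel_measurable circle_measure" unfolding l0_def using gm by measurable
  have small: "norm (of_real (r n) * f v) < 1" if "norm v \<le> 1" for n v
  proof -
    have "norm (of_real (r n) * f v) = r n * norm (f v)" using r[of n] by (simp add: norm_mult)
    also have "\<dots> \<le> r n * 1" using le[OF that] r[of n] by (intro mult_left_mono) auto
    also have "\<dots> < 1" using r[of n] by simp
    finally show ?thesis .
  qed
  have mv: "integrable circle_measure (l n) \<and> (\<integral>w. l n w \<partial>circle_measure) = 0" for n
  proof -
    \<comment> \<open>The factor r < 1 keeps 1 - r f in the right half-plane, so the principal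
      logarithm is holomorphic there, with value 0 at the centre.\<close>
    define F where "F v = Ln (1 - of_real (r n) * f v)" for v
    have Fc: "continuous_on (cball 0 1) F" unfolding F_def
      by (intro continuous_intros cont) (auto dest: one_minus_not_nonpos[OF small])
    have Fh: "F holomorphic_on ball 0 1" unfolding F_def
      by (intro holomorphic_intros holo) (auto dest: one_minus_not_nonpos[OF small[OF less_imp_le]])
    have eq: "l n w = Re (indicator (sphere 0 1) w *\<^sub>R F w)" for w
    proof (cases "w \<in> sphere 0 1")
      case True
      then have "1 - of_real (r n) * f w \<noteq> 0" using small[of w n] by auto
      then show ?thesis using True by (simp add: l_def g_def F_def)
    qed (simp add: l_def g_def)
    note I = circle_mean_value(1)[OF Fc Fh]
    have E: "(\<integral>w. indicator (sphere 0 1) w *\<^sub>R F w \<partial>circle_measure) = 0"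
      using circle_mean_value(2)[OF Fc Fh] by (simp add: F_def f0)
    show ?thesis unfolding eq
      using integrable_Re[OF I] integral_Re[OF I] unfolding E zero_complex.sel by blast
  qed
  have up: "norm (1 - g w) \<le> 2" "norm (1 - of_real (r n) * g w) \<le> 2" for n w
  proof -
    show "norm (1 - g w) \<le> 2" using norm_triangle_ineq4[of 1 "g w"] g1[of w] by simp
    have "norm (of_real (r n) * g w) \<le> 1" using r[of n] g1[of w] by (simp add: norm_mult mult_le_one)
    then show "norm (1 - of_real (r n) * g w) \<le> 2"
      using norm_triangle_ineq4[of 1 "of_real (r n) * g w"] by simp
  qed
  have ln_le: "ln x \<le> ln 2" if "0 \<le> x" "x \<le> 2" for x :: real
    using that by (cases "x = 0") auto
  have l_le: "l n w \<le> ln 2" "l0 w \<le> ln 2" for n w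
    unfolding l_def l0_def using up by (auto intro: ln_le)
  have lim: "(\<lambda>n. l n w) \<longlonglongrightarrow> l0 w" if "g w \<noteq> 1" for w
  proof -
    have "(\<lambda>n. ln (norm (1 - of_real (r n) * g w))) \<longlonglongrightarrow> ln (norm (1 - of_real 1 * g w))"
      using that by (intro tendsto_intros rlim) auto
    then show ?thesis by (simp add: l_def l0_def)
  qed
  \<comment> \<open>Subtracting from ln 2 makes the integrands nonnegative, with the same integral
    for every n: the input for Fatou.\<close>
  have nn: "(\<integral>\<^sup>+w. ennreal (ln 2 - l n w) \<partial>circle_measure) = ennreal (ln 2)" for n
    using mv[of n] l_le by (subst nn_integral_eq_integral) (auto simp: circle.prob_space[simplified])
  have "(\<integral>\<^sup>+w. ennreal (ln 2 - l0 w) \<partial>circle_measure) = (\<integral>\<^sup>+w. liminf (\<lambda>n. ennreal (ln 2 - l n w)) \<partial>circle_measure)"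
  proof (rule nn_integral_cong_AE, use AE1 in eventually_elim)
    case (elim w)
    then have "(\<lambda>n. ennreal (ln 2 - l n w)) \<longlonglongrightarrow> ennreal (ln 2 - l0 w)"
      by (intro tendsto_ennrealI tendsto_intros lim)
    then show ?case by (simp add: lim_imp_Liminf)
  qed
  also have "\<dots> \<le> liminf (\<lambda>n. \<integral>\<^sup>+w. ennreal (ln 2 - l n w) \<partial>circle_measure)"
    using lm by (intro nn_integral_liminf) auto
  also have "\<dots> = ennreal (ln 2)" by (simp add: nn Liminf_const)
  finally have "(\<integral>\<^sup>+w. ennreal (ln 2 - l0 w) \<partial>circle_measure) < \<infinity>"
    using le_less_trans[OF _ ennreal_less_top] by auto
  then have "integrable circle_measure (\<lambda>w. ln 2 - l0 w)"
    using l0m l_le by (intro integrableI_nonneg) auto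
  from Bochner_Integration.integrable_diff[OF _ this, of "\<lambda>_. ln 2"]
  have int0: "integrable circle_measure l0" by simp
  have bound: "norm (l n w) \<le> 2 * ln 2 + \<bar>l0 w\<bar>" if "g w \<noteq> 1" for n w
  proof -
    have "norm (1 - g w) \<le> 2 * norm (1 - of_real (r n) * g w)"
      using norm_one_minus_le_double[of "r n" "g w"] r[of n] g1[of w] by simp
    moreover have "norm (1 - g w) > 0" using that by simp
    ultimately have "ln (norm (1 - g w)) \<le> ln (2 * norm (1 - of_real (r n) * g w))"
      by (subst ln_le_cancel_iff) auto
    also have "\<dots> = ln 2 + ln (norm (1 - of_real (r n) * g w))"
      using \<open>norm (1 - g w) > 0\<close> \<open>norm (1 - g w) \<le> 2 * norm (1 - of_real (r n) * g w)\<close>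
      by (subst ln_mult_pos) auto
    finally have "l0 w \<le> ln 2 + l n w" by (simp add: l_def l0_def)
    moreover have "0 \<le> ln (2::real)" by simp
    ultimately show ?thesis using l_le(1)[of n w] unfolding real_norm_def by arith
  qed
  have "(\<lambda>n. \<integral>w. l n w \<partial>circle_measure) \<longlonglongrightarrow> (\<integral>w. l0 w \<partial>circle_measure)"
  proof (rule integral_dominated_convergence[where w = "\<lambda>w. 2 * ln 2 + \<bar>l0 w\<bar>"])
    show "AE w in circle_measure. (\<lambda>n. l n w) \<longlonglongrightarrow> l0 w" using AE1 by eventually_elim (rule lim)
    show "AE w in circle_measure. norm (l n w) \<le> 2 * ln 2 + \<bar>l0 w\<bar>" for n
      using AE1 by eventually_elim (rule bound)
  qed (use lm l0m int0 in auto)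
  then have "(\<integral>w. l0 w \<partial>circle_measure) = 0"
    using mv by (simp add: LIMSEQ_const_iff)
  then show "integrable circle_measure (\<lambda>w. ln (norm (1 - g w)))"
    and "(\<integral>w. ln (norm (1 - g w)) \<partial>circle_measure) = 0"
    using int0 by (simp_all add: l0_def[abs_def])
qed

subsection \<open>The image of arc length and its potential\<close>

definition psi_circle :: "complex \<Rightarrow> complex" where
  "psi_circle w = indicator (sphere 0 1) w *\<^sub>R psi w"

lemma psi_circle_eq [simp]: "norm w = 1 \<Longrightarrow> psi_circle w = psi w"
  by (simp add: psi_circle_def)

lemma psi_circle_measurable [measurable]: "psi_circle \<in> borel_measurable borel"
  unfolding psi_circle_def[abs_def]
  by (intro borel_measurable_continuous_on_indicator continuous_on_psi) auto

definition mu_Gamma :: "complex measure" where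
  "mu_Gamma = distr circle_measure borel psi_circle"

lemma psi_circle_measurable': "psi_circle \<in> measurable circle_measure borel"
  by simp

lemma sets_mu_Gamma [simp, measurable_cong]: "sets mu_Gamma = sets borel"
  by (simp add: mu_Gamma_def)

lemma space_mu_Gamma [simp]: "space mu_Gamma = UNIV"
  by (simp add: mu_Gamma_def)

lemma prob_space_mu_Gamma: "prob_space mu_Gamma"
  unfolding mu_Gamma_def by (rule circle.prob_space_distr) simp

lemma phi_measurable [measurable]: "phi \<in> borel_measurable borel"
  unfolding phi_def[abs_def] by measurable

lemma Gamma_borel [measurable]: "Gamma_curve \<in> sets borel"
  using closed_Gamma by (rule borel_closed)

text \<open>\<open>phi\<close> and \<open>psi\<close> are inverse bijections between curve and
  circle, so the forward image under \<open>phi\<close> is a preimage under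
  \<open>psi_circle\<close>, hence Borel.\<close>

lemma emeasure_mu_Gamma:
  assumes "B \<in> sets borel"
  shows "emeasure mu_Gamma B = emeasure circle_measure (phi ` (B \<inter> Gamma_curve))"
proof -
  have eq: "phi ` (B \<inter> Gamma_curve) = sphere 0 1 \<inter> psi_circle -` B"
  proof (intro equalityI subsetI)
    fix w assume "w \<in> phi ` (B \<inter> Gamma_curve)"
    then obtain z where "z \<in> B" "z \<in> Gamma_curve" "w = phi z" by blast
    then show "w \<in> sphere 0 1 \<inter> psi_circle -` B" using psi_phi[of z] by (auto simp: Gamma_curve_def)
  next
    fix w assume "w \<in> sphere 0 1 \<inter> psi_circle -` B"
    then have "psi w \<in> B \<inter> Gamma_curve" "phi (psi w) = w"
      using psi_in_Gamma[of w] by (auto intro!: phi_psi)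
    then show "w \<in> phi ` (B \<inter> Gamma_curve)" by force
  qed
  have m: "psi_circle -` B \<in> sets borel"
    using measurable_sets[OF psi_circle_measurable assms] by simp
  have "emeasure mu_Gamma B = emeasure circle_measure (psi_circle -` B)"
    using assms by (simp add: mu_Gamma_def emeasure_distr)
  also have "\<dots> = emeasure circle_measure (sphere 0 1 \<inter> psi_circle -` B)"
  proof (rule emeasure_eq_AE)
    show "AE w in circle_measure. (w \<in> psi_circle -` B) = (w \<in> sphere 0 1 \<inter> psi_circle -` B)"
      using AE_circle_norm by eventually_elim simp
  qed (use m in auto)
  finally show ?thesis unfolding eq .
qed

lemma AE_mu_Gamma: "AE z in mu_Gamma. z \<in> Gamma_curve"
  unfolding mu_Gamma_def
proof (subst AE_distr_iff)
  show "AE w in circle_measure. psi_circle w \<in> Gamma_curve"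
    using AE_circle_norm by eventually_elim (simp add: psi_in_Gamma)
qed auto

lemma emeasure_mu_Gamma_Gamma: "emeasure mu_Gamma Gamma_curve = 1"
  using prob_space.emeasure_eq_1_AE[OF prob_space_mu_Gamma, of Gamma_curve] AE_mu_Gamma by auto

lemma prob_measure_on_mu_Gamma: "prob_measure_on Gamma_curve mu_Gamma"
  by (simp add: prob_measure_on_def prob_space_mu_Gamma emeasure_mu_Gamma_Gamma)

text \<open>No atoms: \<open>psi\<close> is injective and points of the circle are null. The
  diagonal has to be null because \<open>ln\<close> takes a default value at 0.\<close>

lemma AE_mu_Gamma_neq: "AE z in mu_Gamma. z \<noteq> a"
  unfolding mu_Gamma_def
proof (subst AE_distr_iff)
  show "AE w in circle_measure. psi_circle w \<noteq> a"
    using AE_circle_norm AE_circle_neq[of "phi a"]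
  proof eventually_elim
    case (elim w)
    then show ?case using phi_psi[of w] by force
  qed
qed auto

lemma integral_phi_power:
  assumes "k \<ge> 1"
  shows "(\<integral>z. phi z ^ k \<partial>mu_Gamma) = 0"
proof -
  have "(\<integral>z. phi z ^ k \<partial>mu_Gamma) = (\<integral>w. phi (psi_circle w) ^ k \<partial>circle_measure)"
    unfolding mu_Gamma_def by (rule integral_distr) auto
  also have "\<dots> = (\<integral>w. indicator (sphere 0 1) w *\<^sub>R w ^ k \<partial>circle_measure)"
  proof (rule integral_cong_AE)
    show "AE w in circle_measure. phi (psi_circle w) ^ k = indicator (sphere 0 1) w *\<^sub>R w ^ k"
      using AE_circle_norm
    proof eventually_elim
      case (elim w)
      then have "w \<noteq> 0" by auto
      then show ?case using elim by (simp add: phi_psi)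
    qed
    have "(\<lambda>w::complex. indicator (sphere 0 1) w *\<^sub>R w ^ k) \<in> borel_measurable borel"
      by (intro borel_measurable_continuous_on_indicator continuous_intros) auto
    then show "(\<lambda>w. indicator (sphere 0 1) w *\<^sub>R w ^ k) \<in> borel_measurable circle_measure" by simp
  qed auto
  also have "\<dots> = 0 ^ k"
    by (rule circle_mean_value(2)) (auto intro!: continuous_intros holomorphic_intros)
  finally show ?thesis using assms by (simp add: power_0_left)
qed

lemma measure_support_mu_Gamma: "measure_support mu_Gamma = Gamma_curve"
proof (intro equalityI subsetI)
  fix z assume z: "z \<in> measure_support mu_Gamma"
  show "z \<in> Gamma_curve"
  proof (rule ccontr)
    assume "z \<notin> Gamma_curve"
    then have "emeasure mu_Gamma (- Gamma_curve) > 0"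
      using z closed_Gamma by (auto simp: measure_support_def)
    moreover have "emeasure mu_Gamma (- Gamma_curve) = 0"
      using AE_mu_Gamma by (subst (asm) AE_iff_measurable[OF _ refl]) (auto simp: Compl_eq)
    ultimately show False by simp
  qed
next
  fix z assume z: "z \<in> Gamma_curve"
  show "z \<in> measure_support mu_Gamma"
    unfolding measure_support_def
  proof (intro CollectI allI impI, elim conjE)
    fix U :: "complex set" assume U: "open U" "z \<in> U"
    define a where "a = Arg2pi (phi z)"
    have a: "0 \<le> a" "a < 2 * pi" "cis a = phi z"
      using Arg2pi_ge_0[of "phi z"] Arg2pi_lt_2pi[of "phi z"] Arg2pi_eq[of "phi z"] z
      by (auto simp: a_def Gamma_curve_def cis_conv_exp)
    have cont: "continuous_on {0..2*pi} (\<lambda>t. psi (cis t))"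
      by (intro continuous_on_compose2[OF continuous_on_psi] continuous_intros) auto
    obtain d where d: "d > 0" "\<And>t. t \<in> {0..2*pi} \<Longrightarrow> dist t a < d \<Longrightarrow> psi (cis t) \<in> U"
    proof -
      obtain e where e: "e > 0" "ball z e \<subseteq> U" using U open_contains_ball by blast
      have "psi (cis a) = z" using a(3) psi_phi[OF z] by simp
      then obtain d where "d > 0" "\<And>t. t \<in> {0..2*pi} \<Longrightarrow> dist t a < d \<Longrightarrow> dist (psi (cis t)) z < e"
        using cont[unfolded continuous_on_iff, rule_format, of a e] a e(1) by auto
      then show ?thesis using that[of d] e(2) by (metis dist_commute mem_ball subsetD)
    qed
    \<comment> \<open>The interval goes to the right of a and is cut off at 2 pi; it has positive
      length because a < 2 pi.\<close>
    define b where "b = min (2 * pi) (a + d / 2)"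
    have ab: "a < b" "b \<le> 2 * pi" "b < a + d" using a d(1) by (auto simp: b_def)
    have sub: "{a..b} \<subseteq> {0..2*pi} \<inter> cis -` (psi_circle -` U)"
      using ab a d(2) by (auto simp: dist_real_def)
    have mU: "psi_circle -` U \<in> sets borel"
      using measurable_sets[OF psi_circle_measurable borel_open[OF U(1)]] by simp
    have "cis -` (psi_circle -` U) \<in> sets borel"
      using measurable_sets[OF cis_measurable mU] by simp
    then have "emeasure lborel {a..b} \<le> emeasure lborel ({0..2*pi} \<inter> cis -` (psi_circle -` U))"
      by (intro emeasure_mono sub) auto
    moreover have "emeasure lborel {a..b} > 0" using ab by simp
    ultimately have "emeasure lborel ({0..2*pi} \<inter> cis -` (psi_circle -` U)) > 0" by order
    then have "emeasure circle_measure (psi_circle -` U) > 0"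
      unfolding emeasure_circle_measure[OF mU] by (simp add: ennreal_zero_less_divide)
    then show "emeasure mu_Gamma U > 0"
      using U(1) by (simp add: mu_Gamma_def emeasure_distr)
  qed
qed

lemma mu_Gamma_potential:
  assumes z: "z \<in> Gamma_curve"
  shows "integrable mu_Gamma (\<lambda>t. ln (norm (z - t)))"
    and "(\<integral>t. ln (norm (z - t)) \<partial>mu_Gamma) = ln 4"
proof -
  define u where "u = phi z"
  have u: "norm u = 1" and z1: "norm z \<ge> 1" and z0: "z \<noteq> 0" and u0: "u \<noteq> 0"
    using z by (auto simp: u_def Gamma_curve_def)
  \<comment> \<open>As |u| = 1, |w - u| = |1 - f1 w|; and 1 - 1/(psi w z) is the conjugate of 1 - f2
    w. So both factors are moduli of 1 - f with f holomorphic in the disc and f 0 = 0, as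
    \<open>circle_log_mean\<close> requires.\<close>
  define f1 where "f1 v = cnj u * v" for v
  define f2 where "f2 v = chi v / cnj z" for v
  define g1 where "g1 w = indicator (sphere 0 1) w *\<^sub>R f1 w" for w
  define g2 where "g2 w = indicator (sphere 0 1) w *\<^sub>R f2 w" for w
  have key: "g1 w \<noteq> 1 \<and> g2 w \<noteq> 1 \<and>
     ln (norm (z - psi_circle w)) = ln 4 + ln (norm (1 - g1 w)) - ln (norm (1 - g2 w))"
    if w: "norm w = 1" "w \<noteq> u" for w
  proof -
    have w0: "w \<noteq> 0" using w by auto
    have w_inv: "1 / w = cnj w" using w(1) w0 by (simp add: field_simps complex_norm_square[symmetric])
    have p0: "psi w \<noteq> 0" using norm_psi_ge[OF w0] w by auto
    have "1 / psi w = chi (1 / w)" using psi_chi[OF w0] p0 by (simp add: field_simps)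
    also have "\<dots> = cnj (chi w)" unfolding w_inv using w by (intro chi_cnj) simp
    finally have inv: "1 / psi w = cnj (chi w)" .
    have "1 / (psi w * z) = cnj (f2 w)"
      using inv by (simp add: f2_def) (metis divide_divide_eq_left mult_1 times_divide_eq_left inv)
    then have "1 - 1 / (psi w * z) = cnj (1 - f2 w)" by simp
    then have n2: "norm (1 - 1 / (psi w * z)) = norm (1 - g2 w)"
      using w by (metis complex_mod_cnj g2_def indicator_simps(1) mem_sphere_0 scaleR_one)
    have "u * (1 - f1 w) = u - w" using u by (simp add: f1_def right_diff_distrib mult.assoc[symmetric] complex_norm_square[symmetric])
    then have "norm (1 - f1 w) = norm (u - w)" using u by (metis mult_1 norm_mult)
    then have n1: "norm (w - u) = norm (1 - g1 w)" using w by (simp add: g1_def norm_minus_commute)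
    have "4 * (w - u) = (psi w - z) * (1 - 1 / (psi w * z))"
      using phi_minus_phi[OF p0 z0] phi_psi[OF w0] by (simp add: u_def)
    then have "norm (4 :: complex) * norm (w - u) = norm (psi w - z) * norm (1 - 1 / (psi w * z))"
      by (simp only: norm_mult[symmetric])
    then have prod: "4 * norm (1 - g1 w) = norm (z - psi w) * norm (1 - g2 w)"
      unfolding n1 n2 by (simp add: norm_minus_commute)
    \<comment> \<open>The single exclusion w = u serves both logarithms: once the left side of
      \<open>prod\<close> is nonzero, so are both factors on the right.\<close>
    have nz1: "norm (1 - g1 w) \<noteq> 0" using n1 w by (metis norm_eq_zero right_minus_eq)
    then have nz2: "norm (1 - g2 w) \<noteq> 0" "norm (z - psi w) \<noteq> 0" using prod by auto
    have "ln (4 * norm (1 - g1 w)) = ln (norm (z - psi w) * norm (1 - g2 w))" by (simp only: prod)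
    then have "ln 4 + ln (norm (1 - g1 w)) = ln (norm (z - psi w)) + ln (norm (1 - g2 w))"
      using nz1 nz2 by (simp add: ln_mult_pos)
    then show ?thesis using nz1 nz2 w by auto
  qed
  have AE0: "AE w in circle_measure. norm w = 1 \<and> w \<noteq> u"
    using AE_circle_norm AE_circle_neq by eventually_elim simp
  have i1: "integrable circle_measure (\<lambda>w. ln (norm (1 - g1 w)))" "(\<integral>w. ln (norm (1 - g1 w)) \<partial>circle_measure) = 0"
  proof -
    have "AE w in circle_measure. g1 w \<noteq> 1" using AE0 by eventually_elim (use key in blast)
    moreover have "continuous_on (cball 0 1) f1" "f1 holomorphic_on ball 0 1"
      unfolding f1_def by (intro continuous_intros holomorphic_intros)+
    ultimately show "integrable circle_measure (\<lambda>w. ln (norm (1 - g1 w)))" "(\<integral>w. ln (norm (1 - g1 w)) \<partial>circle_measure) = 0"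
      unfolding g1_def by (intro circle_log_mean; simp add: f1_def norm_mult u)+
  qed
  have i2: "integrable circle_measure (\<lambda>w. ln (norm (1 - g2 w)))" "(\<integral>w. ln (norm (1 - g2 w)) \<partial>circle_measure) = 0"
  proof -
    have "AE w in circle_measure. g2 w \<noteq> 1" using AE0 by eventually_elim (use key in blast)
    moreover have "continuous_on (cball 0 1) f2" "f2 holomorphic_on ball 0 1"
      unfolding f2_def using z0
      by (intro continuous_intros holomorphic_intros continuous_on_chi holomorphic_on_chi; simp)+
    moreover have "norm (f2 v) \<le> 1" if "norm v \<le> 1" for v
      using norm_chi_le[of v] that z1 by (auto simp: f2_def norm_divide divide_le_eq)
    moreover have "f2 0 = 0" by (simp add: f2_def chi_def)
    ultimately show "integrable circle_measure (\<lambda>w. ln (norm (1 - g2 w)))" "(\<integral>w. ln (norm (1 - g2 w)) \<partial>circle_measure) = 0"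
      unfolding g2_def by (intro circle_log_mean; simp)+
  qed
  define L where "L w = ln 4 + ln (norm (1 - g1 w)) - ln (norm (1 - g2 w))" for w
  have iL: "integrable circle_measure L" "(\<integral>w. L w \<partial>circle_measure) = ln 4"
    unfolding L_def using i1 i2 by (auto simp: circle.prob_space[simplified])
  have AEL: "AE w in circle_measure. ln (norm (z - psi_circle w)) = L w"
    using AE0 by eventually_elim (use key in \<open>auto simp: L_def\<close>)
  have "integrable circle_measure (\<lambda>w. ln (norm (z - psi_circle w)))"
    using iL(1) AEL by (subst integrable_cong_AE[OF _ _ AEL]) auto
  then show "integrable mu_Gamma (\<lambda>t. ln (norm (z - t)))"
    unfolding mu_Gamma_def by (subst integrable_distr_eq) auto
  have "(\<integral>t. ln (norm (z - t)) \<partial>mu_Gamma) = (\<integral>w. ln (norm (z - psi_circle w)) \<partial>circle_measure)"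
    unfolding mu_Gamma_def by (rule integral_distr) auto
  also have "\<dots> = (\<integral>w. L w \<partial>circle_measure)"
    using iL(1) by (intro integral_cong_AE AEL) auto
  finally show "(\<integral>t. ln (norm (z - t)) \<partial>mu_Gamma) = ln 4" using iL by simp
qed

subsection \<open>Positive definiteness of the logarithmic energy\<close>

text \<open>The integral over \<open>s\<close> is \<open>- ln q / 2\<close> (Frullani). The subtracted \<open>exp (- s)\<close> cancels for
  differences of measures of equal mass.\<close>

definition log_kernel :: "real \<Rightarrow> real \<Rightarrow> real" where
  "log_kernel q s = indicator {0..} s * ((exp (- (q * s)) - exp (- s)) / (2 * s))"

text \<open>The quotient is the integral of exp (- x s) over x in [a, b]; Tonelli, and the integral
  1/x over s, finish the computation.\<close>

lemma Frullani_exp: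
  assumes "0 < a" "a \<le> b"
  shows "(\<integral>\<^sup>+s. ennreal (indicator {0..} s * ((exp (- (a * s)) - exp (- (b * s))) / s)) \<partial>lborel) = ennreal (ln b - ln a)"
proof -
  have "(\<integral>\<^sup>+s. ennreal (indicator {0..} s * ((exp (- (a * s)) - exp (- (b * s))) / s)) \<partial>lborel) =
      (\<integral>\<^sup>+s. (\<integral>\<^sup>+x. ennreal (exp (- (x * s))) * indicator {a..b} x * indicator {0..} s \<partial>lborel) \<partial>lborel)"
  \<comment> \<open>The point s = 0, where the quotient takes the default value 0, is a null
    set.\<close>
  proof (rule nn_integral_cong_AE, use AE_lborel_singleton[of 0] in eventually_elim)
    case (elim s)
    show ?case
    proof (cases "s > 0")
      case True
      have "(\<integral>\<^sup>+x. ennreal (exp (- (x * s))) * indicator {a..b} x \<partial>lborel) =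
          ennreal (- exp (- (b * s)) / s - (- exp (- (a * s)) / s))"
        by (rule nn_integral_FTC_Icc[OF _ _ _ assms(2), of "\<lambda>x. exp (- (x * s))" "\<lambda>x. - exp (- (x * s)) / s"])
           (use True in \<open>auto intro!: derivative_eq_intros simp: has_real_derivative_iff_has_vector_derivative[symmetric]\<close>)
      also have "- exp (- (b * s)) / s - (- exp (- (a * s)) / s) = (exp (- (a * s)) - exp (- (b * s))) / s"
        by (simp add: diff_divide_distrib)
      finally show ?thesis using True by simp
    qed (use elim in auto)
  qed
  also have "\<dots> = (\<integral>\<^sup>+x. (\<integral>\<^sup>+s. ennreal (exp (- (x * s))) * indicator {a..b} x * indicator {0..} s \<partial>lborel) \<partial>lborel)"
    by (rule lborel_pair.Fubini'[symmetric]) (simp, measurable)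
  also have "\<dots> = (\<integral>\<^sup>+x. ennreal (1 / x) * indicator {a..b} x \<partial>lborel)"
  proof (rule nn_integral_cong)
    fix x :: real
    show "(\<integral>\<^sup>+s. ennreal (exp (- (x * s))) * indicator {a..b} x * indicator {0..} s \<partial>lborel) =
        ennreal (1 / x) * indicator {a..b} x"
    proof (cases "x \<in> {a..b}")
      case True
      then have x: "x > 0" using assms by auto
      have lim: "((\<lambda>s. - exp (- (x * s)) / x) \<longlongrightarrow> 0) at_top"
        using x by real_asymp
      have "(\<integral>\<^sup>+s. ennreal (exp (- (x * s))) * indicator {0..} s \<partial>lborel) = ennreal (0 - (- exp (- (x * 0)) / x))"
        by (rule nn_integral_FTC_atLeast[OF _ _ _ lim]) (use x in \<open>auto intro!: derivative_eq_intros\<close>)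
      then show ?thesis using True by simp
    qed simp
  qed
  also have "\<dots> = ennreal (ln b - ln a)"
    using assms
    by (intro nn_integral_FTC_Icc)
       (auto intro!: derivative_eq_intros simp: has_real_derivative_iff_has_vector_derivative[symmetric])
  finally show ?thesis .
qed

lemma log_kernel_measurable [measurable]: "(\<lambda>(q, s). log_kernel q s) \<in> borel_measurable (borel \<Otimes>\<^sub>M borel)"
  unfolding log_kernel_def by measurable

text \<open>The kernel keeps one sign, decided by r <= 1, so the nonnegative Frullani formula gives
  the integral and the absolute integral alike. The latter is needed for Fubini in
  \<open>log_energy_as_gauss\<close>.\<close>

lemma log_kernel_integral:
  assumes "r > 0"
  shows "integrable lborel (log_kernel (r\<^sup>2))" "(\<integral>s. log_kernel (r\<^sup>2) s \<partial>lborel) = - ln r"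
    "(\<integral>s. norm (log_kernel (r\<^sup>2) s) \<partial>lborel) = \<bar>ln r\<bar>"
proof -
  have main: "has_bochner_integral lborel (log_kernel (r\<^sup>2)) (- ln r) \<and>
     has_bochner_integral lborel (\<lambda>s. norm (log_kernel (r\<^sup>2) s)) \<bar>ln r\<bar>"
  proof (cases "r \<le> 1")
    case True
    have nn: "log_kernel (r\<^sup>2) s \<ge> 0" for s
    proof (cases "s > 0")
      case s: True
      have "r\<^sup>2 * s \<le> 1 * s" using True assms s by (intro mult_right_mono power_le_one) auto
      then show ?thesis using s by (auto simp: log_kernel_def)
    qed (auto simp: log_kernel_def indicator_def)
    have "(\<integral>\<^sup>+s. ennreal (2 * log_kernel (r\<^sup>2) s) \<partial>lborel) = ennreal (ln 1 - ln (r\<^sup>2))"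
      using Frullani_exp[of "r\<^sup>2" 1] True assms by (simp add: log_kernel_def power_le_one)
    then have "has_bochner_integral lborel (\<lambda>s. 2 * log_kernel (r\<^sup>2) s) (ln 1 - ln (r\<^sup>2))"
      using nn True assms by (intro has_bochner_integral_nn_integral) (auto simp: ln_realpow)
    from has_bochner_integral_mult_right[OF this, of "1 / 2"]
    have h: "has_bochner_integral lborel (log_kernel (r\<^sup>2)) (- ln r)"
      using assms by (simp add: ln_realpow)
    then show ?thesis using nn True assms by simp
  next
    case False
    have nn: "log_kernel (r\<^sup>2) s \<le> 0" for s
    proof (cases "s > 0")
      case s: True
      have "1 * s \<le> r\<^sup>2 * s" using False s by (intro mult_right_mono one_le_power) auto
      then show ?thesis using s by (auto simp: log_kernel_def divide_nonpos_pos)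
    qed (auto simp: log_kernel_def indicator_def)
    have "2 * - log_kernel (r\<^sup>2) s = indicator {0..} s * ((exp (- (1 * s)) - exp (- (r\<^sup>2 * s))) / s)" for s
      by (cases "s = 0") (simp_all add: log_kernel_def field_simps)
    then have "(\<integral>\<^sup>+s. ennreal (2 * - log_kernel (r\<^sup>2) s) \<partial>lborel) = ennreal (ln (r\<^sup>2) - ln 1)"
      using Frullani_exp[of 1 "r\<^sup>2"] False assms by (simp add: one_le_power)
    then have "has_bochner_integral lborel (\<lambda>s. 2 * - log_kernel (r\<^sup>2) s) (ln (r\<^sup>2) - ln 1)"
      using nn False assms by (intro has_bochner_integral_nn_integral) (auto simp: ln_realpow)
    from has_bochner_integral_mult_right[OF this, of "- 1 / 2"] has_bochner_integral_mult_right[OF this, of "1 / 2"]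
    have h: "has_bochner_integral lborel (log_kernel (r\<^sup>2)) (- ln r)"
      "has_bochner_integral lborel (\<lambda>s. - log_kernel (r\<^sup>2) s) (ln r)"
      using assms by (simp_all add: ln_realpow)
    have "norm (log_kernel (r\<^sup>2) s) = - log_kernel (r\<^sup>2) s" for s using nn[of s] by simp
    then show ?thesis using h False by simp
  qed
  then show "integrable lborel (log_kernel (r\<^sup>2))" "(\<integral>s. log_kernel (r\<^sup>2) s \<partial>lborel) = - ln r"
    "(\<integral>s. norm (log_kernel (r\<^sup>2) s) \<partial>lborel) = \<bar>ln r\<bar>"
    by (auto simp: has_bochner_integral_iff)
qed

section \<open>Probability measures on a compact set and their products\<close>

lemma prob_measure_onD:
  assumes "prob_measure_on K \<alpha>"
  shows "prob_space \<alpha>" "sets \<alpha> = sets borel" "space \<alpha> = UNIV"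
  using assms by (auto simp: prob_measure_on_def dest: sets_eq_imp_space_eq)

lemma prob_measure_on_AE:
  assumes "prob_measure_on K \<alpha>" "compact K"
  shows "AE z in \<alpha>. z \<in> K"
proof -
  interpret prob_space \<alpha> using prob_measure_onD[OF assms(1)] by simp
  have "K \<in> sets \<alpha>" using prob_measure_onD(2)[OF assms(1)] assms(2) by (simp add: borel_compact)
  moreover have "prob K = 1" using assms(1) by (simp add: prob_measure_on_def measure_def)
  ultimately show ?thesis by (simp add: prob_eq_1)
qed

lemma sets_pair_prob_measure_on:
  assumes "prob_measure_on K \<alpha>" "prob_measure_on K \<beta>"
  shows "sets (\<alpha> \<Otimes>\<^sub>M \<beta>) = sets (borel :: (complex \<times> complex) measure)"
  unfolding borel_prod[symmetric] using assms by (intro sets_pair_measure_cong prob_measure_onD(2))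

lemma borel_measurable_pair_prob:
  assumes "prob_measure_on K \<alpha>" "prob_measure_on K \<beta>" "f \<in> borel_measurable (borel :: (complex \<times> complex) measure)"
  shows "f \<in> borel_measurable (\<alpha> \<Otimes>\<^sub>M \<beta>)"
  using assms(3) measurable_cong_sets[OF sets_pair_prob_measure_on[OF assms(1,2)] refl] by blast

lemma AE_pair_prob:
  assumes "prob_measure_on K \<alpha>" "prob_measure_on K \<beta>" "compact K"
  shows "AE p in \<alpha> \<Otimes>\<^sub>M \<beta>. fst p \<in> K \<and> snd p \<in> K"
proof -
  interpret A: prob_space \<alpha> using prob_measure_onD[OF assms(1)] by simp
  interpret B: prob_space \<beta> using prob_measure_onD[OF assms(2)] by simp
  interpret pair_sigma_finite \<alpha> \<beta> ..
  have "K \<times> K \<in> sets borel" using assms(3) by (intro borel_compact compact_Times)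
  then have "K \<times> K \<in> sets (\<alpha> \<Otimes>\<^sub>M \<beta>)" by (simp add: sets_pair_prob_measure_on[OF assms(1,2)])
  moreover have "{p \<in> space (\<alpha> \<Otimes>\<^sub>M \<beta>). fst p \<in> K \<and> snd p \<in> K} = K \<times> K"
    using prob_measure_onD(3) assms by (auto simp: space_pair_measure)
  ultimately have m: "{p \<in> space (\<alpha> \<Otimes>\<^sub>M \<beta>). fst p \<in> K \<and> snd p \<in> K} \<in> sets (\<alpha> \<Otimes>\<^sub>M \<beta>)" by simp
  show ?thesis
    by (rule AE_pair_measure[OF m], use prob_measure_on_AE[OF assms(1,3)] in eventually_elim,
        use prob_measure_on_AE[OF assms(2,3)] in eventually_elim) auto
qed

lemma integrable_pair_bounded:
  fixes f :: "complex \<times> complex \<Rightarrow> 'a :: {banach, second_countable_topology}"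
  assumes "prob_measure_on K \<alpha>" "prob_measure_on K \<beta>" "compact K"
    and "f \<in> borel_measurable borel" "\<And>z t. z \<in> K \<Longrightarrow> t \<in> K \<Longrightarrow> norm (f (z, t)) \<le> B"
  shows "integrable (\<alpha> \<Otimes>\<^sub>M \<beta>) f"
proof -
  interpret A: prob_space \<alpha> using prob_measure_onD[OF assms(1)] by simp
  interpret B: prob_space \<beta> using prob_measure_onD[OF assms(2)] by simp
  interpret pair_prob_space \<alpha> \<beta> ..
  have "AE p in \<alpha> \<Otimes>\<^sub>M \<beta>. norm (f p) \<le> B"
    using AE_pair_prob[OF assms(1-3)] by eventually_elim (use assms(5) in \<open>metis prod.collapse\<close>)
  then show ?thesis
    by (intro integrable_const_bound[of _ B] borel_measurable_pair_prob[OF assms(1,2)] assms(4))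
qed

lemma integrable_continuous_prob:
  fixes f :: "complex \<Rightarrow> 'a :: {banach, second_countable_topology}"
  assumes "prob_measure_on K \<alpha>" "compact K" "continuous_on UNIV f"
  shows "integrable \<alpha> f"
proof -
  interpret A: prob_space \<alpha> using prob_measure_onD[OF assms(1)] by simp
  have "compact (f ` K)" using assms continuous_on_subset by (intro compact_continuous_image) auto
  then obtain B where B: "\<And>z. z \<in> K \<Longrightarrow> norm (f z) \<le> B"
    by (meson bounded_iff compact_imp_bounded imageI)
  have "f \<in> borel_measurable \<alpha>"
    using borel_measurable_continuous_onI[OF assms(3)] measurable_cong_sets[OF prob_measure_onD(2)[OF assms(1)] refl] by blast
  then show ?thesis
    using prob_measure_on_AE[OF assms(1,2)] B by (intro A.integrable_const_bound[of _ B]) (auto elim!: eventually_mono)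
qed

lemma integral_pair_mult:
  fixes f g :: "complex \<Rightarrow> complex"
  assumes "prob_measure_on K \<alpha>" "prob_measure_on K \<beta>" "compact K"
    and "continuous_on UNIV f" "continuous_on UNIV g"
  shows "integrable (\<alpha> \<Otimes>\<^sub>M \<beta>) (\<lambda>p. f (fst p) * g (snd p))"
    "(\<integral>p. f (fst p) * g (snd p) \<partial>(\<alpha> \<Otimes>\<^sub>M \<beta>)) = (\<integral>z. f z \<partial>\<alpha>) * (\<integral>t. g t \<partial>\<beta>)"
proof -
  interpret A: prob_space \<alpha> using prob_measure_onD[OF assms(1)] by simp
  interpret B: prob_space \<beta> using prob_measure_onD[OF assms(2)] by simp
  interpret pair_sigma_finite \<alpha> \<beta> ..
  have cont: "continuous_on UNIV (\<lambda>p. f (fst p) * g (snd p))"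
    by (intro continuous_intros continuous_on_compose2[OF assms(4)] continuous_on_compose2[OF assms(5)]) auto
  have "compact ((\<lambda>p. f (fst p) * g (snd p)) ` (K \<times> K))"
    using assms(3) continuous_on_subset[OF cont] by (intro compact_continuous_image compact_Times) auto
  then obtain B where B: "\<And>p. p \<in> K \<times> K \<Longrightarrow> norm (f (fst p) * g (snd p)) \<le> B"
    by (meson bounded_iff compact_imp_bounded imageI)
  show i: "integrable (\<alpha> \<Otimes>\<^sub>M \<beta>) (\<lambda>p. f (fst p) * g (snd p))"
    by (rule integrable_pair_bounded[OF assms(1-3) borel_measurable_continuous_onI[OF cont], where B = B])
       (use B in force)
  have "(\<integral>p. f (fst p) * g (snd p) \<partial>(\<alpha> \<Otimes>\<^sub>M \<beta>)) = (\<integral>z. (\<integral>t. f z * g t \<partial>\<beta>) \<partial>\<alpha>)"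
    using integral_fst'[OF i] by simp
  then show "(\<integral>p. f (fst p) * g (snd p) \<partial>(\<alpha> \<Otimes>\<^sub>M \<beta>)) = (\<integral>z. f z \<partial>\<alpha>) * (\<integral>t. g t \<partial>\<beta>)"
    by simp
qed

section \<open>Gaussian energies as series of weighted moments\<close>

definition gauss_energy :: "real \<Rightarrow> complex measure \<Rightarrow> complex measure \<Rightarrow> real" where
  "gauss_energy s \<alpha> \<beta> = (\<integral>p. exp (- ((norm (fst p - snd p))\<^sup>2 * s)) \<partial>(\<alpha> \<Otimes>\<^sub>M \<beta>))"

definition gauss_moment :: "real \<Rightarrow> nat \<Rightarrow> nat \<Rightarrow> complex measure \<Rightarrow> complex" where
  "gauss_moment s i j \<alpha> = (\<integral>z. of_real (exp (- (s * (norm z)\<^sup>2))) * z ^ i * cnj z ^ j \<partial>\<alpha>)"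

text \<open>Fubini over the pair space and s: the absolute integral of the kernel over s is |ln |z -
  t||, so integrability of the logarithm is exactly the condition to check.\<close>

lemma log_energy_as_gauss:
  assumes "prob_measure_on K \<alpha>" "prob_measure_on K \<beta>" "compact K"
    and int: "integrable (\<alpha> \<Otimes>\<^sub>M \<beta>) (\<lambda>p. ln (norm (fst p - snd p)))"
    and neq: "AE p in \<alpha> \<Otimes>\<^sub>M \<beta>. fst p \<noteq> snd p"
  shows "has_bochner_integral lborel (\<lambda>s. indicator {0..} s * ((gauss_energy s \<alpha> \<beta> - exp (- s)) / (2 * s)))
     (- (\<integral>p. ln (norm (fst p - snd p)) \<partial>(\<alpha> \<Otimes>\<^sub>M \<beta>)))"
proof -
  interpret A: prob_space \<alpha> using prob_measure_onD[OF assms(1)] by simp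
  interpret B: prob_space \<beta> using prob_measure_onD[OF assms(2)] by simp
  interpret AB: pair_prob_space \<alpha> \<beta> ..
  interpret P: pair_sigma_finite "\<alpha> \<Otimes>\<^sub>M \<beta>" lborel ..
  define M where "M = \<alpha> \<Otimes>\<^sub>M \<beta>"
  define F where "F = (\<lambda>(p :: complex \<times> complex, s). log_kernel ((norm (fst p - snd p))\<^sup>2) s)"
  have "F \<in> borel_measurable ((borel \<Otimes>\<^sub>M borel) \<Otimes>\<^sub>M borel)"
    unfolding F_def by measurable
  then have "F \<in> borel_measurable (borel \<Otimes>\<^sub>M borel)" unfolding borel_prod .
  moreover have "sets (M \<Otimes>\<^sub>M lborel) = sets (borel \<Otimes>\<^sub>M borel)"
    using sets_pair_prob_measure_on[OF assms(1,2)] by (intro sets_pair_measure_cong) (auto simp: M_def)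
  ultimately have Fm: "F \<in> borel_measurable (M \<Otimes>\<^sub>M lborel)"
    using measurable_cong_sets[of "M \<Otimes>\<^sub>M lborel" "borel \<Otimes>\<^sub>M borel" borel borel] by blast
  have AEi: "AE p in M. integrable lborel (\<lambda>s. F (p, s)) \<and> (\<integral>s. F (p, s) \<partial>lborel) = - ln (norm (fst p - snd p)) \<and>
      (\<integral>s. norm (F (p, s)) \<partial>lborel) = \<bar>ln (norm (fst p - snd p))\<bar>"
    unfolding M_def using neq by eventually_elim (use log_kernel_integral in \<open>auto simp: F_def\<close>)
  have lnm: "(\<lambda>p. ln (norm (fst p - snd p))) \<in> borel_measurable M"
    unfolding M_def using int by auto
  have Fi: "integrable (M \<Otimes>\<^sub>M lborel) F"
    unfolding M_def
  proof (rule P.Fubini_integrable[OF Fm[unfolded M_def]])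
    have "AE p in M. \<bar>ln (norm (fst p - snd p))\<bar> = (\<integral>s. norm (F (p, s)) \<partial>lborel)"
      using AEi by eventually_elim simp
    moreover have "(\<lambda>p. \<integral>s. norm (F (p, s)) \<partial>lborel) \<in> borel_measurable M"
      using Fm unfolding M_def by (intro lborel.borel_measurable_lebesgue_integral) auto
    ultimately show "integrable (\<alpha> \<Otimes>\<^sub>M \<beta>) (\<lambda>p. \<integral>s. norm (F (p, s)) \<partial>lborel)"
      using integrable_abs[OF int] lnm unfolding M_def by (subst integrable_cong_AE[symmetric]) auto
    show "AE p in \<alpha> \<Otimes>\<^sub>M \<beta>. integrable lborel (\<lambda>s. F (p, s))"
      using AEi unfolding M_def by eventually_elim simp
  qed
  have "(\<integral>s. (\<integral>p. F (p, s) \<partial>M) \<partial>lborel) = (\<integral>p. (\<integral>s. F (p, s) \<partial>lborel) \<partial>M)"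
    unfolding M_def using Fi[unfolded M_def] by (intro P.Fubini_integral) (simp add: F_def)
  also have "\<dots> = (\<integral>p. - ln (norm (fst p - snd p)) \<partial>M)"
  proof (rule integral_cong_AE)
    show "AE p in M. (\<integral>s. F (p, s) \<partial>lborel) = - ln (norm (fst p - snd p))"
      using AEi by eventually_elim simp
    show "(\<lambda>p. \<integral>s. F (p, s) \<partial>lborel) \<in> borel_measurable M"
      using Fm unfolding M_def by (intro lborel.borel_measurable_lebesgue_integral) auto
  qed (use lnm in auto)
  finally have eq: "(\<integral>s. (\<integral>p. F (p, s) \<partial>M) \<partial>lborel) = - (\<integral>p. ln (norm (fst p - snd p)) \<partial>M)"
    by simp
  have "integrable lborel (\<lambda>s. \<integral>p. F (p, s) \<partial>M)"
    unfolding M_def using Fi[unfolded M_def] P.integrable_snd[of "\<lambda>p s. F (p, s)"] by simp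
  moreover have "(\<integral>p. F (p, s) \<partial>M) = indicator {0..} s * ((gauss_energy s \<alpha> \<beta> - exp (- s)) / (2 * s))" for s
  proof (cases "s \<ge> 0")
    case True
    have "integrable M (\<lambda>p. exp (- ((norm (fst p - snd p))\<^sup>2 * s)))"
      unfolding M_def
      by (rule integrable_pair_bounded[OF assms(1-3), where B = 1])
         (use True in \<open>auto intro!: borel_measurable_continuous_onI continuous_intros\<close>)
    then show ?thesis
      using True by (simp add: F_def log_kernel_def gauss_energy_def M_def AB.prob_space[simplified])
  qed (simp add: F_def log_kernel_def)
  ultimately show ?thesis using eq by (simp add: has_bochner_integral_iff M_def)
qed

text \<open>Split |z - t|^2 = |z|^2 + |t|^2 - 2 Re (z cnj t), expand the exponential of the mixed
  term, and apply the binomial theorem to 2 Re (z cnj t) = z cnj t + cnj z t. Each term is a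
  function of z times the conjugate of the same function of t.\<close>

lemma gauss_energy_expansion:
  assumes "prob_measure_on K \<alpha>" "prob_measure_on K \<beta>" "compact K" "s \<ge> 0"
  shows "(\<lambda>k. \<Sum>i\<le>k. s ^ k / fact k * real (k choose i) *
       Re (gauss_moment s i (k - i) \<alpha> * cnj (gauss_moment s i (k - i) \<beta>))) sums gauss_energy s \<alpha> \<beta>"
proof -
  define M where "M = \<alpha> \<Otimes>\<^sub>M \<beta>"
  interpret A: prob_space \<alpha> using prob_measure_onD[OF assms(1)] by simp
  interpret B: prob_space \<beta> using prob_measure_onD[OF assms(2)] by simp
  interpret AB: pair_prob_space \<alpha> \<beta> ..
  define e where "e z = exp (- (s * (norm z)\<^sup>2))" for z :: complex
  define h where "h i j z = of_real (e z) * z ^ i * cnj z ^ j" for i j z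
  have hc: "continuous_on UNIV (h i j)" for i j unfolding h_def e_def by (intro continuous_intros)
  have hcc: "continuous_on UNIV (\<lambda>z. cnj (h i j z))" for i j by (intro continuous_intros hc)
  have mom: "gauss_moment s i j \<gamma> = (\<integral>z. h i j z \<partial>\<gamma>)" for i j \<gamma>
    by (simp add: gauss_moment_def h_def e_def)
  define T where "T k p = e (fst p) * e (snd p) * ((2 * s * Re (fst p * cnj (snd p))) ^ k / fact k)" for k p
  have Tm: "T k \<in> borel_measurable borel" for k unfolding T_def e_def
    by (intro borel_measurable_continuous_onI continuous_intros) auto
  have T_eq: "of_real (T k p) = (\<Sum>i\<le>k. of_real (s ^ k / fact k * real (k choose i)) * (h i (k - i) (fst p) * cnj (h i (k - i) (snd p))))" for k p
  proof -
    obtain z t where p: "p = (z, t)" by (cases p)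
    have "of_real (2 * Re (z * cnj t)) = z * cnj t + cnj z * t" by (simp add: complex_eq_iff)
    then have "of_real ((2 * Re (z * cnj t)) ^ k) = (z * cnj t + cnj z * t) ^ k" by simp
    also have "\<dots> = (\<Sum>i\<le>k. of_nat (k choose i) * (z * cnj t) ^ i * (cnj z * t) ^ (k - i))"
      by (rule binomial_ring)
    finally have b: "of_real ((2 * Re (z * cnj t)) ^ k) = (\<Sum>i\<le>k. of_nat (k choose i) * (z * cnj t) ^ i * (cnj z * t) ^ (k - i))" .
    have "T k p = s ^ k / fact k * (e z * e t) * (2 * Re (z * cnj t)) ^ k"
    proof -
      have pw: "(2 * s * x) ^ k = s ^ k * (2 * x) ^ k" for x :: real
        by (simp add: power_mult_distrib)
      show ?thesis unfolding T_def p fst_conv snd_conv pw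
        by (simp del: times_complex.sel complex_cnj_mult power_mult_distrib)
    qed
    then have T: "complex_of_real (T k p) = of_real (s ^ k / fact k * (e z * e t)) * of_real ((2 * Re (z * cnj t)) ^ k)"
      by (simp only: of_real_mult)
    show ?thesis
      unfolding T b sum_distrib_left
      by (intro sum.cong) (simp_all add: p h_def power_mult_distrib mult_ac)
  qed
  have T_int: "integrable M (T k) \<and> (\<integral>p. T k p \<partial>M) = (\<Sum>i\<le>k. s ^ k / fact k * real (k choose i) *
       Re (gauss_moment s i (k - i) \<alpha> * cnj (gauss_moment s i (k - i) \<beta>)))" for k
  proof -
    note im = integral_pair_mult[OF assms(1-3) hc hcc]
    have ReM: "Re (of_real a * x) = a * Re x" for a x by simp
    have T_eq': "T k = (\<lambda>p. Re (\<Sum>i\<le>k. of_real (s ^ k / fact k * real (k choose i)) * (h i (k - i) (fst p) * cnj (h i (k - i) (snd p)))))"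
      by (rule ext) (metis Re_complex_of_real T_eq)
    have I: "integrable M (\<lambda>p. \<Sum>i\<le>k. of_real (s ^ k / fact k * real (k choose i)) * (h i (k - i) (fst p) * cnj (h i (k - i) (snd p))))"
      unfolding M_def by (intro Bochner_Integration.integrable_sum integrable_mult_right im(1))
    have "(\<integral>p. (\<Sum>i\<le>k. of_real (s ^ k / fact k * real (k choose i)) * (h i (k - i) (fst p) * cnj (h i (k - i) (snd p)))) \<partial>M)
       = (\<Sum>i\<le>k. of_real (s ^ k / fact k * real (k choose i)) * (gauss_moment s i (k - i) \<alpha> * cnj (gauss_moment s i (k - i) \<beta>)))"
      unfolding M_def
      by (subst Bochner_Integration.integral_sum) (auto simp: im mom intro!: integrable_mult_right im(1))
    then have E: "Re (\<integral>p. (\<Sum>i\<le>k. of_real (s ^ k / fact k * real (k choose i)) * (h i (k - i) (fst p) * cnj (h i (k - i) (snd p)))) \<partial>M)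
       = (\<Sum>i\<le>k. s ^ k / fact k * real (k choose i) * Re (gauss_moment s i (k - i) \<alpha> * cnj (gauss_moment s i (k - i) \<beta>)))"
      by (simp only: Re_sum ReM)
    show ?thesis using integrable_Re[OF I] integral_Re[OF I] unfolding T_eq' E by blast
  qed
  \<comment> \<open>On K the series is dominated by the one of exp (2 s R^2), which allows termwise
    integration.\<close>
  obtain R where R: "R \<ge> 0" "\<And>z. z \<in> K \<Longrightarrow> norm z \<le> R"
    using compact_imp_bounded[OF assms(3)] unfolding bounded_pos by (meson less_imp_le)
  have T_sums: "(\<lambda>k. T k p) sums exp (- ((norm (fst p - snd p))\<^sup>2 * s))" for p
  proof -
    have "(\<lambda>k. e (fst p) * e (snd p) * ((2 * s * Re (fst p * cnj (snd p))) ^ k / fact k)) sums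
        (e (fst p) * e (snd p) * exp (2 * s * Re (fst p * cnj (snd p))))"
      using exp_converges[of "2 * s * Re (fst p * cnj (snd p))"] by (intro sums_mult) (simp add: divide_inverse mult.commute)
    moreover have "e (fst p) * e (snd p) * exp (2 * s * Re (fst p * cnj (snd p))) = exp (- ((norm (fst p - snd p))\<^sup>2 * s))"
    proof -
      have nrm: "(norm (fst p - snd p))\<^sup>2 = (norm (fst p))\<^sup>2 + (norm (snd p))\<^sup>2 - 2 * Re (fst p * cnj (snd p))"
        unfolding cmod_power2 by (simp add: power2_eq_square algebra_simps)
      show ?thesis unfolding nrm e_def exp_add[symmetric] by (simp add: algebra_simps)
    qed
    ultimately show ?thesis by (simp add: T_def)
  qed
  have T_bound: "norm (T k p) \<le> (2 * s * R * R) ^ k / fact k" if "fst p \<in> K" "snd p \<in> K" for k p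
  proof -
    have "\<bar>Re (fst p * cnj (snd p))\<bar> \<le> R * R"
      using abs_Re_le_cmod[of "fst p * cnj (snd p)"] mult_mono[OF R(2)[OF that(1)] R(2)[OF that(2)]] R(1)
      by (simp add: norm_mult)
    then have "\<bar>2 * s * Re (fst p * cnj (snd p))\<bar> \<le> 2 * s * (R * R)"
      using assms(4) by (simp add: abs_mult mult_left_mono)
    then have "\<bar>2 * s * Re (fst p * cnj (snd p))\<bar> ^ k \<le> (2 * s * (R * R)) ^ k" by (intro power_mono) auto
    moreover have "e (fst p) * e (snd p) \<le> 1" "0 \<le> e (fst p) * e (snd p)"
      using assms(4) by (auto simp: e_def intro!: mult_le_one)
    ultimately have "e (fst p) * e (snd p) * (\<bar>2 * s * Re (fst p * cnj (snd p))\<bar> ^ k / fact k) \<le> 1 * ((2 * s * (R * R)) ^ k / fact k)"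
      by (intro mult_mono divide_right_mono) auto
    moreover have "norm (T k p) = e (fst p) * e (snd p) * (\<bar>2 * s * Re (fst p * cnj (snd p))\<bar> ^ k / fact k)"
      unfolding T_def real_norm_def abs_mult[of "e (fst p) * e (snd p)"]
        abs_of_nonneg[OF \<open>0 \<le> e (fst p) * e (snd p)\<close>]
      by (simp add: power_abs del: times_complex.sel complex_cnj_mult)
    ultimately show ?thesis by (simp only: mult_1 mult.assoc)
  qed
  have summ: "summable (\<lambda>k. (2 * s * R * R) ^ k / fact k)"
    using summable_exp[of "2 * s * R * R"] by (simp add: divide_inverse mult.commute)
  have "(\<lambda>k. \<integral>p. T k p \<partial>M) sums (\<integral>p. (\<Sum>k. T k p) \<partial>M)"
  proof (rule sums_integral)
    show "integrable M (T k)" for k using T_int by blast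
    show "AE p in M. summable (\<lambda>k. norm (T k p))"
      unfolding M_def using AE_pair_prob[OF assms(1-3)]
      by eventually_elim (rule summable_comparison_test'[OF summ], use T_bound in auto)
    show "summable (\<lambda>k. \<integral>p. norm (T k p) \<partial>M)"
    proof (rule summable_comparison_test'[OF summ])
      fix k
      have "(\<integral>p. norm (T k p) \<partial>M) \<le> (\<integral>p. (2 * s * R * R) ^ k / fact k \<partial>M)"
      proof (rule integral_mono_AE)
        show "AE p in M. norm (T k p) \<le> (2 * s * R * R) ^ k / fact k"
          unfolding M_def using AE_pair_prob[OF assms(1-3)] by eventually_elim (use T_bound in blast)
        show "integrable M (\<lambda>p. norm (T k p))" using T_int by auto
        show "integrable M (\<lambda>p. (2 * s * R * R) ^ k / fact k)" by (simp add: M_def)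
      qed
      then show "norm (\<integral>p. norm (T k p) \<partial>M) \<le> (2 * s * R * R) ^ k / fact k"
        by (simp add: M_def AB.prob_space[simplified])
    qed
  qed
  then show ?thesis
    using T_int T_sums by (simp add: gauss_energy_def M_def sums_iff)
qed

text \<open>Makes Stone--Weierstrass applicable to linear conditions: \<open>A\<close> is a module over the
  polynomials in \<open>u\<close> and \<open>cnj u\<close>, but need not be closed under products.\<close>

lemma real_polynomial_multiplier:
  fixes u :: "complex \<Rightarrow> complex" and A :: "(complex \<Rightarrow> complex) set"
  assumes add: "\<And>f g. f \<in> A \<Longrightarrow> g \<in> A \<Longrightarrow> (\<lambda>z. f z + g z) \<in> A"
    and scale: "\<And>c f. f \<in> A \<Longrightarrow> (\<lambda>z. c * f z) \<in> A"
    and mult: "\<And>f. f \<in> A \<Longrightarrow> (\<lambda>z. u z * f z) \<in> A"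
    and mult_cnj: "\<And>f. f \<in> A \<Longrightarrow> (\<lambda>z. cnj (u z) * f z) \<in> A"
    and g: "real_polynomial_function g" and f: "f \<in> A"
  shows "(\<lambda>z. of_real (g (u z)) * f z) \<in> A"
  using g f
proof (induction g arbitrary: f rule: real_polynomial_function.induct)
  case (linear h)
  note fA = linear(2)
  interpret bounded_linear h by fact
  have h: "h w = Re w * h 1 + Im w * h \<i>" for w
  proof -
    have "w = Re w *\<^sub>R 1 + Im w *\<^sub>R \<i>" by (simp add: complex_eq_iff)
    then have "h w = h (Re w *\<^sub>R 1 + Im w *\<^sub>R \<i>)" by (rule arg_cong)
    then show ?thesis by (simp add: add scaleR)
  qed
  \<comment> \<open>Every real-linear functional on the plane is a complex combination of w and cnj
    w.\<close>
  define c1 c2 :: complex where "c1 = Complex (h 1 / 2) (- h \<i> / 2)" and "c2 = Complex (h 1 / 2) (h \<i> / 2)"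
  have "of_real (h w) = c1 * w + c2 * cnj w" for w
    by (subst h) (simp add: c1_def c2_def complex_eq_iff algebra_simps)
  then have "(\<lambda>z. of_real (h (u z)) * f z) = (\<lambda>z. c1 * (u z * f z) + c2 * (cnj (u z) * f z))"
    by (simp add: fun_eq_iff algebra_simps)
  then show ?case using assms(1)[OF assms(2)[OF assms(3)] assms(2)[OF assms(4)], OF fA fA] by simp
next
  case (const c)
  then show ?case by (rule assms(2))
next
  case (add g1 g2)
  then show ?case using assms(1)[OF add.IH(1)[OF add.prems] add.IH(2)[OF add.prems]]
    by (simp add: algebra_simps)
next
  case (mult g1 g2)
  then show ?case using mult.IH(1)[OF mult.IH(2)[OF mult.prems]] by (simp add: mult_ac)
qed

text \<open>The indicator of a closed set is the pointwise limit of the continuous functions max 0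
  (1 - n dist(z, C)), and closed sets generate the Borel sets.\<close>

lemma prob_measure_on_eqI:
  assumes "prob_measure_on K \<alpha>" "prob_measure_on K \<beta>" "compact K"
    and eq: "\<And>f :: complex \<Rightarrow> real. continuous_on UNIV f \<Longrightarrow> (\<integral>z. f z \<partial>\<alpha>) = (\<integral>z. f z \<partial>\<beta>)"
  shows "\<alpha> = \<beta>"
proof (rule measure_eqI_generator_eq[where \<Omega> = UNIV and E = "Collect closed" and A = "\<lambda>_. UNIV"])
  interpret A: prob_space \<alpha> using prob_measure_onD[OF assms(1)] by simp
  interpret B: prob_space \<beta> using prob_measure_onD[OF assms(2)] by simp
  show "Int_stable (Collect closed :: complex set set)" by (auto simp: Int_stable_def)
  show "sets \<alpha> = sigma_sets UNIV (Collect closed)" "sets \<beta> = sigma_sets UNIV (Collect closed)"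
    using prob_measure_onD(2)[OF assms(1)] prob_measure_onD(2)[OF assms(2)]
    by (simp_all add: borel_eq_closed)
  show "emeasure \<alpha> UNIV \<noteq> \<infinity>" by simp
  fix C :: "complex set" assume "C \<in> Collect closed"
  then have C: "closed C" by simp
  show "emeasure \<alpha> C = emeasure \<beta> C"
  \<comment> \<open>The empty set is treated apart because \<open>infdist\<close> to it is 0 by
    default.\<close>
  proof (cases "C = {}")
    case False
    define h where "h n z = max 0 (1 - real n * infdist z C)" for n z
    have hc: "continuous_on UNIV (h n)" for n unfolding h_def by (intro continuous_intros)
    have h01: "0 \<le> h n z" "h n z \<le> 1" for n z by (auto simp: h_def infdist_nonneg)
    have lim: "(\<lambda>n. h n z) \<longlonglongrightarrow> indicator C z" for z
    proof (cases "z \<in> C")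
      case True
      then show ?thesis by (simp add: h_def)
    next
      case zC: False
      then have d: "infdist z C > 0" using C False in_closed_iff_infdist_zero[OF C False] infdist_nonneg[of z C] by auto
      obtain N :: nat where N: "1 / infdist z C < real N" using reals_Archimedean2 by blast
      have "h n z = 0" if "n \<ge> N" for n
      proof -
        have "1 < real N * infdist z C" using N d by (simp add: divide_less_eq)
        also have "\<dots> \<le> real n * infdist z C" using that d by (intro mult_right_mono) auto
        finally show ?thesis by (simp add: h_def)
      qed
      then have "\<forall>\<^sub>F n in sequentially. h n z = 0" by (rule eventually_sequentiallyI)
      then show ?thesis using zC by (simp add: tendsto_eventually)
    qed
    have meas: "measure \<gamma> C = lim (\<lambda>n. \<integral>z. h n z \<partial>\<gamma>)" if "prob_measure_on K \<gamma>" for \<gamma>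
    proof -
      interpret prob_space \<gamma> using prob_measure_onD[OF that] by simp
      have sC: "C \<in> sets \<gamma>" using C prob_measure_onD(2)[OF that] by simp
      have "(\<lambda>n. \<integral>z. h n z \<partial>\<gamma>) \<longlonglongrightarrow> (\<integral>z. indicator C z \<partial>\<gamma>)"
      proof (rule integral_dominated_convergence[where w = "\<lambda>_. 1"])
        show "h n \<in> borel_measurable \<gamma>" for n
          using integrable_continuous_prob[OF that assms(3) hc] by auto
      qed (use lim h01 sC in auto)
      then show ?thesis using sC by (simp add: limI)
    qed
    have "measure \<alpha> C = measure \<beta> C"
      using meas[OF assms(1)] meas[OF assms(2)] eq[OF hc] by simp
    then show ?thesis by (simp add: A.emeasure_eq_measure B.emeasure_eq_measure)
  qed simp
qed auto

text \<open>Quantifying over all i and j makes \<open>A\<close> stable under multiplication by z and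
  cnj z, as these only shift an index; so equality of moments spreads to all polynomials against the
  Gaussian weight.\<close>

lemma gauss_moments_determine:
  assumes "prob_measure_on K \<alpha>" "prob_measure_on K \<beta>" "compact K" "s \<ge> 0"
    and mom: "\<And>i j. gauss_moment s i j \<alpha> = gauss_moment s i j \<beta>"
  shows "\<alpha> = \<beta>"
proof (rule prob_measure_on_eqI[OF assms(1-3)])
  define e where "e z = exp (- (s * (norm z)\<^sup>2))" for z :: complex
  have ec: "continuous_on UNIV e" unfolding e_def by (intro continuous_intros)
  have e1: "0 < e z" "e z \<le> 1" for z using assms(4) by (auto simp: e_def)
  define A where "A = {f. continuous_on UNIV f \<and> (\<forall>i j. (\<integral>z. of_real (e z) * z ^ i * cnj z ^ j * f z \<partial>\<alpha>) =
      (\<integral>z. of_real (e z) * z ^ i * cnj z ^ j * f z \<partial>\<beta>))}"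
  have int: "integrable \<gamma> (\<lambda>z. of_real (e z) * z ^ i * cnj z ^ j * f z)"
    if "continuous_on UNIV f" "prob_measure_on K \<gamma>" for f i j \<gamma>
    using that assms(3) by (intro integrable_continuous_prob[of K]) (auto intro!: continuous_intros ec)
  have one: "(\<lambda>_. 1) \<in> A" using mom by (simp add: A_def gauss_moment_def e_def)
  have poly: "(\<lambda>z. of_real (g (id z)) * 1) \<in> A" if "real_polynomial_function g" for g
  proof (rule real_polynomial_multiplier[OF _ _ _ _ that one])
    fix f1 f2 assume f: "f1 \<in> A" "f2 \<in> A"
    then have c: "continuous_on UNIV f1" "continuous_on UNIV f2" by (auto simp: A_def)
    show "(\<lambda>z. f1 z + f2 z) \<in> A"
      using f int[OF c(1) assms(1)] int[OF c(2) assms(1)] int[OF c(1) assms(2)] int[OF c(2) assms(2)]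
      by (auto simp: A_def distrib_left intro: continuous_intros)
  next
    fix f c assume f: "f \<in> A"
    have "(\<integral>z. of_real (e z) * z ^ i * cnj z ^ j * (c * f z) \<partial>\<gamma>) = c * (\<integral>z. of_real (e z) * z ^ i * cnj z ^ j * f z \<partial>\<gamma>)" for \<gamma> i j
      by (subst integral_mult_right_zero[symmetric]) (simp add: mult_ac)
    then show "(\<lambda>z. c * f z) \<in> A" using f by (auto simp: A_def intro: continuous_intros)
  next
    fix f assume f: "f \<in> A"
    have "(\<lambda>z. of_real (e z) * z ^ i * cnj z ^ j * (id z * f z)) = (\<lambda>z. of_real (e z) * z ^ Suc i * cnj z ^ j * f z)" for i j
      by (simp add: fun_eq_iff mult_ac)
    then show "(\<lambda>z. id z * f z) \<in> A" using f by (auto simp: A_def simp del: power_Suc intro!: continuous_intros)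
    have "(\<lambda>z. of_real (e z) * z ^ i * cnj z ^ j * (cnj (id z) * f z)) = (\<lambda>z. of_real (e z) * z ^ i * cnj z ^ Suc j * f z)" for i j
      by (simp add: fun_eq_iff mult_ac)
    then show "(\<lambda>z. cnj (id z) * f z) \<in> A" using f by (auto simp: A_def simp del: power_Suc intro!: continuous_intros)
  qed
  fix f :: "complex \<Rightarrow> real" assume f: "continuous_on UNIV f"
  have bound: "\<bar>(\<integral>z. f z \<partial>\<alpha>) - (\<integral>z. f z \<partial>\<beta>)\<bar> \<le> 2 * \<epsilon>" if \<epsilon>: "\<epsilon> > 0" for \<epsilon>
  proof -
    \<comment> \<open>Approximating f / e instead of f keeps the weight in the integrals, and e <= 1
      preserves the error bound.\<close>
    have "continuous_on K (\<lambda>z. f z / e z)"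
      using f ec e1 by (intro continuous_intros) (auto intro: continuous_on_subset simp: less_imp_neq[symmetric])
    then obtain g where g: "real_polynomial_function g" "\<And>z. z \<in> K \<Longrightarrow> \<bar>f z / e z - g z\<bar> < \<epsilon>"
      using Stone_Weierstrass_real_polynomial_function[OF assms(3) _ \<epsilon>] by blast
    have gc: "continuous_on UNIV g" using g(1) by (simp add: continuous_on_polymonial_function real_polynomial_function_eq)
    have egc: "continuous_on UNIV (\<lambda>z. e z * g z)" by (intro continuous_intros ec gc)
    have "(\<integral>z. complex_of_real (e z * g z) \<partial>\<alpha>) = (\<integral>z. complex_of_real (e z * g z) \<partial>\<beta>)"
      using poly[OF g(1)] unfolding A_def by (auto dest!: spec[of _ 0])
    then have eg: "(\<integral>z. e z * g z \<partial>\<alpha>) = (\<integral>z. e z * g z \<partial>\<beta>)"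
      by (simp only: integral_complex_of_real of_real_eq_iff)
    have close: "\<bar>(\<integral>z. f z \<partial>\<gamma>) - (\<integral>z. e z * g z \<partial>\<gamma>)\<bar> \<le> \<epsilon>" if \<gamma>: "prob_measure_on K \<gamma>" for \<gamma>
    proof -
      interpret prob_space \<gamma> using prob_measure_onD[OF \<gamma>] by simp
      note I = integrable_continuous_prob[OF \<gamma> assms(3) f] integrable_continuous_prob[OF \<gamma> assms(3) egc]
      have "\<bar>(\<integral>z. f z - e z * g z \<partial>\<gamma>)\<bar> \<le> (\<integral>z. \<bar>f z - e z * g z\<bar> \<partial>\<gamma>)" by (rule integral_abs_bound)
      also have "\<dots> \<le> (\<integral>z. \<epsilon> \<partial>\<gamma>)"
      proof (rule integral_mono_AE)
        show "AE z in \<gamma>. \<bar>f z - e z * g z\<bar> \<le> \<epsilon>"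
          using prob_measure_on_AE[OF \<gamma> assms(3)]
        proof eventually_elim
          case (elim z)
          have "f z - e z * g z = e z * (f z / e z - g z)" using e1(1)[of z] by (simp add: right_diff_distrib)
          then have "\<bar>f z - e z * g z\<bar> = e z * \<bar>f z / e z - g z\<bar>" using e1(1)[of z] by (simp add: abs_mult)
          also have "\<dots> \<le> 1 * \<epsilon>" using g(2)[OF elim] e1[of z] by (intro mult_mono) auto
          finally show ?case by simp
        qed
      qed (use I in auto)
      also have "\<dots> = \<epsilon>" by (simp add: prob_space)
      finally show ?thesis using I by simp
    qed
    show ?thesis using close[OF assms(1)] close[OF assms(2)] eg by linarith
  qed
  show "(\<integral>z. f z \<partial>\<alpha>) = (\<integral>z. f z \<partial>\<beta>)"
  proof (rule ccontr)
    assume "(\<integral>z. f z \<partial>\<alpha>) \<noteq> (\<integral>z. f z \<partial>\<beta>)"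
    then show False using bound[of "\<bar>(\<integral>z. f z \<partial>\<alpha>) - (\<integral>z. f z \<partial>\<beta>)\<bar> / 4"] by auto
  qed
qed

text \<open>By the expansion, the form is a series of squared moduli of moment differences with
  nonnegative coefficients, which are positive for s > 0.\<close>

lemma gauss_energy_definite:
  assumes "prob_measure_on K \<alpha>" "prob_measure_on K \<beta>" "compact K" "s \<ge> 0"
  shows "gauss_energy s \<alpha> \<alpha> - 2 * gauss_energy s \<alpha> \<beta> + gauss_energy s \<beta> \<beta> \<ge> 0"
    and "gauss_energy s \<alpha> \<alpha> - 2 * gauss_energy s \<alpha> \<beta> + gauss_energy s \<beta> \<beta> = 0 \<Longrightarrow> s > 0 \<Longrightarrow> \<alpha> = \<beta>"
proof -
  define D where "D = gauss_energy s \<alpha> \<alpha> - 2 * gauss_energy s \<alpha> \<beta> + gauss_energy s \<beta> \<beta>"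
  define m where "m i j = gauss_moment s i j \<alpha> - gauss_moment s i j \<beta>" for i j
  define c where "c k i = s ^ k / fact k * real (k choose i)" for k i
  have sq: "Re (a * cnj a) - 2 * Re (a * cnj b) + Re (b * cnj b) = (norm (a - b))\<^sup>2" for a b :: complex
    unfolding cmod_power2 by (simp add: power2_eq_square algebra_simps)
  have sums: "(\<lambda>k. \<Sum>i\<le>k. c k i * (norm (m i (k - i)))\<^sup>2) sums D"
  proof -
    have "(\<lambda>k. \<Sum>i\<le>k. c k i * (norm (m i (k - i)))\<^sup>2) =
      (\<lambda>k. (\<Sum>i\<le>k. c k i * Re (gauss_moment s i (k - i) \<alpha> * cnj (gauss_moment s i (k - i) \<alpha>)))
        - 2 * (\<Sum>i\<le>k. c k i * Re (gauss_moment s i (k - i) \<alpha> * cnj (gauss_moment s i (k - i) \<beta>)))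
        + (\<Sum>i\<le>k. c k i * Re (gauss_moment s i (k - i) \<beta> * cnj (gauss_moment s i (k - i) \<beta>))))"
      unfolding m_def sq[symmetric] sum_distrib_left sum_subtractf[symmetric] sum.distrib[symmetric]
      by (intro ext sum.cong refl) (simp add: algebra_simps)
    then show ?thesis unfolding D_def c_def
      by (simp only:) (rule sums_add[OF sums_diff[OF gauss_energy_expansion[OF assms(1) assms(1) assms(3,4)]
          sums_mult[OF gauss_energy_expansion[OF assms]]] gauss_energy_expansion[OF assms(2) assms(2) assms(3,4)]])
  qed
  have nn: "(\<Sum>i\<le>k. c k i * (norm (m i (k - i)))\<^sup>2) \<ge> 0" for k
    using assms(4) by (intro sum_nonneg) (auto simp: c_def)
  show "gauss_energy s \<alpha> \<alpha> - 2 * gauss_energy s \<alpha> \<beta> + gauss_energy s \<beta> \<beta> \<ge> 0"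
    unfolding D_def[symmetric] by (rule sums_le[OF _ sums_zero sums]) (rule nn)
  assume D0: "gauss_energy s \<alpha> \<alpha> - 2 * gauss_energy s \<alpha> \<beta> + gauss_energy s \<beta> \<beta> = 0" and s: "s > 0"
  note D0 = D0[folded D_def]
  have z: "(\<Sum>i\<le>k. c k i * (norm (m i (k - i)))\<^sup>2) = 0" for k
    using suminf_eq_zero_iff[OF sums_summable[OF sums]] sums_unique[OF sums] nn D0 by auto
  show "\<alpha> = \<beta>"
  proof (rule gauss_moments_determine[OF assms])
    fix i j
    have "c (i + j) i * (norm (m i (i + j - i)))\<^sup>2 = 0"
      by (rule sum_nonneg_0[OF _ _ z[of "i + j"]]) (use s in \<open>auto simp: c_def\<close>)
    moreover have "c (i + j) i > 0" using s by (simp add: c_def)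
    ultimately show "gauss_moment s i j \<alpha> = gauss_moment s i j \<beta>" by (simp add: m_def)
  qed
qed

text \<open>Integrates the Gaussian forms against ds / (2 s); the terms exp (- s) cancel since the
  coefficients 1, -2, 1 add up to 0. In case of equality a single s > 0 with vanishing form is
  enough.\<close>

lemma log_energy_definite:
  assumes "prob_measure_on K \<alpha>" "prob_measure_on K \<beta>" "compact K"
    and int: "integrable (\<alpha> \<Otimes>\<^sub>M \<alpha>) (\<lambda>p. ln (norm (fst p - snd p)))"
       "integrable (\<alpha> \<Otimes>\<^sub>M \<beta>) (\<lambda>p. ln (norm (fst p - snd p)))"
       "integrable (\<beta> \<Otimes>\<^sub>M \<beta>) (\<lambda>p. ln (norm (fst p - snd p)))"
    and neq: "AE p in \<alpha> \<Otimes>\<^sub>M \<alpha>. fst p \<noteq> snd p" "AE p in \<alpha> \<Otimes>\<^sub>M \<beta>. fst p \<noteq> snd p"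
       "AE p in \<beta> \<Otimes>\<^sub>M \<beta>. fst p \<noteq> snd p"
  defines "L \<equiv> \<lambda>M. (\<integral>p. ln (norm (fst p - snd p)) \<partial>M)"
  shows "L (\<alpha> \<Otimes>\<^sub>M \<alpha>) + L (\<beta> \<Otimes>\<^sub>M \<beta>) \<le> 2 * L (\<alpha> \<Otimes>\<^sub>M \<beta>)"
    and "L (\<alpha> \<Otimes>\<^sub>M \<alpha>) + L (\<beta> \<Otimes>\<^sub>M \<beta>) = 2 * L (\<alpha> \<Otimes>\<^sub>M \<beta>) \<Longrightarrow> \<alpha> = \<beta>"
proof -
  define D where "D s = gauss_energy s \<alpha> \<alpha> - 2 * gauss_energy s \<alpha> \<beta> + gauss_energy s \<beta> \<beta>" for s
  define W where "W s = indicator {0..} s * (D s / (2 * s))" for s :: real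
  define w where "w \<alpha> \<beta> s = indicator {0..} s * ((gauss_energy s \<alpha> \<beta> - exp (- s)) / (2 * s))" for \<alpha> \<beta> s
  have hb: "has_bochner_integral lborel (w \<alpha> \<alpha>) (- L (\<alpha> \<Otimes>\<^sub>M \<alpha>))"
      "has_bochner_integral lborel (w \<alpha> \<beta>) (- L (\<alpha> \<Otimes>\<^sub>M \<beta>))"
      "has_bochner_integral lborel (w \<beta> \<beta>) (- L (\<beta> \<Otimes>\<^sub>M \<beta>))"
    unfolding w_def L_def
    by (rule log_energy_as_gauss[OF assms(1) assms(1) assms(3) int(1) neq(1)]
          log_energy_as_gauss[OF assms(1-3) int(2) neq(2)]
          log_energy_as_gauss[OF assms(2) assms(2) assms(3) int(3) neq(3)])+
  have "has_bochner_integral lborel (\<lambda>s. w \<alpha> \<alpha> s - 2 * w \<alpha> \<beta> s + w \<beta> \<beta> s)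
      (- L (\<alpha> \<Otimes>\<^sub>M \<alpha>) - 2 * - L (\<alpha> \<Otimes>\<^sub>M \<beta>) + - L (\<beta> \<Otimes>\<^sub>M \<beta>))"
    by (intro has_bochner_integral_add has_bochner_integral_diff has_bochner_integral_mult_right hb)
  moreover have "(\<lambda>s. w \<alpha> \<alpha> s - 2 * w \<alpha> \<beta> s + w \<beta> \<beta> s) = W"
    by (rule ext) (simp add: w_def W_def D_def indicator_def diff_divide_distrib add_divide_distrib)
  ultimately have hW: "has_bochner_integral lborel W (2 * L (\<alpha> \<Otimes>\<^sub>M \<beta>) - L (\<alpha> \<Otimes>\<^sub>M \<alpha>) - L (\<beta> \<Otimes>\<^sub>M \<beta>))"
    by (simp add: algebra_simps)
  have W0: "W s \<ge> 0" for s
    using gauss_energy_definite(1)[OF assms(1-3)] by (auto simp: W_def D_def indicator_def)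
  show "L (\<alpha> \<Otimes>\<^sub>M \<alpha>) + L (\<beta> \<Otimes>\<^sub>M \<beta>) \<le> 2 * L (\<alpha> \<Otimes>\<^sub>M \<beta>)"
    using Bochner_Integration.integral_nonneg[of lborel W] W0 has_bochner_integral_integral_eq[OF hW] by simp
  assume "L (\<alpha> \<Otimes>\<^sub>M \<alpha>) + L (\<beta> \<Otimes>\<^sub>M \<beta>) = 2 * L (\<alpha> \<Otimes>\<^sub>M \<beta>)"
  then have "AE s in lborel. W s = 0"
    using integral_nonneg_eq_0_iff_AE[of lborel W] hW W0 by (simp add: has_bochner_integral_iff)
  \<comment> \<open>[1, 2] serves as a set of positive measure away from s = 0.\<close>
  have "\<exists>s\<in>{1..2}. W s = 0"
  proof (rule ccontr)
    assume "\<not> (\<exists>s\<in>{1..2}. W s = 0)"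
    then have "AE s in lborel. s \<notin> {1..2::real}"
      using \<open>AE s in lborel. W s = 0\<close> by (auto elim: eventually_mono)
    then have "{1..2::real} \<in> null_sets lborel" by (subst (asm) AE_iff_null_sets[symmetric]) auto
    then show False by (simp add: null_sets_def)
  qed
  then obtain s where "s \<ge> 1" "W s = 0" by auto
  then show "\<alpha> = \<beta>"
    using gauss_energy_definite(2)[OF assms(1-3), of s] by (simp add: W_def D_def)
qed

subsection \<open>The equilibrium measure\<close>

text \<open>Bridge from the extended-real energy to Bochner integrals. Boundedness of K makes the
  negative part finite; finite energy makes the diagonal null, because the positive kernel is
  infinite there.\<close>

lemma log_integrals_of_log_energy:
  assumes \<alpha>: "prob_measure_on K \<alpha>" and K: "compact K"
  shows "integrable (\<alpha> \<Otimes>\<^sub>M \<alpha>) (\<lambda>p. ln (norm (fst p - snd p))) \<Longrightarrow> (AE p in \<alpha> \<Otimes>\<^sub>M \<alpha>. fst p \<noteq> snd p) \<Longrightarrow>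
      log_energy \<alpha> = ereal (- (\<integral>p. ln (norm (fst p - snd p)) \<partial>(\<alpha> \<Otimes>\<^sub>M \<alpha>)))"
    and "log_energy \<alpha> \<noteq> \<infinity> \<Longrightarrow> integrable (\<alpha> \<Otimes>\<^sub>M \<alpha>) (\<lambda>p. ln (norm (fst p - snd p)))"
    and "log_energy \<alpha> \<noteq> \<infinity> \<Longrightarrow> AE p in \<alpha> \<Otimes>\<^sub>M \<alpha>. fst p \<noteq> snd p"
proof -
  interpret A: prob_space \<alpha> using prob_measure_onD[OF \<alpha>] by simp
  interpret AA: pair_prob_space \<alpha> \<alpha> ..
  define M where "M = \<alpha> \<Otimes>\<^sub>M \<alpha>"
  define l where "l p = ln (norm (fst p - snd p))" for p :: "complex \<times> complex"
  define pos where "pos p = (if fst p = snd p then \<infinity> else ennreal (ln (1 / norm (fst p - snd p))))" for p :: "complex \<times> complex"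
  define neg where "neg p = (if fst p = snd p then 0 else ennreal (- ln (1 / norm (fst p - snd p))))" for p :: "complex \<times> complex"
  note tr = borel_measurable_pair_prob[OF \<alpha> \<alpha>] measurable_cong_sets[OF sets_pair_prob_measure_on[OF \<alpha> \<alpha>] refl]
  have "closed {p :: complex \<times> complex. fst p = snd p}" by (intro closed_Collect_eq continuous_intros)
  then have D: "{p :: complex \<times> complex. fst p = snd p} \<in> sets borel" by (rule borel_closed)
  have lb: "l \<in> borel_measurable borel"
    unfolding l_def borel_prod[symmetric] by measurable
  have pos_eq: "pos = (\<lambda>p. if fst p = snd p then \<infinity> else ennreal (- l p))"
    and neg_eq: "neg = (\<lambda>p. if fst p = snd p then 0 else ennreal (l p))"
    by (auto simp: pos_def neg_def l_def ln_div fun_eq_iff)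
  have posb: "pos \<in> borel_measurable borel" and negb: "neg \<in> borel_measurable borel"
    unfolding pos_eq neg_eq using D lb by (auto intro!: measurable_If)
  have posM: "pos \<in> borel_measurable (\<alpha> \<Otimes>\<^sub>M \<alpha>)" and negM: "neg \<in> borel_measurable (\<alpha> \<Otimes>\<^sub>M \<alpha>)"
    and lM: "l \<in> borel_measurable M"
    using posb negb lb tr(1) by (auto simp: M_def)
  define P N where "P = (\<integral>\<^sup>+p. pos p \<partial>M)" and "N = (\<integral>\<^sup>+p. neg p \<partial>M)"
  have E: "log_energy \<alpha> = enn2ereal P - enn2ereal N"
    unfolding P_def N_def M_def A.nn_integral_fst[OF posM, symmetric] A.nn_integral_fst[OF negM, symmetric]
    unfolding log_energy_def pos_def neg_def fst_conv snd_conv ..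
  obtain R where R: "R \<ge> 1" "\<And>z. z \<in> K \<Longrightarrow> norm z \<le> R"
  proof -
    obtain b where "\<And>z. z \<in> K \<Longrightarrow> norm z \<le> b"
      using compact_imp_bounded[OF K] unfolding bounded_iff by blast
    then show ?thesis using that[of "max 1 b"] by force
  qed
  have "AE p in M. neg p \<le> ennreal (ln (2 * R))"
    unfolding M_def using AE_pair_prob[OF \<alpha> \<alpha> K]
  proof eventually_elim
    case (elim p)
    have "norm (fst p - snd p) \<le> 2 * R"
      using norm_triangle_ineq4[of "fst p" "snd p"] R(2)[of "fst p"] R(2)[of "snd p"] elim by linarith
    then have "fst p \<noteq> snd p \<Longrightarrow> l p \<le> ln (2 * R)" unfolding l_def
      using R(1) by (subst ln_le_cancel_iff) auto
    then show ?case by (auto simp: neg_eq intro: ennreal_leI)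
  qed
  then have "N \<le> (\<integral>\<^sup>+p. ennreal (ln (2 * R)) \<partial>M)" unfolding N_def by (rule nn_integral_mono_AE)
  also have "\<dots> = ennreal (ln (2 * R))" by (simp add: M_def AA.emeasure_space_1[simplified])
  finally have Nfin: "N \<noteq> \<infinity>" by (auto simp: top_unique)
  have AEeq: "P = (\<integral>\<^sup>+p. ennreal (- l p) \<partial>M) \<and> N = (\<integral>\<^sup>+p. ennreal (l p) \<partial>M)" if "AE p in M. fst p \<noteq> snd p"
    unfolding P_def N_def
    by (intro conjI nn_integral_cong_AE) (use that in eventually_elim, simp add: pos_eq neg_eq)+
  {
    assume i: "integrable (\<alpha> \<Otimes>\<^sub>M \<alpha>) (\<lambda>p. ln (norm (fst p - snd p)))" and n: "AE p in \<alpha> \<Otimes>\<^sub>M \<alpha>. fst p \<noteq> snd p"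
    have i': "integrable M l" using i by (simp add: M_def l_def[abs_def])
    have n': "AE p in M. fst p \<noteq> snd p" using n unfolding M_def .
    have PN: "P = (\<integral>\<^sup>+p. ennreal (- l p) \<partial>M)" "N = (\<integral>\<^sup>+p. ennreal (l p) \<partial>M)" using AEeq[OF n'] by auto
    have Pfin: "P \<noteq> \<infinity>" using i' unfolding PN real_integrable_def by simp
    have "(\<integral>p. l p \<partial>M) = enn2real N - enn2real P"
      unfolding PN by (rule real_lebesgue_integral_def[OF i'])
    moreover have "enn2ereal P - enn2ereal N = ereal (enn2real P - enn2real N)"
      using Pfin Nfin by (cases P; cases N) auto
    ultimately show "log_energy \<alpha> = ereal (- (\<integral>p. ln (norm (fst p - snd p)) \<partial>(\<alpha> \<Otimes>\<^sub>M \<alpha>)))"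
      unfolding E by (simp add: M_def l_def[abs_def])
  }
  assume fin: "log_energy \<alpha> \<noteq> \<infinity>"
  have Pfin: "P \<noteq> \<infinity>"
  proof
    assume "P = \<infinity>"
    then have "log_energy \<alpha> = \<infinity>" unfolding E using Nfin by (cases N) auto
    then show False using fin by simp
  qed
  have "AE p in M. pos p \<noteq> \<infinity>"
    using nn_integral_PInf_AE[of pos M] Pfin posM unfolding P_def M_def by simp
  then have n': "AE p in M. fst p \<noteq> snd p" by eventually_elim (auto simp: pos_eq)
  then show "AE p in \<alpha> \<Otimes>\<^sub>M \<alpha>. fst p \<noteq> snd p" unfolding M_def .
  have "integrable M l"
    unfolding real_integrable_def using AEeq[OF n'] Pfin Nfin lM by auto
  then show "integrable (\<alpha> \<Otimes>\<^sub>M \<alpha>) (\<lambda>p. ln (norm (fst p - snd p)))" by (simp add: M_def l_def[abs_def])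
qed

text \<open>The potential of \<open>mu_Gamma\<close> is constant on the curve, so the measure
  integrated against it is irrelevant and may itself have infinite energy.\<close>

lemma mixed_energy_mu_Gamma:
  assumes \<nu>: "prob_measure_on Gamma_curve \<nu>"
  shows "integrable (\<nu> \<Otimes>\<^sub>M mu_Gamma) (\<lambda>p. ln (norm (fst p - snd p)))"
    and "AE p in \<nu> \<Otimes>\<^sub>M mu_Gamma. fst p \<noteq> snd p"
    and "(\<integral>p. ln (norm (fst p - snd p)) \<partial>(\<nu> \<Otimes>\<^sub>M mu_Gamma)) = ln 4"
proof -
  interpret A: prob_space \<nu> using prob_measure_onD[OF \<nu>] by simp
  interpret B: prob_space mu_Gamma by (rule prob_space_mu_Gamma)
  interpret AB: pair_prob_space \<nu> mu_Gamma ..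
  define l where "l p = ln (norm (fst p - snd p))" for p :: "complex \<times> complex"
  have "l \<in> borel_measurable borel"
    unfolding l_def borel_prod[symmetric] by measurable
  then have lm: "l \<in> borel_measurable (\<nu> \<Otimes>\<^sub>M mu_Gamma)"
    by (rule borel_measurable_pair_prob[OF \<nu> prob_measure_on_mu_Gamma])
  have AEG: "AE z in \<nu>. z \<in> Gamma_curve" by (rule prob_measure_on_AE[OF \<nu> compact_Gamma])
  \<comment> \<open>Two points of the curve are at distance at most 6 + 6 = 12, and l <= ln 12 gives
    |l| <= 2 ln 12 - l, whose integral is known.\<close>
  have abs_bound: "(\<integral>t. norm (l (z, t)) \<partial>mu_Gamma) \<le> 2 * ln 12" if z: "z \<in> Gamma_curve" for z
  proof -
    have "(\<integral>t. norm (l (z, t)) \<partial>mu_Gamma) \<le> (\<integral>t. 2 * ln 12 - l (z, t) \<partial>mu_Gamma)"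
    proof (rule integral_mono_AE)
      show "AE t in mu_Gamma. norm (l (z, t)) \<le> 2 * ln 12 - l (z, t)"
        using AE_mu_Gamma AE_mu_Gamma_neq[of z]
      proof eventually_elim
        case (elim t)
        have "norm (z - t) \<le> 12"
          using norm_triangle_ineq4[of z t] K_region_bounded[of z] K_region_bounded[of t] Gamma_subset_K z elim by force
        then have "l (z, t) \<le> ln 12" using elim unfolding l_def by (subst ln_le_cancel_iff) auto
        moreover have "ln (12::real) \<ge> 0" by simp
        ultimately show ?case unfolding real_norm_def by arith
      qed
    qed (use mu_Gamma_potential(1)[OF z] in \<open>auto simp: l_def\<close>)
    also have "\<dots> = 2 * ln 12 - ln 4"
      using mu_Gamma_potential[OF z] by (simp add: l_def B.prob_space[simplified])
    also have "\<dots> \<le> 2 * ln 12" by simp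
    finally show ?thesis .
  qed
  have li: "integrable (\<nu> \<Otimes>\<^sub>M mu_Gamma) l"
  proof (rule AB.Fubini_integrable[OF lm])
    show "integrable \<nu> (\<lambda>z. \<integral>t. norm (l (z, t)) \<partial>mu_Gamma)"
    proof (rule A.integrable_const_bound)
      show "AE z in \<nu>. norm (\<integral>t. norm (l (z, t)) \<partial>mu_Gamma) \<le> 2 * ln 12"
        using AEG by eventually_elim (use abs_bound in auto)
      show "(\<lambda>z. \<integral>t. norm (l (z, t)) \<partial>mu_Gamma) \<in> borel_measurable \<nu>"
        using lm by (intro B.borel_measurable_lebesgue_integral) auto
    qed
    show "AE z in \<nu>. integrable mu_Gamma (\<lambda>t. l (z, t))"
      using AEG by eventually_elim (use mu_Gamma_potential(1) in \<open>auto simp: l_def\<close>)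
  qed
  then show "integrable (\<nu> \<Otimes>\<^sub>M mu_Gamma) (\<lambda>p. ln (norm (fst p - snd p)))" by (simp add: l_def[abs_def])
  have "(\<integral>p. l p \<partial>(\<nu> \<Otimes>\<^sub>M mu_Gamma)) = (\<integral>z. (\<integral>t. l (z, t) \<partial>mu_Gamma) \<partial>\<nu>)"
    by (rule AB.integral_fst'[OF li, symmetric])
  also have "\<dots> = (\<integral>z. ln 4 \<partial>\<nu>)"
  proof (rule integral_cong_AE)
    show "AE z in \<nu>. (\<integral>t. l (z, t) \<partial>mu_Gamma) = ln 4"
      using AEG by eventually_elim (use mu_Gamma_potential(2) in \<open>auto simp: l_def\<close>)
    show "(\<lambda>z. \<integral>t. l (z, t) \<partial>mu_Gamma) \<in> borel_measurable \<nu>"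
      using lm by (intro B.borel_measurable_lebesgue_integral) auto
  qed auto
  finally show "(\<integral>p. ln (norm (fst p - snd p)) \<partial>(\<nu> \<Otimes>\<^sub>M mu_Gamma)) = ln 4"
    by (simp add: l_def A.prob_space)
  have "closed {p :: complex \<times> complex. fst p = snd p}" by (intro closed_Collect_eq continuous_intros)
  then have "- {p :: complex \<times> complex. fst p = snd p} \<in> sets borel" by (intro borel_comp borel_closed)
  moreover have "{p \<in> space (\<nu> \<Otimes>\<^sub>M mu_Gamma). fst p \<noteq> snd p} = - {p. fst p = snd p}"
    using prob_measure_onD(3)[OF \<nu>] by (auto simp: space_pair_measure)
  ultimately have "{p \<in> space (\<nu> \<Otimes>\<^sub>M mu_Gamma). fst p \<noteq> snd p} \<in> sets (\<nu> \<Otimes>\<^sub>M mu_Gamma)"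
    using sets_pair_prob_measure_on[OF \<nu> prob_measure_on_mu_Gamma] by simp
  then show "AE p in \<nu> \<Otimes>\<^sub>M mu_Gamma. fst p \<noteq> snd p"
  proof (rule AB.AE_pair_measure)
    show "AE z in \<nu>. AE t in mu_Gamma. fst (z, t) \<noteq> snd (z, t)"
      using AE_mu_Gamma_neq by (auto simp: eq_commute)
  qed
qed

lemma log_energy_mu_Gamma: "log_energy mu_Gamma = ereal (- ln 4)"
  using log_integrals_of_log_energy(1)[OF prob_measure_on_mu_Gamma compact_Gamma
      mixed_energy_mu_Gamma(1,2)[OF prob_measure_on_mu_Gamma]]
  unfolding mixed_energy_mu_Gamma(3)[OF prob_measure_on_mu_Gamma] .

text \<open>With the mixed integral and that of \<open>mu_Gamma\<close> both ln 4, definiteness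
  reads L + ln 4 <= 2 ln 4. Infinite energy is trivial.\<close>

lemma log_energy_ge_mu_Gamma:
  assumes \<nu>: "prob_measure_on Gamma_curve \<nu>"
  shows "log_energy mu_Gamma \<le> log_energy \<nu>"
    and "log_energy \<nu> \<le> log_energy mu_Gamma \<Longrightarrow> \<nu> = mu_Gamma"
proof -
  note mu = prob_measure_on_mu_Gamma
  note m = mixed_energy_mu_Gamma[OF \<nu>] mixed_energy_mu_Gamma[OF mu]
  have *: "log_energy mu_Gamma \<le> log_energy \<nu> \<and> (log_energy \<nu> \<le> log_energy mu_Gamma \<longrightarrow> \<nu> = mu_Gamma)"
  proof (cases "log_energy \<nu> = \<infinity>")
    case False
    note f = log_integrals_of_log_energy(2,3)[OF \<nu> compact_Gamma False]
    note e = log_integrals_of_log_energy(1)[OF \<nu> compact_Gamma f]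
    note d = log_energy_definite[OF \<nu> mu compact_Gamma f(1) m(1) m(4) f(2) m(2) m(5)]
    define L where "L = (\<integral>p. ln (norm (fst p - snd p)) \<partial>(\<nu> \<Otimes>\<^sub>M \<nu>))"
    have 1: "L + ln 4 \<le> 2 * ln 4"
      using d(1) by (simp only: m(3) m(6) L_def)
    have 2: "\<nu> = mu_Gamma" if "L \<ge> ln 4"
    proof (rule d(2))
      show "(\<integral>p. ln (norm (fst p - snd p)) \<partial>(\<nu> \<Otimes>\<^sub>M \<nu>)) + (\<integral>p. ln (norm (fst p - snd p)) \<partial>(mu_Gamma \<Otimes>\<^sub>M mu_Gamma)) =
          2 * (\<integral>p. ln (norm (fst p - snd p)) \<partial>(\<nu> \<Otimes>\<^sub>M mu_Gamma))"
        unfolding m(3) m(6) L_def[symmetric] using 1 that by linarith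
    qed
    have e': "log_energy \<nu> = ereal (- L)" unfolding e L_def ..
    have 3: "L \<le> ln 4" using 1 by linarith
    show ?thesis unfolding e' log_energy_mu_Gamma ereal_less_eq neg_le_iff_le using 2 3 by blast
  qed (simp add: log_energy_mu_Gamma)
  show "log_energy mu_Gamma \<le> log_energy \<nu>" by (rule conjunct1[OF *])
  show "\<nu> = mu_Gamma" if "log_energy \<nu> \<le> log_energy mu_Gamma"
    by (rule mp[OF conjunct2[OF *] that])
qed

lemma minimizes_log_energy_Gamma_iff: "minimizes_log_energy Gamma_curve \<nu> \<longleftrightarrow> \<nu> = mu_Gamma"
proof
  assume "minimizes_log_energy Gamma_curve \<nu>"
  then show "\<nu> = mu_Gamma"
    unfolding minimizes_log_energy_def
    by (intro log_energy_ge_mu_Gamma(2)) (auto simp: prob_measure_on_mu_Gamma)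
next
  assume "\<nu> = mu_Gamma"
  then show "minimizes_log_energy Gamma_curve \<nu>"
    unfolding minimizes_log_energy_def
    using prob_measure_on_mu_Gamma log_energy_ge_mu_Gamma(1) by simp
qed

lemma equilibrium_measure_Gamma: "equilibrium_measure Gamma_curve = mu_Gamma"
  by (simp add: equilibrium_measure_def minimizes_log_energy_Gamma_iff)

lemma logarithmic_capacity_Gamma: "logarithmic_capacity Gamma_curve = 4"
proof -
  have "robin_constant Gamma_curve = ereal (- ln 4)"
    unfolding robin_constant_def
  proof (rule INF_eqI)
    show "ereal (- ln 4) \<le> log_energy \<nu>" if "\<nu> \<in> {\<mu>. prob_measure_on Gamma_curve \<mu>}" for \<nu>
      using log_energy_ge_mu_Gamma(1)[of \<nu>] that log_energy_mu_Gamma by simp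
    show "y \<le> ereal (- ln 4)" if "\<And>\<nu>. \<nu> \<in> {\<mu>. prob_measure_on Gamma_curve \<mu>} \<Longrightarrow> y \<le> log_energy \<nu>" for y
      using that[of mu_Gamma] prob_measure_on_mu_Gamma log_energy_mu_Gamma by simp
  qed
  then show ?thesis by (simp add: logarithmic_capacity_def)
qed

subsection \<open>Weak-* convergence\<close>

lemma zero_avg_add: "zero_avg n (\<lambda>z. f z + g z) = zero_avg n f + zero_avg n g"
  by (simp add: zero_avg_def power_sum_def sum.distrib distrib_left add_divide_distrib)

lemma zero_avg_scale: "zero_avg n (\<lambda>z. c * f z) = c * zero_avg n f"
  by (simp add: zero_avg_def power_sum_def sum_distrib_left mult_ac)

lemma zero_avg_cnj: "zero_avg n (\<lambda>z. cnj (f z)) = cnj (zero_avg n f)"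
  by (simp add: zero_avg_def power_sum_def)

section \<open>The class of test functions whose averages converge\<close>

lemma set_integrable_Gamma:
  assumes "continuous_on Gamma_curve (f :: complex \<Rightarrow> complex)"
  shows "set_integrable mu_Gamma Gamma_curve f"
proof -
  interpret prob_space mu_Gamma by (rule prob_space_mu_Gamma)
  have "compact (f ` Gamma_curve)" using assms compact_Gamma by (rule compact_continuous_image)
  then obtain B where B: "\<And>z. z \<in> Gamma_curve \<Longrightarrow> norm (f z) \<le> B"
    by (meson bounded_iff compact_imp_bounded imageI)
  show ?thesis unfolding set_integrable_def
  proof (rule integrable_const_bound)
    show "AE z in mu_Gamma. norm (indicat_real Gamma_curve z *\<^sub>R f z) \<le> B"
      using AE_mu_Gamma by eventually_elim (use B in auto)
    have "(\<lambda>z. indicator Gamma_curve z *\<^sub>R f z) \<in> borel_measurable borel"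
      by (intro borel_measurable_continuous_on_indicator assms) auto
    then show "(\<lambda>z. indicat_real Gamma_curve z *\<^sub>R f z) \<in> borel_measurable mu_Gamma" by simp
  qed
qed

text \<open>The integral is restricted to the curve so that f need only be continuous on
  \<open>K_region\<close>; \<open>phi\<close>, for instance, has a pole outside it.\<close>

definition zero_avg_conv :: "(complex \<Rightarrow> complex) \<Rightarrow> bool" where
  "zero_avg_conv f \<longleftrightarrow> continuous_on K_region f \<and>
     (\<lambda>n. zero_avg n f) \<longlonglongrightarrow> (LINT z:Gamma_curve|mu_Gamma. f z)"

lemma zero_avg_conv_continuous: "zero_avg_conv f \<Longrightarrow> continuous_on Gamma_curve f"
  unfolding zero_avg_conv_def using Gamma_subset_K continuous_on_subset by blast

lemma zero_avg_conv_add: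
  assumes "zero_avg_conv f" "zero_avg_conv g"
  shows "zero_avg_conv (\<lambda>z. f z + g z)"
  using assms set_integrable_Gamma[OF zero_avg_conv_continuous[OF assms(1)]]
    set_integrable_Gamma[OF zero_avg_conv_continuous[OF assms(2)]]
  unfolding zero_avg_conv_def
  by (auto simp: zero_avg_add set_integral_add intro!: continuous_intros tendsto_intros)

lemma zero_avg_conv_scale:
  assumes "zero_avg_conv f"
  shows "zero_avg_conv (\<lambda>z. c * f z)"
  using assms unfolding zero_avg_conv_def
  by (auto simp: zero_avg_scale intro!: continuous_intros tendsto_intros)

text \<open>A three-epsilon argument; \<open>zero_avg_approx\<close> permits approximation on the
  curve alone.\<close>

lemma zero_avg_conv_uniform_limit:
  assumes f: "continuous_on K_region f"
    and approx: "\<And>\<epsilon>. \<epsilon> > 0 \<Longrightarrow> \<exists>g. zero_avg_conv g \<and> (\<forall>z\<in>Gamma_curve. norm (f z - g z) < \<epsilon>)"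
  shows "zero_avg_conv f"
  unfolding zero_avg_conv_def
proof (intro conjI f tendstoI)
  interpret prob_space mu_Gamma by (rule prob_space_mu_Gamma)
  fix \<epsilon> :: real assume "\<epsilon> > 0"
  then obtain g where g: "zero_avg_conv g" "\<And>z. z \<in> Gamma_curve \<Longrightarrow> norm (f z - g z) < \<epsilon> / 3"
    using approx[of "\<epsilon> / 3"] by auto
  have gK: "continuous_on K_region g" using g(1) by (simp add: zero_avg_conv_def)
  have I: "set_integrable mu_Gamma Gamma_curve f" "set_integrable mu_Gamma Gamma_curve g"
    using f gK Gamma_subset_K continuous_on_subset by (blast intro: set_integrable_Gamma)+
  have "norm (LINT z:Gamma_curve|mu_Gamma. f z - g z) \<le> (\<integral>z. \<epsilon> / 3 \<partial>mu_Gamma)"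
    unfolding set_lebesgue_integral_def
  proof (rule order_trans[OF integral_norm_bound integral_mono])
    show "norm (indicat_real Gamma_curve z *\<^sub>R (f z - g z)) \<le> \<epsilon> / 3" for z
      using g(2)[of z] \<open>\<epsilon> > 0\<close> by (auto simp: indicator_def intro: less_imp_le)
    show "integrable mu_Gamma (\<lambda>z. norm (indicat_real Gamma_curve z *\<^sub>R (f z - g z)))"
      using set_integral_diff(1)[OF I] unfolding set_integrable_def by (rule integrable_norm)
  qed auto
  then have d3: "norm ((LINT z:Gamma_curve|mu_Gamma. f z) - (LINT z:Gamma_curve|mu_Gamma. g z)) \<le> \<epsilon> / 3"
    using set_integral_diff(2)[OF I] by (simp add: prob_space[simplified])
  have "\<forall>\<^sub>F n in sequentially. norm (zero_avg n f - zero_avg n g) \<le> \<epsilon> / 3"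
    using \<open>\<epsilon> > 0\<close> g(2) by (intro zero_avg_approx f gK) auto
  moreover have "\<forall>\<^sub>F n in sequentially. dist (zero_avg n g) (LINT z:Gamma_curve|mu_Gamma. g z) < \<epsilon> / 3"
    using g(1) \<open>\<epsilon> > 0\<close> unfolding zero_avg_conv_def by (intro tendstoD) auto
  ultimately show "\<forall>\<^sub>F n in sequentially. dist (zero_avg n f) (LINT z:Gamma_curve|mu_Gamma. f z) < \<epsilon>"
  proof eventually_elim
    case (elim n)
    have "dist (zero_avg n f) (LINT z:Gamma_curve|mu_Gamma. f z) \<le>
      norm (zero_avg n f - zero_avg n g) + dist (zero_avg n g) (LINT z:Gamma_curve|mu_Gamma. g z)
      + norm ((LINT z:Gamma_curve|mu_Gamma. f z) - (LINT z:Gamma_curve|mu_Gamma. g z))"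
      by norm
    then show ?case using elim d3 by linarith
  qed
qed

text \<open>Makes identities valid only on the curve, such as cnj (phi z) = 1 / phi z, usable for
  averages over zeros off the curve.\<close>

lemma zero_avg_conv_cong_Gamma:
  assumes "continuous_on K_region f" "zero_avg_conv g" "\<And>z. z \<in> Gamma_curve \<Longrightarrow> f z = g z"
  shows "zero_avg_conv f"
  using assms by (intro zero_avg_conv_uniform_limit) auto

lemma continuous_on_phi_K: "continuous_on K_region phi"
  by (rule continuous_on_subset[OF continuous_on_phi]) (auto simp: K_region_def)

lemma set_integral_Gamma_eq:
  fixes f :: "complex \<Rightarrow> complex"
  assumes "f \<in> borel_measurable borel"
  shows "(LINT z:Gamma_curve|mu_Gamma. f z) = (\<integral>z. f z \<partial>mu_Gamma)"
  unfolding set_lebesgue_integral_def using assms AE_mu_Gamma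
  by (intro integral_cong_AE) (auto elim: eventually_mono)

lemma zero_avg_conv_phi_power: "zero_avg_conv (\<lambda>z. phi z ^ k)"
proof (cases "k = 0")
  case True
  interpret prob_space mu_Gamma by (rule prob_space_mu_Gamma)
  have "(\<lambda>n. zero_avg n (\<lambda>z. z powi 0)) \<longlonglongrightarrow> 1" using zero_avg_power_int[of 0] by simp
  then show ?thesis using True
    by (simp add: zero_avg_conv_def set_integral_Gamma_eq prob_space[simplified])
next
  case False
  then have "(LINT z:Gamma_curve|mu_Gamma. phi z ^ k) = 0"
    using integral_phi_power[of k] by (subst set_integral_Gamma_eq) auto
  then show ?thesis using zero_avg_phi_power[of k] False
    by (auto simp: zero_avg_conv_def intro!: continuous_intros continuous_on_phi_K)
qed

lemma zero_avg_conv_cnj: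
  assumes "zero_avg_conv f"
  shows "zero_avg_conv (\<lambda>z. cnj (f z))"
proof -
  have "(LINT z:Gamma_curve|mu_Gamma. cnj (f z)) = cnj (LINT z:Gamma_curve|mu_Gamma. f z)"
    unfolding set_lebesgue_integral_def by (simp flip: Bochner_Integration.integral_cnj)
  then show ?thesis using assms unfolding zero_avg_conv_def zero_avg_cnj
    by (auto intro!: continuous_intros tendsto_intros)
qed

text \<open>On \<open>Gamma_curve\<close> this is \<open>phi z powi k\<close>; off the curve, the conjugate keeps negative
  indices within reach of the moment computation.\<close>

definition phi_int :: "int \<Rightarrow> complex \<Rightarrow> complex" where
  "phi_int k z = (if k \<ge> 0 then phi z ^ nat k else cnj (phi z) ^ nat (- k))"

lemma zero_avg_conv_phi_int: "zero_avg_conv (phi_int k)"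
  using zero_avg_conv_phi_power[of "nat k"] zero_avg_conv_cnj[OF zero_avg_conv_phi_power[of "nat (- k)"]]
  by (cases "k \<ge> 0") (simp_all add: phi_int_def[abs_def])

lemma phi_int_Gamma:
  assumes "z \<in> Gamma_curve"
  shows "phi_int k z = phi z powi k"
proof -
  have "norm (phi z) = 1" using assms by (simp add: Gamma_curve_def)
  then have "phi z * cnj (phi z) = 1" by (simp add: complex_norm_square[symmetric])
  then have "inverse (phi z) = cnj (phi z)" by (rule inverse_unique)
  then show ?thesis by (simp add: phi_int_def power_int_def)
qed

text \<open>On the curve, multiplication by \<open>phi\<close> or its conjugate shifts the index of
  \<open>phi_int\<close> by one, so the condition for all k is stable under both.\<close>

lemma zero_avg_conv_polynomial:
  assumes "real_polynomial_function g"
  shows "zero_avg_conv (\<lambda>z. of_real (g (phi z)))"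
proof -
  define A where "A = {f. continuous_on K_region f \<and> (\<forall>k. zero_avg_conv (\<lambda>z. f z * phi_int k z))}"
  have phi_intK: "continuous_on K_region (phi_int k)" for k
    using zero_avg_conv_phi_int by (simp add: zero_avg_conv_def)
  have phi_Gamma: "norm (phi z) = 1" "phi z \<noteq> 0" if "z \<in> Gamma_curve" for z
    using that by (auto simp: Gamma_curve_def)
  have "(\<lambda>z. of_real (g (phi z)) * 1) \<in> A"
  proof (rule real_polynomial_multiplier[OF _ _ _ _ assms])
    fix f1 f2 assume "f1 \<in> A" "f2 \<in> A"
    then show "(\<lambda>z. f1 z + f2 z) \<in> A"
      by (auto simp: A_def distrib_right intro: continuous_intros zero_avg_conv_add)
  next
    fix f c assume "f \<in> A"
    then show "(\<lambda>z. c * f z) \<in> A"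
      by (auto simp: A_def mult.assoc intro: continuous_intros zero_avg_conv_scale)
  next
    fix f assume f: "f \<in> A"
    then have fc: "continuous_on K_region f" by (simp add: A_def)
    have "zero_avg_conv (\<lambda>z. (phi z * f z) * phi_int k z)" for k
    proof (rule zero_avg_conv_cong_Gamma)
      show "continuous_on K_region (\<lambda>z. (phi z * f z) * phi_int k z)"
        by (intro continuous_intros fc phi_intK continuous_on_phi_K)
      show "zero_avg_conv (\<lambda>z. f z * phi_int (k + 1) z)" using f by (simp add: A_def)
      show "(phi z * f z) * phi_int k z = f z * phi_int (k + 1) z" if "z \<in> Gamma_curve" for z
        using that phi_Gamma[OF that] by (simp add: phi_int_Gamma power_int_add_1)
    qed
    then show "(\<lambda>z. phi z * f z) \<in> A"
      by (auto simp: A_def intro!: continuous_intros fc continuous_on_phi_K)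
    have "zero_avg_conv (\<lambda>z. (cnj (phi z) * f z) * phi_int k z)" for k
    proof (rule zero_avg_conv_cong_Gamma)
      show "continuous_on K_region (\<lambda>z. (cnj (phi z) * f z) * phi_int k z)"
        by (intro continuous_intros fc phi_intK continuous_on_phi_K)
      show "zero_avg_conv (\<lambda>z. f z * phi_int (k - 1) z)" using f by (simp add: A_def)
      show "(cnj (phi z) * f z) * phi_int k z = f z * phi_int (k - 1) z" if "z \<in> Gamma_curve" for z
      proof -
        have "phi_int (k - 1) z = phi_int k z * cnj (phi z)"
        proof -
          have "cnj (phi z) = inverse (phi z)"
            using phi_int_Gamma[OF that, of "-1"] by (simp add: phi_int_def)
          then show ?thesis
            using phi_Gamma[OF that] by (simp add: phi_int_Gamma[OF that] power_int_diff divide_inverse)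
        qed
        then show ?thesis by (simp add: mult_ac)
      qed
    qed
    then show "(\<lambda>z. cnj (phi z) * f z) \<in> A"
      by (auto simp: A_def intro!: continuous_intros fc continuous_on_phi_K)
  next
    show "(\<lambda>_. 1) \<in> A" using zero_avg_conv_phi_int by (simp add: A_def)
  qed
  then have "zero_avg_conv (\<lambda>z. of_real (g (phi z)) * phi_int 0 z)" by (simp add: A_def)
  then show ?thesis by (simp add: phi_int_def)
qed

text \<open>Stone-Weierstrass on the circle, applied after composing f with \<open>psi\<close> and
  carried back to the curve by \<open>phi\<close>.\<close>

lemma zero_avg_conv_real:
  fixes f :: "complex \<Rightarrow> real"
  assumes "continuous_on K_region f"
  shows "zero_avg_conv (\<lambda>z. of_real (f z))"
proof (rule zero_avg_conv_uniform_limit)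
  show "continuous_on K_region (\<lambda>z. complex_of_real (f z))" using assms by (intro continuous_intros)
  fix \<epsilon> :: real assume "\<epsilon> > 0"
  have "continuous_on (sphere 0 1) (\<lambda>w. f (psi w))"
    by (rule continuous_on_compose2[OF assms continuous_on_psi])
       (use psi_in_Gamma Gamma_subset_K in auto)
  then obtain g where g: "real_polynomial_function g" "\<And>w. w \<in> sphere 0 1 \<Longrightarrow> \<bar>f (psi w) - g w\<bar> < \<epsilon>"
    using Stone_Weierstrass_real_polynomial_function[OF compact_sphere _ \<open>\<epsilon> > 0\<close>] by blast
  have "norm (complex_of_real (f z) - of_real (g (phi z))) < \<epsilon>" if "z \<in> Gamma_curve" for z
    using g(2)[of "phi z"] that psi_phi[OF that]
    by (simp add: Gamma_curve_def flip: of_real_diff)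
  then show "\<exists>h. zero_avg_conv h \<and> (\<forall>z\<in>Gamma_curve. norm (complex_of_real (f z) - h z) < \<epsilon>)"
    using zero_avg_conv_polynomial[OF g(1)] by blast
qed

lemma zero_avg_conv_continuous_function:
  assumes "continuous_on K_region f"
  shows "zero_avg_conv f"
proof -
  have "zero_avg_conv (\<lambda>z. of_real (Re (f z)) + \<i> * of_real (Im (f z)))"
    using assms by (intro zero_avg_conv_add zero_avg_conv_scale zero_avg_conv_real continuous_intros)
  then show ?thesis by (simp add: complex_eq[symmetric])
qed

lemma integral_zero_counting_measure:
  fixes f :: "complex \<Rightarrow> complex"
  assumes "f \<in> borel_measurable borel"
  shows "(\<integral>z. f z \<partial>zero_counting_measure (Q n n)) = zero_avg n f"
proof -
  have "(\<integral>z. f z \<partial>zero_counting_measure (Q n n)) =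
    (\<integral>z. f z \<partial>density (count_space (zeros n)) (\<lambda>z. ennreal (real (order z (Q n n)) / real n)))"
    unfolding zero_counting_measure_def zeros_def degree_Q using assms by (intro integral_distr) auto
  also have "\<dots> = (\<integral>z. (real (order z (Q n n)) / real n) *\<^sub>R f z \<partial>count_space (zeros n))"
    by (intro integral_density) auto
  also have "\<dots> = (\<Sum>z\<in>zeros n. (real (order z (Q n n)) / real n) *\<^sub>R f z)"
    by (rule lebesgue_integral_count_space_finite[OF finite_zeros])
  also have "\<dots> = zero_avg n f"
    by (simp add: zero_avg_def power_sum_def sum_divide_distrib scaleR_conv_of_real)
  finally show ?thesis .
qed

lemma weak_star_conv_zeros: "weak_star_conv (\<lambda>n. zero_counting_measure (Q n n)) mu_Gamma"
  unfolding weak_star_conv_def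
proof (intro allI impI, elim conjE)
  fix f :: "complex \<Rightarrow> complex" assume f: "continuous_on UNIV f"
  have m: "f \<in> borel_measurable borel" using f by (rule borel_measurable_continuous_onI)
  have "zero_avg_conv f"
    by (rule zero_avg_conv_continuous_function) (rule continuous_on_subset[OF f], simp)
  then show "(\<lambda>n. \<integral>z. f z \<partial>zero_counting_measure (Q n n)) \<longlonglongrightarrow> (\<integral>z. f z \<partial>mu_Gamma)"
    by (simp add: integral_zero_counting_measure[OF m] zero_avg_conv_def set_integral_Gamma_eq[OF m])
qed

theorem corollary1:
  shows "(\<exists>!\<mu>. minimizes_log_energy Gamma_curve \<mu>)
    \<and> weak_star_conv (\<lambda>n. zero_counting_measure (Q n n)) (equilibrium_measure Gamma_curve)
    \<and> measure_support (equilibrium_measure Gamma_curve) = Gamma_curve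
    \<and> (\<forall>B \<in> sets borel.
          emeasure (equilibrium_measure Gamma_curve) B = emeasure circle_measure (phi ` (B \<inter> Gamma_curve)))
    \<and> logarithmic_capacity Gamma_curve = 4
    \<and> (\<exists>N. \<forall>m. \<forall>n \<ge> max N m. \<forall>z. poly (Q n m) z = 0 \<longrightarrow> z \<in> inside Gamma_curve)"
  unfolding equilibrium_measure_Gamma
proof (intro conjI ballI)
  show "\<exists>!\<mu>. minimizes_log_energy Gamma_curve \<mu>"
    by (simp add: minimizes_log_energy_Gamma_iff)
  \<comment> \<open>\<open>zeros_not_exterior\<close> holds at every n >= m, without an asymptotic
    threshold, so 0 is a witness.\<close>
  show "\<exists>N. \<forall>m. \<forall>n \<ge> max N m. \<forall>z. poly (Q n m) z = 0 \<longrightarrow> z \<in> inside Gamma_curve"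
    using zeros_not_exterior inside_Gamma by (intro exI[of _ 0]) auto
qed (simp_all add: weak_star_conv_zeros measure_support_mu_Gamma emeasure_mu_Gamma logarithmic_capacity_Gamma)

end
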